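(* Let $L$ be the generator of a one-dimensional diffusion on $I$ with discrete spectrum $0\ge-\lambda_1>-\lambda_2>\cdots$ and corresponding eigenfunctions $\phi_1,\phi_2,\dots$, and let $n\ge1$. Then the function $$h_n(x)=\det(\phi_i(x_j))_{i,j=1}^n$$ is the ground state of the Karlin-McGregor semigroup $P_t^n$ of $n$ independent copies of the diffusion killed when they intersect.
   Context: $I$ is an interval with endpoints $l<r$, $I^\circ=(l,r)$, $W^n(I^\circ)=\{l<x_1\le\cdots\le x_n<r\}$. $L=a(x)\frac{d^2}{dx^2}+b(x)\frac d{dx}$ with $a\in C^1(I^\circ)$, $a>0$, $b\in C(I^\circ)$; its speed density is $m(x)=\frac1{s'(x)a(x)}$ with $s'(x)=\exp(-\int_c^x\frac ba)$, $c\in I^\circ$. Discrete spectrum means: $L\phi_k=-\lambda_k\phi_k$, where $\{\phi_k\}_{k\ge1}$ is an orthonormal basis of $L^2(I,m(x)dx)$, and the transition density of the diffusion on $I^\circ$ with respect to $m(dy)$ is $q_t(x,y)=\sum_{k\ge1}e^{-\lambda_kt}\phi_k(x)\phi_k(y)$, converging uniformly on compact squares of $I^\circ\times I^\circ$. $P_t^n$ is the semigroup on $W^n(I^\circ)$ with density $\det(q_t(x_i,y_j))_{i,j=1}^n$ with respect to $\prod_{i=1}^nm(y_i)dy_i$. "Ground state" means the minimal positive eigenfunction: $h_n$ is (up to multiplication by $-1$) non-negative and $P_t^nh_n=e^{-\sum_{i=1}^n\lambda_it}h_n$, with $\sum_{i=1}^n\lambda_i$ the bottom of the spectrum of minus the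 generator of $P_t^n$ in $L^2(W^n(I^\circ),\prod_im(x_i)dx_i)$. The eigenfunctions $\phi_i$ are determined only up to sign, so $h_n$ is understood up to sign. *)

theory Defs
  imports "HOL-Probability.Probability" "Jordan_Normal_Form.Determinant"
begin

text \<open>
  The open interval \<open>(l, r)\<close> with endpoints in the extended reals is \<open>einterval l r\<close>.
  All sequences and coordinates are indexed from 0: \<open>\<phi> k\<close> and \<open>lam k\<close> are the
  \<open>(k+1)\<close>-st eigenfunction and eigenvalue, and points of the chamber are
  \<open>x 0 \<le> \<dots> \<le> x (n - 1)\<close>.
\<close>

section \<open>The operator and its speed measure\<close>

definition C2_on :: "(real \<Rightarrow> real) \<Rightarrow> real set \<Rightarrow> bool" where
  "C2_on f S \<longleftrightarrow> f C1_differentiable_on S \<and> deriv f C1_differentiable_on S"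

definition diff_op :: "(real \<Rightarrow> real) \<Rightarrow> (real \<Rightarrow> real) \<Rightarrow> (real \<Rightarrow> real) \<Rightarrow> real \<Rightarrow> real" where
  "diff_op a b f x = a x * deriv (deriv f) x + b x * deriv f x"

definition scale_deriv :: "(real \<Rightarrow> real) \<Rightarrow> (real \<Rightarrow> real) \<Rightarrow> real \<Rightarrow> real \<Rightarrow> real" where
  "scale_deriv a b c x = exp (- (LBINT y=ereal c..ereal x. b y / a y))"

definition speed_density :: "(real \<Rightarrow> real) \<Rightarrow> (real \<Rightarrow> real) \<Rightarrow> real \<Rightarrow> real \<Rightarrow> real" where
  "speed_density a b c x = 1 / (scale_deriv a b c x * a x)"

text \<open>
  The measure \<open>m(x) dx\<close>. It lives on the open interval, on which the density is defined; finite
  endpoints are Lebesgue-null, so its L2 space is that of any interval with these endpoints.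
\<close>

definition speed_measure ::
  "ereal \<Rightarrow> ereal \<Rightarrow> (real \<Rightarrow> real) \<Rightarrow> (real \<Rightarrow> real) \<Rightarrow> real \<Rightarrow> real measure" where
  "speed_measure l r a b c =
     density (restrict_space lborel (einterval l r)) (\<lambda>x. ennreal (speed_density a b c x))"

section \<open>One-dimensional diffusions\<close>

definition natural_filtration ::
  "'w measure \<Rightarrow> (real \<Rightarrow> 'w \<Rightarrow> ereal) \<Rightarrow> real \<Rightarrow> 'w measure" where
  "natural_filtration Om X t =
     sigma (space Om) {X s -` B \<inter> space Om | s B. 0 \<le> s \<and> s \<le> t \<and> B \<in> sets borel}"

lemma filtration_natural_filtration: "filtration (space Om) (natural_filtration Om X)"
proof
  show "space (natural_filtration Om X t) = space Om" for t
    unfolding natural_filtration_def by (rule space_measure_of) auto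
next
  fix s t :: real assume "s \<le> t"
  then show "sets (natural_filtration Om X s) \<le> sets (natural_filtration Om X t)"
    unfolding natural_filtration_def
    by (subst (1 2) sets_measure_of) (force intro!: sigma_sets_mono')+
qed

text \<open>
  The family of laws \<open>P x\<close> on a common measurable space \<open>Om\<close> is a diffusion on the interval \<open>I\<close> with
  endpoints \<open>l < r\<close>: a strong Markov process with continuous paths. The paths are continuous in
  the closed interval \<open>{l..r}\<close> of the extended reals. An endpoint outside \<open>I\<close> serves as cemetery:
  a path which reaches it (explosion, or killing at the boundary) stays there. Nothing is
  prescribed at endpoints belonging to \<open>I\<close>, which may be reflecting, absorbing, or entrance points.
\<close>

definition strong_markov ::
  "'w measure \<Rightarrow> (ereal \<Rightarrow> 'w measure) \<Rightarrow> (real \<Rightarrow> 'w \<Rightarrow> ereal) \<Rightarrow> ereal set \<Rightarrow> bool" where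
  "strong_markov Om P X S \<longleftrightarrow>
     (\<forall>x\<in>S. \<forall>T. stopping_time (natural_filtration Om X) T \<and> (\<forall>\<omega>\<in>space Om. 0 \<le> T \<omega>) \<longrightarrow>
       (\<forall>A\<in>sets (filtration.pre_sigma (space Om) (natural_filtration Om X) T).
          \<forall>s\<ge>0. \<forall>B\<in>sets borel.
            emeasure (P x) {\<omega>\<in>A. X (T \<omega> + s) \<omega> \<in> B} =
            (\<integral>\<^sup>+ \<omega>\<in>A. emeasure (P (X (T \<omega>) \<omega>)) {\<omega>'\<in>space Om. X s \<omega>' \<in> B} \<partial>P x)))"

definition diffusion ::
  "ereal \<Rightarrow> ereal \<Rightarrow> real set \<Rightarrow> 'w measure \<Rightarrow> (ereal \<Rightarrow> 'w measure) \<Rightarrow> (real \<Rightarrow> 'w \<Rightarrow> ereal) \<Rightarrow> bool"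
where
  "diffusion l r I Om P X \<longleftrightarrow>
     einterval l r \<subseteq> I \<and> ereal ` I \<subseteq> {l..r} \<and>
     P \<in> restrict_space borel {l..r} \<rightarrow>\<^sub>M prob_algebra Om \<and>
     (\<forall>t\<ge>0. X t \<in> Om \<rightarrow>\<^sub>M borel) \<and>
     (\<forall>\<omega>\<in>space Om. continuous_on {0..} (\<lambda>t. X t \<omega>) \<and> (\<forall>t\<ge>0. X t \<omega> \<in> {l..r})) \<and>
     (\<forall>x\<in>{l..r}. AE \<omega> in P x. X 0 \<omega> = x) \<and>
     (\<forall>x\<in>{l..r} - ereal ` I. \<forall>t\<ge>0. AE \<omega> in P x. X t \<omega> = x) \<and>
     strong_markov Om P X {l..r}"

text \<open>
  Evaluation of a function on \<open>(l, r)\<close> at an extended real, with value 0 off \<open>(l, r)\<close>; it is only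
  used for functions with compact support in \<open>(l, r)\<close>.
\<close>

definition zero_ext :: "ereal \<Rightarrow> ereal \<Rightarrow> (real \<Rightarrow> real) \<Rightarrow> ereal \<Rightarrow> real" where
  "zero_ext l r f z = (if l < z \<and> z < r then f (real_of_ereal z) else 0)"

definition has_generator ::
  "ereal \<Rightarrow> ereal \<Rightarrow> (ereal \<Rightarrow> 'w measure) \<Rightarrow> (real \<Rightarrow> 'w \<Rightarrow> ereal) \<Rightarrow>
   (real \<Rightarrow> real) \<Rightarrow> (real \<Rightarrow> real) \<Rightarrow> bool" where
  "has_generator l r P X a b \<longleftrightarrow>
     (\<forall>f K. C2_on f (einterval l r) \<and> compact K \<and> K \<subseteq> einterval l r \<and>
            (\<forall>x\<in>einterval l r - K. f x = 0) \<longrightarrow>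
       (\<forall>x\<in>einterval l r.
          ((\<lambda>t. ((\<integral>\<omega>. zero_ext l r f (X t \<omega>) \<partial>P (ereal x)) - f x) / t)
             \<longlongrightarrow> diff_op a b f x) (at_right 0)))"

definition has_transition_density ::
  "ereal \<Rightarrow> ereal \<Rightarrow> 'w measure \<Rightarrow> (ereal \<Rightarrow> 'w measure) \<Rightarrow> (real \<Rightarrow> 'w \<Rightarrow> ereal) \<Rightarrow>
   real measure \<Rightarrow> (real \<Rightarrow> real \<Rightarrow> real \<Rightarrow> real) \<Rightarrow> bool" where
  "has_transition_density l r Om P X M q \<longleftrightarrow>
     (\<forall>t>0. \<forall>x\<in>einterval l r.
        q t x \<in> borel_measurable M \<and> (\<forall>y\<in>einterval l r. 0 \<le> q t x y) \<and>
        (\<forall>B\<in>sets M. emeasure (P (ereal x)) {\<omega>\<in>space Om. X t \<omega> \<in> ereal ` B} =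
                     (\<integral>\<^sup>+ y\<in>B. ennreal (q t x y) \<partial>M)))"

section \<open>L2 spaces\<close>

text \<open>Elements of \<open>L\<^sup>2(M)\<close> are represented by functions, up to equality almost everywhere.\<close>

definition L2 :: "'a measure \<Rightarrow> ('a \<Rightarrow> real) set" where
  "L2 M = {f \<in> borel_measurable M. integrable M (\<lambda>x. (f x)\<^sup>2)}"

definition l2_norm :: "'a measure \<Rightarrow> ('a \<Rightarrow> real) \<Rightarrow> real" where
  "l2_norm M f = sqrt (\<integral>x. (f x)\<^sup>2 \<partial>M)"

definition l2_orthonormal_basis :: "'a measure \<Rightarrow> (nat \<Rightarrow> 'a \<Rightarrow> real) \<Rightarrow> bool" where
  "l2_orthonormal_basis M \<phi> \<longleftrightarrow>
     (\<forall>k. \<phi> k \<in> L2 M) \<and>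
     (\<forall>j k. (\<integral>x. \<phi> j x * \<phi> k x \<partial>M) = (if j = k then 1 else 0)) \<and>
     (\<forall>f\<in>L2 M. \<forall>\<epsilon>>0. \<exists>N d. l2_norm M (\<lambda>x. f x - (\<Sum>k<N. d k * \<phi> k x)) < \<epsilon>)"

text \<open>
  An unbounded operator on \<open>L\<^sup>2(M)\<close> is given by its graph \<open>G\<close>. The number \<open>\<mu>\<close> is in the resolvent
  set iff \<open>G - \<mu>\<close> is a bijection from the domain onto \<open>L\<^sup>2(M)\<close> with bounded inverse. The Hilbert
  space is real and so is the spectrum: this is used for self-adjoint operators only.
\<close>

definition l2_resolvent_set ::
  "'a measure \<Rightarrow> (('a \<Rightarrow> real) \<Rightarrow> ('a \<Rightarrow> real) \<Rightarrow> bool) \<Rightarrow> real set" where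
  "l2_resolvent_set M G = {\<mu>.
     (\<exists>C. \<forall>f g. G f g \<longrightarrow> l2_norm M f \<le> C * l2_norm M (\<lambda>x. g x - \<mu> * f x)) \<and>
     (\<forall>u\<in>L2 M. \<exists>f g. G f g \<and> (AE x in M. g x - \<mu> * f x = u x))}"

definition l2_spectrum ::
  "'a measure \<Rightarrow> (('a \<Rightarrow> real) \<Rightarrow> ('a \<Rightarrow> real) \<Rightarrow> bool) \<Rightarrow> real set" where
  "l2_spectrum M G = UNIV - l2_resolvent_set M G"

section \<open>Kernel semigroups and their ground states\<close>

definition kernel_semigroup ::
  "'a measure \<Rightarrow> (real \<Rightarrow> 'a \<Rightarrow> 'a \<Rightarrow> real) \<Rightarrow> real \<Rightarrow> ('a \<Rightarrow> real) \<Rightarrow> 'a \<Rightarrow> real" where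
  "kernel_semigroup M p t f x = (\<integral>y. p t x y * f y \<partial>M)"

text \<open>
  Graph of the infinitesimal generator in \<open>L\<^sup>2(M)\<close>: \<open>(T\<^sub>t f - f) / t \<longrightarrow> g\<close> in \<open>L\<^sup>2(M)\<close>.
  The nonnegative integral is used because, unlike the Bochner integral, it is not 0 for functions
  which fail to be square integrable.
\<close>

definition l2_generator ::
  "'a measure \<Rightarrow> (real \<Rightarrow> ('a \<Rightarrow> real) \<Rightarrow> 'a \<Rightarrow> real) \<Rightarrow> ('a \<Rightarrow> real) \<Rightarrow> ('a \<Rightarrow> real) \<Rightarrow> bool" where
  "l2_generator M T f g \<longleftrightarrow>
     f \<in> L2 M \<and> g \<in> L2 M \<and>
     ((\<lambda>t. \<integral>\<^sup>+ x. ennreal (((T t f x - f x) / t - g x)\<^sup>2) \<partial>M) \<longlongrightarrow> 0) (at_right 0)"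

text \<open>
  The infimum is taken in the extended reals, so that \<open>is_spectral_bottom M T E\<close> includes that the
  spectrum of minus the generator is nonempty and bounded below.
\<close>

definition is_spectral_bottom ::
  "'a measure \<Rightarrow> (real \<Rightarrow> ('a \<Rightarrow> real) \<Rightarrow> 'a \<Rightarrow> real) \<Rightarrow> real \<Rightarrow> bool" where
  "is_spectral_bottom M T E \<longleftrightarrow>
     Inf (ereal ` l2_spectrum M (\<lambda>f g. l2_generator M T f (\<lambda>x. - g x))) = ereal E"

definition is_ground_state ::
  "'a measure \<Rightarrow> (real \<Rightarrow> 'a \<Rightarrow> 'a \<Rightarrow> real) \<Rightarrow> ('a \<Rightarrow> real) \<Rightarrow> real \<Rightarrow> bool" where
  "is_ground_state M p h E \<longleftrightarrow>
     h \<in> L2 M \<and> \<not> (AE x in M. h x = 0) \<and>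
     (\<forall>x\<in>space M. 0 \<le> h x) \<and>
     (\<forall>t>0. \<forall>x\<in>space M. integrable M (\<lambda>y. p t x y * h y) \<and>
                          kernel_semigroup M p t h x = exp (- E * t) * h x) \<and>
     is_spectral_bottom M (kernel_semigroup M p) E"

section \<open>The Karlin-McGregor semigroup\<close>

definition weyl_chamber :: "nat \<Rightarrow> real set \<Rightarrow> (nat \<Rightarrow> real) set" where
  "weyl_chamber n J = {x \<in> {..<n} \<rightarrow>\<^sub>E J. \<forall>i j. i < j \<and> j < n \<longrightarrow> x i \<le> x j}"

definition chamber_measure :: "nat \<Rightarrow> real measure \<Rightarrow> (nat \<Rightarrow> real) measure" where
  "chamber_measure n M = restrict_space (Pi\<^sub>M {..<n} (\<lambda>_. M)) (weyl_chamber n (space M))"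

definition karlin_mcgregor_density ::
  "nat \<Rightarrow> (real \<Rightarrow> real \<Rightarrow> real \<Rightarrow> real) \<Rightarrow> real \<Rightarrow> (nat \<Rightarrow> real) \<Rightarrow> (nat \<Rightarrow> real) \<Rightarrow> real" where
  "karlin_mcgregor_density n q t x y = Determinant.det (mat n n (\<lambda>(i, j). q t (x i) (y j)))"

section \<open>Discrete spectrum\<close>

definition discrete_spectrum ::
  "ereal \<Rightarrow> ereal \<Rightarrow> (real \<Rightarrow> real) \<Rightarrow> (real \<Rightarrow> real) \<Rightarrow> real measure \<Rightarrow>
   (real \<Rightarrow> real \<Rightarrow> real \<Rightarrow> real) \<Rightarrow> (nat \<Rightarrow> real) \<Rightarrow> (nat \<Rightarrow> real \<Rightarrow> real) \<Rightarrow> bool" where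
  "discrete_spectrum l r a b M q lam \<phi> \<longleftrightarrow>
     0 \<le> lam 0 \<and> strict_mono lam \<and>
     (\<forall>k. C2_on (\<phi> k) (einterval l r) \<and>
          (\<forall>x\<in>einterval l r. diff_op a b (\<phi> k) x = - lam k * \<phi> k x)) \<and>
     l2_orthonormal_basis M \<phi> \<and>
     (\<forall>t>0. \<forall>K. compact K \<and> K \<subseteq> einterval l r \<longrightarrow>
        uniform_limit (K \<times> K)
          (\<lambda>N (x, y). \<Sum>k<N. exp (- lam k * t) * \<phi> k x * \<phi> k y) (\<lambda>(x, y). q t x y) sequentially)"

end

theory Submission
  imports Defs
begin

text \<open>
  Write \<open>e\<^sub>k(x) = det (\<phi>\<^bsub>k i\<^esub>(x j))\<close> for strictly increasing tuples \<open>k\<close>. By Andreief's identity these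
  functions are orthonormal on the chamber, they are complete because the tensor products of the
  \<open>\<phi>\<^sub>k\<close> are, and the Karlin-McGregor semigroup multiplies \<open>e\<^sub>k\<close> by \<open>exp (- \<Sum>lam (k i) * t)\<close>. So its
  generator is diagonal and the bottom of the spectrum belongs to the first tuple, whose function is \<open>h\<close>.

  That \<open>h\<close> has a constant sign is derived from the one-dimensional Green kernel
  \<open>G(x, y) = \<integral> exp(-t) q\<^sub>t(x, y) dt = \<Sum>\<phi>\<^sub>k(x) \<phi>\<^sub>k(y) / (1 + lam k)\<close>, which avoids colliding particles.
  Continuity of the paths and the strong Markov property at the first passage time of \<open>z\<close>
  give \<open>G(x, y) = \<psi>(x, z) G(z, y)\<close> for \<open>x < z < y\<close>, hence \<open>G(x, y) G(z, z) = G(x, z) G(z, y)\<close>, and such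
  kernels are totally positive. Total positivity passes to the iterates of \<open>G\<close>, and as their
  number tends to infinity the leading term of \<open>det (G\<^sup>N(x i, y j))\<close> is a positive multiple of \<open>h(x) h(y)\<close>.
\<close>

section \<open>Expansions in \<open>L\<^sup>2\<close>\<close>

text \<open>That \<open>h\<close> is an eigenfunction is only half of the claim: placing its
  eigenvalue at the bottom of the spectrum needs a complete diagonalisation, hence the completeness
  proof on the chamber. This does not give the sign. Determinants of \<open>q t\<close> have a sign
  by an argument about n paths; determinants of \<open>G\<close> need one path only, as the
  factorisation at an intermediate point reduces them to products of 2 by 2 minors.

  The obstacle is regularity. Passage through \<open>z\<close> is an identity of measures, so it
  holds for almost every \<open>y\<close>, while the determinants are needed at every point.
  Continuity of \<open>G\<close> needs control of the tails of its series, that is of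
  \<open>G\<close> on the diagonal, and a priori \<open>G(z, z)\<close> could be infinite. The bound
  comes from symmetry and the same passage identity, applied to averages.

  The weight \<open>exp(-t)\<close> makes the multipliers \<open>1 / (1 + lam k)\<close> finite and
  at most 1 even if \<open>lam 0 = 0\<close>. As they decrease strictly, the first tuple has the
  strictly largest product, and powers of the kernel single out \<open>h\<close>.\<close>

lemma tendsto_0_squeeze:
  fixes f g :: "'a \<Rightarrow> real"
  assumes "(g \<longlongrightarrow> 0) F" "\<And>x. 0 \<le> f x" "\<And>x. f x \<le> g x"
  shows "(f \<longlongrightarrow> 0) F"
  by (rule tendsto_sandwich[OF _ _ tendsto_const assms(1)]) (use assms in auto)

lemma L2_integrable_mult:
  assumes "f \<in> L2 M" "g \<in> L2 M"
  shows "integrable M (\<lambda>x. f x * g x)"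
proof (rule Bochner_Integration.integrable_bound)
  show "integrable M (\<lambda>x. (f x)\<^sup>2 + (g x)\<^sup>2)"
    using assms by (auto simp: L2_def)
  show "(\<lambda>x. f x * g x) \<in> borel_measurable M"
    using assms by (auto simp: L2_def)
  have "\<bar>u * v\<bar> \<le> u\<^sup>2 + v\<^sup>2" for u v :: real
    using sum_squares_bound[of u v] sum_squares_bound[of u "- v"] by (auto simp: abs_if)
  then show "AE x in M. norm (f x * g x) \<le> norm ((f x)\<^sup>2 + (g x)\<^sup>2)"
    by auto
qed

lemma L2_cmult: "f \<in> L2 M \<Longrightarrow> (\<lambda>x. c * f x) \<in> L2 M"
  by (auto simp: L2_def power_mult_distrib)

lemma L2_add:
  assumes "f \<in> L2 M" "g \<in> L2 M"
  shows "(\<lambda>x. f x + g x) \<in> L2 M"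
  using assms L2_integrable_mult[OF assms]
  by (auto simp: L2_def power2_sum mult.assoc)

lemma L2_diff:
  assumes "f \<in> L2 M" "g \<in> L2 M"
  shows "(\<lambda>x. f x - g x) \<in> L2 M"
  using L2_add[OF assms(1) L2_cmult[OF assms(2), of "-1"]] by simp

lemma L2_sum:
  "(\<And>i. i \<in> A \<Longrightarrow> f i \<in> L2 M) \<Longrightarrow> (\<lambda>x. \<Sum>i\<in>A. f i x) \<in> L2 M"
proof (induction A rule: infinite_finite_induct)
  case (insert a A)
  then show ?case by (simp add: L2_add)
qed (simp_all add: L2_def)

lemma L2_measurable: "f \<in> L2 M \<Longrightarrow> f \<in> borel_measurable M"
  by (simp add: L2_def)

lemma L2_integrable_square: "f \<in> L2 M \<Longrightarrow> integrable M (\<lambda>x. (f x)\<^sup>2)"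
  by (simp add: L2_def)

lemma L2_Cauchy_Schwarz:
  assumes f: "f \<in> L2 M" and g: "g \<in> L2 M"
  shows "(\<integral>x. f x * g x \<partial>M)\<^sup>2 \<le> (\<integral>x. (f x)\<^sup>2 \<partial>M) * (\<integral>x. (g x)\<^sup>2 \<partial>M)"
proof -
  note i = L2_integrable_square[OF f] L2_integrable_square[OF g] L2_integrable_mult[OF f g]
  define A where "A = (\<integral>x. (f x)\<^sup>2 \<partial>M)"
  define B where "B = (\<integral>x. (g x)\<^sup>2 \<partial>M)"
  define D where "D = (\<integral>x. f x * g x \<partial>M)"
  have q: "0 \<le> s\<^sup>2 * A - 2 * s * t * D + t\<^sup>2 * B" for s t
  proof -
    have "0 \<le> (\<integral>x. (s * f x - t * g x)\<^sup>2 \<partial>M)" by simp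
    also have "(\<lambda>x. (s * f x - t * g x)\<^sup>2) = (\<lambda>x. s\<^sup>2 * (f x)\<^sup>2 - 2 * s * t * (f x * g x) + t\<^sup>2 * (g x)\<^sup>2)"
      by (auto simp: power2_eq_square algebra_simps)
    also have "(\<integral>x. s\<^sup>2 * (f x)\<^sup>2 - 2 * s * t * (f x * g x) + t\<^sup>2 * (g x)\<^sup>2 \<partial>M)
       = s\<^sup>2 * A - 2 * s * t * D + t\<^sup>2 * B"
      using i by (simp add: A_def B_def D_def)
    finally show ?thesis .
  qed
  have B: "0 \<le> B" by (simp add: B_def)
  show ?thesis
  proof (cases "B = 0")
    case True
    \<comment> \<open>For \<open>B = 0\<close> the form is affine in \<open>t\<close>, so a nonzero
      slope would make it negative; the chosen \<open>t\<close> gives exactly -1.\<close>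
    have "D = 0"
    proof (rule ccontr)
      assume "D \<noteq> 0"
      then have "A - 2 * ((A + 1) / (2 * D)) * D = -1" by (simp add: field_simps)
      with q[of 1 "(A + 1) / (2 * D)"] True show False by simp
    qed
    then show ?thesis using True by (simp add: A_def B_def D_def)
  next
    case False
    with B have "0 < B" by simp
    \<comment> \<open>The minimising ratio \<open>t / s = D / B\<close>, cleared of
      denominators.\<close>
    have "0 \<le> B\<^sup>2 * A - 2 * B * D * D + D\<^sup>2 * B" by (rule q)
    then have "0 \<le> B * (A * B - D\<^sup>2)" by (simp add: power2_eq_square algebra_simps)
    with \<open>0 < B\<close> have "D\<^sup>2 \<le> A * B" by (simp add: zero_le_mult_iff)
    then show ?thesis by (simp add: A_def B_def D_def)
  qed
qed

locale l2_orthonormal =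
  fixes M :: "'a measure" and e :: "nat \<Rightarrow> 'a \<Rightarrow> real"
  assumes e_L2: "e i \<in> L2 M"
    and ortho: "(\<integral>x. e i x * e j x \<partial>M) = (if i = j then 1 else 0)"
begin

definition partial :: "(nat \<Rightarrow> real) \<Rightarrow> nat \<Rightarrow> 'a \<Rightarrow> real" where
  "partial c N x = (\<Sum>i<N. c i * e i x)"

definition coef :: "('a \<Rightarrow> real) \<Rightarrow> nat \<Rightarrow> real" where
  "coef f i = (\<integral>x. f x * e i x \<partial>M)"

text \<open>Membership of \<open>f\<close> in \<open>L2 M\<close> is included because the Bochner
  integral of a non-integrable function is 0, so that convergence of the integrals alone would say
  nothing.\<close>

definition expands :: "('a \<Rightarrow> real) \<Rightarrow> (nat \<Rightarrow> real) \<Rightarrow> bool" where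
  "expands f c \<longleftrightarrow> f \<in> L2 M \<and> (\<lambda>N. \<integral>x. (f x - partial c N x)\<^sup>2 \<partial>M) \<longlonglongrightarrow> 0"

lemma partial_L2: "partial c N \<in> L2 M"
  unfolding partial_def by (intro L2_sum L2_cmult e_L2)

lemma integral_mult_partial:
  assumes "f \<in> L2 M"
  shows "(\<integral>x. f x * partial c N x \<partial>M) = (\<Sum>i<N. c i * coef f i)"
proof -
  have "(\<integral>x. f x * partial c N x \<partial>M) = (\<integral>x. (\<Sum>i<N. c i * (f x * e i x)) \<partial>M)"
    by (simp add: partial_def sum_distrib_left mult_ac)
  also have "\<dots> = (\<Sum>i<N. c i * coef f i)"
    using L2_integrable_mult[OF assms e_L2]
    by (simp add: coef_def)
  finally show ?thesis .
qed

lemma coef_partial: "coef (partial c N) i = (if i < N then c i else 0)"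
proof -
  have "coef (partial c N) i = (\<Sum>j<N. c j * coef (e i) j)"
    using integral_mult_partial[OF e_L2, of i c N] by (simp add: coef_def mult.commute)
  also have "\<dots> = (\<Sum>j<N. if j = i then c j else 0)"
    by (intro sum.cong) (auto simp: coef_def ortho)
  finally show ?thesis by simp
qed

text \<open>Pythagoras with free coefficients \<open>c\<close>. For \<open>c = coef f\<close> it
  gives Bessel's inequality; for \<open>coef f = 0\<close> it shows that no partial sum is closer to
  \<open>f\<close> than 0.\<close>

lemma integral_diff_partial:
  assumes "f \<in> L2 M"
  shows "(\<integral>x. (f x - partial c N x)\<^sup>2 \<partial>M)
    = (\<integral>x. (f x)\<^sup>2 \<partial>M) - 2 * (\<Sum>i<N. c i * coef f i) + (\<Sum>i<N. (c i)\<^sup>2)"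
proof -
  have sq: "(\<integral>x. partial c N x * partial c N x \<partial>M) = (\<Sum>i<N. (c i)\<^sup>2)"
    by (simp add: integral_mult_partial[OF partial_L2] coef_partial power2_eq_square)
  have "(\<integral>x. (f x - partial c N x)\<^sup>2 \<partial>M)
     = (\<integral>x. (f x)\<^sup>2 - 2 * (f x * partial c N x) + partial c N x * partial c N x \<partial>M)"
    by (simp add: power2_eq_square algebra_simps)
  also have "\<dots> = (\<integral>x. (f x)\<^sup>2 \<partial>M) - 2 * (\<Sum>i<N. c i * coef f i) + (\<Sum>i<N. (c i)\<^sup>2)"
    using L2_integrable_mult[OF assms partial_L2] L2_integrable_mult[OF partial_L2 partial_L2]
      L2_integrable_square[OF assms]
    by (simp add: integral_mult_partial[OF assms] sq)
  finally show ?thesis .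
qed

lemma integral_partial_diff:
  assumes "N \<le> K"
  shows "(\<integral>x. (partial c K x - partial c N x)\<^sup>2 \<partial>M) = (\<Sum>i=N..<K. (c i)\<^sup>2)"
proof -
  have sq: "(\<integral>x. (partial c K x)\<^sup>2 \<partial>M) = (\<Sum>i<K. (c i)\<^sup>2)"
    by (simp add: power2_eq_square integral_mult_partial[OF partial_L2] coef_partial)
  have "(\<Sum>i<N. c i * coef (partial c K) i) = (\<Sum>i<N. (c i)\<^sup>2)"
    using assms by (intro sum.cong) (auto simp: coef_partial power2_eq_square)
  moreover have "(\<Sum>i<K. (c i)\<^sup>2) = (\<Sum>i<N. (c i)\<^sup>2) + (\<Sum>i=N..<K. (c i)\<^sup>2)"
    using assms sum.atLeastLessThan_concat[of 0 N K "\<lambda>i. (c i)\<^sup>2"] by (simp add: lessThan_atLeast0)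
  ultimately show ?thesis
    by (simp add: integral_diff_partial[OF partial_L2] sq)
qed

text \<open>Put in terms of the nonnegative integral so that Fatou's lemma can use it before the
  limit is known to be square integrable.\<close>

lemma nn_integral_partial_diff:
  assumes "summable (\<lambda>i. (c i)\<^sup>2)" "N \<le> K"
  shows "(\<integral>\<^sup>+x. ennreal ((partial c K x - partial c N x)\<^sup>2) \<partial>M) \<le> ennreal (\<Sum>i. (c (i + N))\<^sup>2)"
proof -
  have "(\<integral>\<^sup>+x. ennreal ((partial c K x - partial c N x)\<^sup>2) \<partial>M)
    = ennreal (\<integral>x. (partial c K x - partial c N x)\<^sup>2 \<partial>M)"
    by (intro nn_integral_eq_integral L2_integrable_square L2_diff partial_L2) auto
  also have "\<dots> = ennreal (\<Sum>i<K - N. (c (i + N))\<^sup>2)"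
    using assms sum.shift_bounds_nat_ivl[of "\<lambda>i. (c i)\<^sup>2" 0 N "K - N"]
    by (simp add: integral_partial_diff lessThan_atLeast0)
  also have "\<dots> \<le> ennreal (\<Sum>i. (c (i + N))\<^sup>2)"
    using summable_ignore_initial_segment[OF assms(1), of N]
    by (intro ennreal_leI sum_le_suminf) auto
  finally show ?thesis .
qed

text \<open>Fatou's lemma carries the tail bound from differences of partial sums over to
  \<open>F\<close> minus a partial sum; this gives both square integrability and convergence. A
  subsequence is allowed because Riesz-Fischer offers no more.\<close>

lemma expands_AE_limit:
  assumes c: "summable (\<lambda>i. (c i)\<^sup>2)" and r: "strict_mono r"
    and F: "F \<in> borel_measurable M" and lim: "AE x in M. (\<lambda>j. partial c (r j) x) \<longlonglongrightarrow> F x"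
  shows "expands F c"
proof -
  define tail where "tail N = (\<Sum>i. (c (i + N))\<^sup>2)" for N
  have [measurable]: "partial c N \<in> borel_measurable M" for N
    using partial_L2 by (rule L2_measurable)
  note [measurable] = F
  have tail0: "0 \<le> tail N" for N
    unfolding tail_def using summable_ignore_initial_segment[OF c, of N] by (intro suminf_nonneg) auto
  have bound: "(\<integral>\<^sup>+x. ennreal ((F x - partial c N x)\<^sup>2) \<partial>M) \<le> ennreal (tail N)" for N
  proof -
    have "(\<integral>\<^sup>+x. ennreal ((F x - partial c N x)\<^sup>2) \<partial>M)
      = (\<integral>\<^sup>+x. liminf (\<lambda>j. ennreal ((partial c (r j) x - partial c N x)\<^sup>2)) \<partial>M)"
    proof (rule nn_integral_cong_AE, use lim in eventually_elim)
      fix x assume "(\<lambda>j. partial c (r j) x) \<longlonglongrightarrow> F x"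
      then have "(\<lambda>j. ennreal ((partial c (r j) x - partial c N x)\<^sup>2)) \<longlonglongrightarrow> ennreal ((F x - partial c N x)\<^sup>2)"
        by (intro tendsto_intros)
      then show "ennreal ((F x - partial c N x)\<^sup>2) = liminf (\<lambda>j. ennreal ((partial c (r j) x - partial c N x)\<^sup>2))"
        by (intro lim_imp_Liminf[symmetric]) auto
    qed
    also have "\<dots> \<le> liminf (\<lambda>j. \<integral>\<^sup>+x. ennreal ((partial c (r j) x - partial c N x)\<^sup>2) \<partial>M)"
      by (rule nn_integral_liminf) measurable
    also have "\<dots> \<le> liminf (\<lambda>j::nat. ennreal (tail N))"
    proof (rule Liminf_mono)
      show "\<forall>\<^sub>F j in sequentially. (\<integral>\<^sup>+x. ennreal ((partial c (r j) x - partial c N x)\<^sup>2) \<partial>M) \<le> ennreal (tail N)"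
        using eventually_ge_at_top[of N]
      proof eventually_elim
        case (elim j)
        have "N \<le> r j" using elim strict_mono_imp_increasing[OF r, of j] by simp
        then show ?case unfolding tail_def by (rule nn_integral_partial_diff[OF c])
      qed
    qed
    finally show ?thesis by (simp add: Liminf_const)
  qed
  have "(\<integral>\<^sup>+x. ennreal (norm ((F x - partial c 0 x)\<^sup>2)) \<partial>M) < \<infinity>"
    using le_less_trans[OF bound[of 0] ennreal_less_top] by simp
  then have "(\<lambda>x. F x - partial c 0 x) \<in> L2 M"
    unfolding L2_def by (auto intro: integrableI_bounded)
  then have FL2: "F \<in> L2 M" by (simp add: partial_def)
  have "(\<integral>x. (F x - partial c N x)\<^sup>2 \<partial>M) \<le> tail N" for N
  proof -
    have "ennreal (\<integral>x. (F x - partial c N x)\<^sup>2 \<partial>M) \<le> ennreal (tail N)"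
      using bound[of N] L2_integrable_square[OF L2_diff[OF FL2 partial_L2]]
      by (subst nn_integral_eq_integral[symmetric]) auto
    then show ?thesis using tail0 by simp
  qed
  moreover have "tail \<longlonglongrightarrow> 0"
    unfolding tail_def by (rule suminf_exist_split2[OF c])
  ultimately have "(\<lambda>N. \<integral>x. (F x - partial c N x)\<^sup>2 \<partial>M) \<longlonglongrightarrow> 0"
    by (elim tendsto_0_squeeze) auto
  then show ?thesis using FL2 by (simp add: expands_def)
qed

text \<open>Serves to recognise kernels known pointwise as eigenfunction series as square integrable
  functions with the expected coefficients.\<close>

lemma expands_pointwise_limit:
  assumes "summable (\<lambda>i. (c i)\<^sup>2)" "\<And>x. x \<in> space M \<Longrightarrow> (\<lambda>i. c i * e i x) sums F x"
  shows "expands F c"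
proof (rule expands_AE_limit[OF assms(1) strict_mono_id])
  have lim: "(\<lambda>N. partial c N x) \<longlonglongrightarrow> F x" if "x \<in> space M" for x
    using assms(2)[OF that] by (simp add: sums_def partial_def)
  show "AE x in M. (\<lambda>j. partial c (id j) x) \<longlonglongrightarrow> F x"
    using lim by simp
  show "F \<in> borel_measurable M"
    by (rule borel_measurable_LIMSEQ_real[OF lim L2_measurable[OF partial_L2]])
qed

text \<open>By Cauchy-Schwarz the inner product with \<open>f\<close> is continuous, so it may be
  taken term by term.\<close>

lemma expands_sums_integral:
  assumes "expands F c" "f \<in> L2 M"
  shows "(\<lambda>i. c i * coef f i) sums (\<integral>x. f x * F x \<partial>M)"
proof -
  have F: "F \<in> L2 M" and lim: "(\<lambda>N. \<integral>x. (F x - partial c N x)\<^sup>2 \<partial>M) \<longlonglongrightarrow> 0"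
    using assms(1) by (auto simp: expands_def)
  have eq: "(\<integral>x. f x * F x \<partial>M) - (\<Sum>i<N. c i * coef f i) = (\<integral>x. f x * (F x - partial c N x) \<partial>M)" for N
    using L2_integrable_mult[OF assms(2) F] L2_integrable_mult[OF assms(2) partial_L2[of c N]]
    by (simp add: right_diff_distrib integral_mult_partial[OF assms(2)])
  have "(\<lambda>N. (\<integral>x. (f x)\<^sup>2 \<partial>M) * (\<integral>x. (F x - partial c N x)\<^sup>2 \<partial>M)) \<longlonglongrightarrow> 0"
    using tendsto_mult_left[OF lim] by simp
  moreover have "(\<integral>x. f x * (F x - partial c N x) \<partial>M)\<^sup>2
      \<le> (\<integral>x. (f x)\<^sup>2 \<partial>M) * (\<integral>x. (F x - partial c N x)\<^sup>2 \<partial>M)" for N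
    by (rule L2_Cauchy_Schwarz[OF assms(2) L2_diff[OF F partial_L2]])
  ultimately have "(\<lambda>N. (\<integral>x. f x * (F x - partial c N x) \<partial>M)\<^sup>2) \<longlonglongrightarrow> 0"
    by (elim tendsto_0_squeeze) auto
  then have "(\<lambda>N. \<integral>x. f x * (F x - partial c N x) \<partial>M) \<longlonglongrightarrow> 0"
    by simp
  then have "(\<lambda>N. (\<integral>x. f x * F x \<partial>M) - (\<Sum>i<N. c i * coef f i)) \<longlonglongrightarrow> 0"
    by (simp add: eq)
  then show ?thesis
    unfolding sums_def using tendsto_diff[OF tendsto_const[of "\<integral>x. f x * F x \<partial>M"]] by fastforce
qed

lemma expands_coef:
  assumes "expands F c"
  shows "coef F i = c i"
proof -
  have "(\<lambda>j. c j * coef (e i) j) sums (\<integral>x. e i x * F x \<partial>M)"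
    by (rule expands_sums_integral[OF assms e_L2])
  moreover have "(\<lambda>j. c j * coef (e i) j) = (\<lambda>j. if j = i then c j else 0)"
    by (auto simp: coef_def ortho)
  ultimately have "c i = (\<integral>x. e i x * F x \<partial>M)"
    using sums_single[of i c] sums_unique2 by fastforce
  then show ?thesis by (simp add: coef_def mult.commute)
qed

lemma expands_norm:
  assumes "expands F c"
  shows "(\<lambda>i. (c i)\<^sup>2) sums (\<integral>x. (F x)\<^sup>2 \<partial>M)"
  using expands_sums_integral[OF assms, of F] assms
  by (simp add: expands_coef[OF assms] power2_eq_square expands_def)

text \<open>
  Along a subsequence with increments \<open>d j\<close> of squared norm at most \<open>4 ^ -j\<close>, the sum of \<open>2 ^ j * (d j)\<^sup>2\<close> is integrable,
  so the increments decay geometrically almost everywhere.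
\<close>

lemma riesz_fischer:
  assumes c: "summable (\<lambda>i. (c i)\<^sup>2)"
  obtains F where "expands F c"
proof -
  have "(\<lambda>N. \<Sum>i. (c (i + N))\<^sup>2) \<longlonglongrightarrow> 0"
    by (rule suminf_exist_split2[OF c])
  then have ev: "\<forall>\<^sub>F N in sequentially. (\<Sum>i. (c (i + N))\<^sup>2) < (1/4) ^ j" for j :: nat
    by (rule order_tendstoD) simp
  have ex: "\<exists>N>n. (\<Sum>i. (c (i + N))\<^sup>2) < (1/4) ^ j" for j n :: nat
    using eventually_happens[OF eventually_conj[OF ev[of j] eventually_gt_at_top[of n]]]
    by auto
  have "\<exists>r. \<forall>j. (\<Sum>i. (c (i + r j))\<^sup>2) < (1/4) ^ j \<and> r j < r (Suc j)"
    by (intro dependent_nat_choice) (use ex in blast)+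
  then obtain r where r: "\<And>j. (\<Sum>i. (c (i + r j))\<^sup>2) < (1/4) ^ j" "\<And>j. r j < r (Suc j)"
    by auto
  have rm: "strict_mono r" using r(2) by (simp add: strict_mono_Suc_iff)
  define d where "d j x = partial c (r (Suc j)) x - partial c (r j) x" for j x
  have [measurable]: "partial c N \<in> borel_measurable M" for N
    using partial_L2 by (rule L2_measurable)
  have dm[measurable]: "d j \<in> borel_measurable M" for j
    unfolding d_def by measurable
  have "(\<integral>\<^sup>+x. (\<Sum>j. ennreal (2 ^ j * (d j x)\<^sup>2)) \<partial>M) = (\<Sum>j. \<integral>\<^sup>+x. ennreal (2 ^ j * (d j x)\<^sup>2) \<partial>M)"
    by (rule nn_integral_suminf) measurable
  also have "\<dots> \<le> (\<Sum>j. ennreal ((1/2) ^ j))"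
  proof (intro suminf_le summableI)
    fix j
    have "(\<integral>\<^sup>+x. ennreal (2 ^ j * (d j x)\<^sup>2) \<partial>M) = ennreal (2 ^ j) * (\<integral>\<^sup>+x. ennreal ((d j x)\<^sup>2) \<partial>M)"
      by (simp add: ennreal_mult' nn_integral_cmult)
    also have "\<dots> \<le> ennreal (2 ^ j) * ennreal (\<Sum>i. (c (i + r j))\<^sup>2)"
      unfolding d_def using r(2)[of j] by (intro mult_left_mono nn_integral_partial_diff[OF c]) auto
    also have "\<dots> \<le> ennreal (2 ^ j) * ennreal ((1/4) ^ j)"
      using r(1)[of j] by (intro mult_left_mono ennreal_leI) auto
    also have "\<dots> = ennreal ((1/2) ^ j)"
      by (simp add: ennreal_mult'[symmetric] power_mult_distrib[symmetric])
    finally show "(\<integral>\<^sup>+x. ennreal (2 ^ j * (d j x)\<^sup>2) \<partial>M) \<le> ennreal ((1/2) ^ j)" .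
  qed
  also have "\<dots> = ennreal (\<Sum>j. (1/2) ^ j)"
    by (rule suminf_ennreal2) (auto intro: summable_geometric)
  finally have "(\<integral>\<^sup>+x. (\<Sum>j. ennreal (2 ^ j * (d j x)\<^sup>2)) \<partial>M) \<noteq> \<infinity>"
    by (auto simp: top_unique)
  then have "AE x in M. (\<Sum>j. ennreal (2 ^ j * (d j x)\<^sup>2)) \<noteq> \<infinity>"
    by (intro nn_integral_PInf_AE) measurable
  then have lim: "AE x in M. (\<lambda>j. partial c (r j) x) \<longlonglongrightarrow> lim (\<lambda>j. partial c (r j) x)"
  proof eventually_elim
    fix x assume fin: "(\<Sum>j. ennreal (2 ^ j * (d j x)\<^sup>2)) \<noteq> \<infinity>"
    define D where "D = (\<lambda>j. ennreal (2 ^ j * (d j x)\<^sup>2))"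
    define K where "K = enn2real (suminf D)"
    have fin: "suminf D \<noteq> \<infinity>" using fin unfolding D_def .
    have bd: "\<bar>d j x\<bar> \<le> sqrt K * (1 / sqrt 2) ^ j" for j
    proof -
      have "sum D {j} \<le> suminf D" by (rule sum_le_suminf) auto
      then have "D j \<le> suminf D" by simp
      also have "\<dots> = ennreal K" using fin by (simp add: K_def less_top)
      finally have "2 ^ j * (d j x)\<^sup>2 \<le> K" by (simp add: D_def K_def)
      then have "sqrt (2 ^ j * (d j x)\<^sup>2) \<le> sqrt K" by simp
      then have "sqrt 2 ^ j * \<bar>d j x\<bar> \<le> sqrt K" by (simp add: real_sqrt_mult real_sqrt_power[of 2])
      then show ?thesis by (simp add: power_one_over field_simps)
    qed
    have "summable (\<lambda>j. d j x)"
    proof (rule summable_comparison_test')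
      show "summable (\<lambda>j. sqrt K * (1 / sqrt 2) ^ j)"
        by (intro summable_mult summable_geometric) simp
      show "norm (d j x) \<le> sqrt K * (1 / sqrt 2) ^ j" if "0 \<le> j" for j
        using bd by simp
    qed
    then have "(\<lambda>n. (\<Sum>j<n. d j x) + partial c (r 0) x) \<longlonglongrightarrow> (\<Sum>j. d j x) + partial c (r 0) x"
      by (intro tendsto_add tendsto_const summable_LIMSEQ)
    then have "convergent (\<lambda>j. partial c (r j) x)"
      using sum_lessThan_telescope[of "\<lambda>j. partial c (r j) x"] by (auto simp: convergent_def d_def)
    then show "(\<lambda>j. partial c (r j) x) \<longlonglongrightarrow> lim (\<lambda>j. partial c (r j) x)"
      by (simp add: convergent_LIMSEQ_iff)
  qed
  have "(\<lambda>x. lim (\<lambda>j. partial c (r j) x)) \<in> borel_measurable M"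
    by measurable
  with lim have "expands (\<lambda>x. lim (\<lambda>j. partial c (r j) x)) c"
    by (intro expands_AE_limit[OF c rm])
  then show ?thesis by (rule that)
qed

lemma bessel:
  assumes "f \<in> L2 M"
  shows "summable (\<lambda>i. (coef f i)\<^sup>2)"
proof (rule summableI_nonneg_bounded)
  fix N
  have "0 \<le> (\<integral>x. (f x - partial (coef f) N x)\<^sup>2 \<partial>M)" by simp
  also have "\<dots> = (\<integral>x. (f x)\<^sup>2 \<partial>M) - (\<Sum>i<N. (coef f i)\<^sup>2)"
    unfolding integral_diff_partial[OF assms] by (simp flip: power2_eq_square)
  finally show "(\<Sum>i<N. (coef f i)\<^sup>2) \<le> (\<integral>x. (f x)\<^sup>2 \<partial>M)" by simp
qed simp

end

text \<open>Completeness as triviality of the orthogonal complement: this is the form that can be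
  checked for the determinants on the chamber. Convergence of expansions then follows from
  Riesz-Fischer.\<close>

locale l2_total = l2_orthonormal +
  assumes total: "f \<in> L2 M \<Longrightarrow> (\<And>i. coef f i = 0) \<Longrightarrow> AE x in M. f x = 0"
begin

text \<open>Riesz-Fischer supplies an \<open>F\<close> with the same coefficients, and
  \<open>f - F\<close> is orthogonal to the whole family.\<close>

lemma expands_of_coef:
  assumes f: "f \<in> L2 M" and c: "\<And>i. coef f i = c i"
  shows "expands f c"
proof -
  have "coef f = c" using c by auto
  then obtain F where F: "expands F c"
    using riesz_fischer bessel[OF f] by metis
  have FL: "F \<in> L2 M" using F by (simp add: expands_def)
  have "AE x in M. f x - F x = 0"
  proof (rule total)
    show "(\<lambda>x. f x - F x) \<in> L2 M" using f FL by (rule L2_diff)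
    show "coef (\<lambda>x. f x - F x) i = 0" for i
      using L2_integrable_mult[OF f e_L2] L2_integrable_mult[OF FL e_L2] c expands_coef[OF F, of i]
      by (simp add: coef_def left_diff_distrib)
  qed
  then have AE: "AE x in M. f x = F x" by auto
  have "(\<integral>x. (f x - partial c N x)\<^sup>2 \<partial>M) = (\<integral>x. (F x - partial c N x)\<^sup>2 \<partial>M)" for N
    using AE L2_measurable[OF L2_diff[OF f partial_L2]] L2_measurable[OF L2_diff[OF FL partial_L2]]
    by (intro integral_cong_AE) auto
  then show ?thesis using F f by (simp add: expands_def)
qed

lemma parseval:
  assumes "f \<in> L2 M" "g \<in> L2 M"
  shows "(\<lambda>i. coef f i * coef g i) sums (\<integral>x. f x * g x \<partial>M)"
  using expands_sums_integral[OF expands_of_coef[OF assms(2) refl] assms(1)]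
  by (simp add: mult.commute)

lemma parseval_norm:
  assumes "f \<in> L2 M"
  shows "(\<lambda>i. (coef f i)\<^sup>2) sums (\<integral>x. (f x)\<^sup>2 \<partial>M)"
  using expands_norm[OF expands_of_coef[OF assms refl]] .

end

text \<open>For \<open>f\<close> orthogonal to the family, Pythagoras keeps every finite combination
  at distance at least the norm of \<open>f\<close>; density forces this norm to be 0.\<close>

lemma l2_total_of_basis:
  assumes "l2_orthonormal_basis M e"
  shows "l2_total M e"
proof -
  have e: "e i \<in> L2 M" for i using assms by (simp add: l2_orthonormal_basis_def)
  interpret l2_orthonormal M e
    using assms by unfold_locales (auto simp: l2_orthonormal_basis_def)
  show ?thesis
  proof
    fix f assume f: "f \<in> L2 M" and c: "\<And>i. coef f i = 0"
    define A where "A = (\<integral>x. (f x)\<^sup>2 \<partial>M)"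
    have "A \<le> \<epsilon>\<^sup>2" if "\<epsilon> > 0" for \<epsilon>
    proof -
      obtain N d where "l2_norm M (\<lambda>x. f x - (\<Sum>k<N. d k * e k x)) < \<epsilon>"
        using assms f \<open>\<epsilon> > 0\<close> unfolding l2_orthonormal_basis_def by meson
      then have "sqrt (\<integral>x. (f x - partial d N x)\<^sup>2 \<partial>M) < \<epsilon>"
        by (simp add: l2_norm_def partial_def)
      then have "(\<integral>x. (f x - partial d N x)\<^sup>2 \<partial>M) \<le> \<epsilon>\<^sup>2"
        using power_mono[of "sqrt (\<integral>x. (f x - partial d N x)\<^sup>2 \<partial>M)" \<epsilon> 2] by simp
      moreover have "A \<le> (\<integral>x. (f x - partial d N x)\<^sup>2 \<partial>M)"
        using c by (simp add: integral_diff_partial[OF f] A_def sum_nonneg)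
      ultimately show ?thesis by simp
    qed
    from this[of "sqrt \<epsilon>" for \<epsilon>] have "A \<le> \<epsilon>" if "\<epsilon> > 0" for \<epsilon>
      using that by simp
    then have "A \<le> 0" by (rule field_le_epsilon) simp
    then have "A = 0" by (simp add: A_def antisym)
    then show "AE x in M. f x = 0"
      using integral_nonneg_eq_0_iff_AE[OF L2_integrable_square[OF f]] by (simp add: A_def)
  qed
qed

section \<open>Generators diagonal in an orthonormal basis\<close>

lemma exp_difference_quotient_tendsto:
  "((\<lambda>t::real. (exp (- (a * t)) - 1) / t) \<longlongrightarrow> - a) (at_right 0)"
proof -
  have "((\<lambda>t. exp (- (a * t))) has_field_derivative - a) (at 0 within {0<..})"
    by (auto intro!: derivative_eq_intros)
  then show ?thesis by (simp add: has_field_derivative_iff)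
qed

text \<open>The kernel is described by the coefficients of \<open>p t x\<close> for every single
  \<open>x\<close>, so the semigroup is computed by Parseval at every point and not just almost
  everywhere. The index of the least eigenvalue is a parameter because the enumeration of tuples is
  arbitrary.\<close>

locale l2_spectral_kernel = l2_total +
  fixes p :: "real \<Rightarrow> 'a \<Rightarrow> 'a \<Rightarrow> real" and \<mu> :: "nat \<Rightarrow> real" and k0 :: nat
  assumes p_L2: "0 < t \<Longrightarrow> x \<in> space M \<Longrightarrow> p t x \<in> L2 M"
    and p_coef: "0 < t \<Longrightarrow> x \<in> space M \<Longrightarrow> coef (p t x) i = exp (- \<mu> i * t) * e i x"
    and \<mu>_nonneg: "0 \<le> \<mu> i"
    and \<mu>_min: "\<mu> k0 \<le> \<mu> i"
begin

lemma semigroup_expands: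
  assumes f: "f \<in> L2 M" and t: "0 < t"
  shows "expands (kernel_semigroup M p t f) (\<lambda>i. exp (- \<mu> i * t) * coef f i)"
proof (rule expands_pointwise_limit)
  show "summable (\<lambda>i. (exp (- \<mu> i * t) * coef f i)\<^sup>2)"
  proof (rule summable_comparison_test'[OF bessel[OF f]])
    fix i
    have "exp (- \<mu> i * t) \<le> 1" using \<mu>_nonneg[of i] t by simp
    then have "(exp (- \<mu> i * t))\<^sup>2 \<le> 1" by (simp add: power_le_one)
    then show "norm ((exp (- \<mu> i * t) * coef f i)\<^sup>2) \<le> (coef f i)\<^sup>2"
      using mult_right_mono[of "(exp (- \<mu> i * t))\<^sup>2" 1 "(coef f i)\<^sup>2"]
      by (simp add: power_mult_distrib)
  qed
  show "(\<lambda>i. exp (- \<mu> i * t) * coef f i * e i x) sums kernel_semigroup M p t f x"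
    if "x \<in> space M" for x
    using parseval[OF p_L2[OF t that] f] p_coef[OF t that]
    by (simp add: kernel_semigroup_def mult_ac)
qed

text \<open>Parseval turns the convergence that defines the generator into a question about series
  of numbers.\<close>

lemma generator_distance:
  assumes f: "f \<in> L2 M" and g: "g \<in> L2 M" and t: "0 < t"
  shows "summable (\<lambda>i. ((exp (- (\<mu> i * t)) - 1) / t * coef f i - coef g i)\<^sup>2)"
    and "(\<integral>\<^sup>+x. ennreal (((kernel_semigroup M p t f x - f x) / t - g x)\<^sup>2) \<partial>M)
      = ennreal (\<Sum>i. ((exp (- (\<mu> i * t)) - 1) / t * coef f i - coef g i)\<^sup>2)"
proof -
  let ?T = "kernel_semigroup M p t f"
  let ?u = "\<lambda>x. 1 / t * (?T x - f x) - g x"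
  have T: "?T \<in> L2 M" using semigroup_expands[OF f t] by (simp add: expands_def)
  have Tf: "(\<lambda>x. 1 / t * (?T x - f x)) \<in> L2 M"
    by (intro L2_cmult L2_diff T f)
  have u: "?u \<in> L2 M"
    by (intro L2_diff Tf g)
  have "coef ?u i = (exp (- (\<mu> i * t)) - 1) / t * coef f i - coef g i" for i
  proof -
    have "coef ?u i = (\<integral>x. 1 / t * (?T x * e i x - f x * e i x) - g x * e i x \<partial>M)"
      by (simp add: coef_def algebra_simps)
    also have "\<dots> = 1 / t * (coef ?T i - coef f i) - coef g i"
      using L2_integrable_mult[OF T e_L2] L2_integrable_mult[OF f e_L2] L2_integrable_mult[OF g e_L2]
      by (simp add: coef_def)
    finally show ?thesis
      using expands_coef[OF semigroup_expands[OF f t], of i] t by (simp add: field_simps)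
  qed
  then have s: "(\<lambda>i. ((exp (- (\<mu> i * t)) - 1) / t * coef f i - coef g i)\<^sup>2) sums (\<integral>x. (?u x)\<^sup>2 \<partial>M)"
    using parseval_norm[OF u] by simp
  then show "summable (\<lambda>i. ((exp (- (\<mu> i * t)) - 1) / t * coef f i - coef g i)\<^sup>2)"
    by (rule sums_summable)
  have "(\<integral>\<^sup>+x. ennreal (((?T x - f x) / t - g x)\<^sup>2) \<partial>M) = (\<integral>\<^sup>+x. ennreal ((?u x)\<^sup>2) \<partial>M)"
    by simp
  also have "\<dots> = ennreal (\<integral>x. (?u x)\<^sup>2 \<partial>M)"
    by (intro nn_integral_eq_integral L2_integrable_square u) simp
  also have "(\<integral>x. (?u x)\<^sup>2 \<partial>M) = (\<Sum>i. ((exp (- (\<mu> i * t)) - 1) / t * coef f i - coef g i)\<^sup>2)"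
    using s by (rule sums_unique)
  finally show "(\<integral>\<^sup>+x. ennreal (((?T x - f x) / t - g x)\<^sup>2) \<partial>M)
      = ennreal (\<Sum>i. ((exp (- (\<mu> i * t)) - 1) / t * coef f i - coef g i)\<^sup>2)" .
qed

text \<open>One term of the series is at most the whole, so the difference quotients converge in
  each coefficient, and there the limit is known.\<close>

lemma coef_generator:
  assumes gen: "l2_generator M (kernel_semigroup M p) f g"
  shows "coef g i = - \<mu> i * coef f i"
proof -
  have f: "f \<in> L2 M" and g: "g \<in> L2 M" using gen by (auto simp: l2_generator_def)
  let ?c = "\<lambda>t i. (exp (- (\<mu> i * t)) - 1) / t * coef f i - coef g i"
  have "((\<lambda>t. \<integral>\<^sup>+x. ennreal (((kernel_semigroup M p t f x - f x) / t - g x)\<^sup>2) \<partial>M) \<longlongrightarrow> 0) (at_right 0)"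
    using gen by (simp add: l2_generator_def)
  then have "((\<lambda>t. ennreal ((?c t i)\<^sup>2)) \<longlongrightarrow> 0) (at_right 0)"
  proof (rule tendsto_sandwich[OF _ _ tendsto_const, rotated 2])
    show "\<forall>\<^sub>F t in at_right 0. ennreal ((?c t i)\<^sup>2)
        \<le> (\<integral>\<^sup>+x. ennreal (((kernel_semigroup M p t f x - f x) / t - g x)\<^sup>2) \<partial>M)"
      using eventually_at_right_less[of 0]
    proof eventually_elim
      case (elim t)
      have "(\<Sum>j\<in>{i}. (?c t j)\<^sup>2) \<le> (\<Sum>j. (?c t j)\<^sup>2)"
        by (rule sum_le_suminf[OF generator_distance(1)[OF f g elim]]) auto
      then show ?case
        by (simp add: generator_distance(2)[OF f g elim] ennreal_leI)
    qed
  qed simp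
  then have "((\<lambda>t. ennreal ((?c t i)\<^sup>2)) \<longlongrightarrow> ennreal 0) (at_right 0)" by simp
  then have "((\<lambda>t. (?c t i)\<^sup>2) \<longlongrightarrow> 0) (at_right 0)"
    by (subst (asm) tendsto_ennreal_iff) auto
  moreover have "((\<lambda>t. (?c t i)\<^sup>2) \<longlongrightarrow> (- \<mu> i * coef f i - coef g i)\<^sup>2) (at_right 0)"
    by (intro tendsto_intros exp_difference_quotient_tendsto)
  ultimately have "(- \<mu> i * coef f i - coef g i)\<^sup>2 = 0"
    using tendsto_unique[OF trivial_limit_at_right_real] by blast
  then show ?thesis by simp
qed

text \<open>Convergence in each coefficient does not suffice for the converse. The terms are
  dominated by \<open>(coef g i)\<^sup>2\<close>, summable by Bessel, and Tannery's theorem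
  applies.\<close>

lemma generatorI:
  assumes f: "f \<in> L2 M" and g: "g \<in> L2 M" and eq: "\<And>i. coef g i = - \<mu> i * coef f i"
  shows "l2_generator M (kernel_semigroup M p) f g"
proof -
  let ?a = "\<lambda>i t. ((exp (- (\<mu> i * t)) - 1) / t * coef f i - coef g i)\<^sup>2"
  have lim: "((\<lambda>t. ?a i t) \<longlongrightarrow> 0) (at_right 0)" for i
  proof -
    have "((\<lambda>t. ?a i t) \<longlongrightarrow> (- \<mu> i * coef f i - coef g i)\<^sup>2) (at_right 0)"
      by (intro tendsto_intros exp_difference_quotient_tendsto)
    then show ?thesis by (simp add: eq)
  qed
  have bound: "norm (?a i t) \<le> (coef g i)\<^sup>2" if t: "0 < t" for i t
  proof -
    \<comment> \<open>The quotient lies between \<open>- \<mu> i\<close> and 0, by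
      \<open>1 - v \<le> exp (- v) \<le> 1\<close> for \<open>v = \<mu> i * t\<close>.\<close>
    have "\<bar>(exp (- (\<mu> i * t)) - 1) / t + \<mu> i\<bar> \<le> \<bar>\<mu> i\<bar>"
    proof -
      have "1 - \<mu> i * t \<le> exp (- (\<mu> i * t))" using exp_ge_add_one_self[of "- (\<mu> i * t)"] by simp
      moreover have "exp (- (\<mu> i * t)) \<le> 1" using \<mu>_nonneg[of i] t by simp
      ultimately have "- \<mu> i \<le> (exp (- (\<mu> i * t)) - 1) / t" "(exp (- (\<mu> i * t)) - 1) / t \<le> 0"
        using t by (auto simp: field_simps)
      then show ?thesis by simp
    qed
    then have "((exp (- (\<mu> i * t)) - 1) / t + \<mu> i)\<^sup>2 \<le> (\<mu> i)\<^sup>2"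
      by (rule abs_le_square_iff[THEN iffD1])
    then have "((exp (- (\<mu> i * t)) - 1) / t + \<mu> i)\<^sup>2 * (coef f i)\<^sup>2 \<le> (\<mu> i)\<^sup>2 * (coef f i)\<^sup>2"
      by (intro mult_right_mono) auto
    moreover have "(exp (- (\<mu> i * t)) - 1) / t * coef f i - coef g i = ((exp (- (\<mu> i * t)) - 1) / t + \<mu> i) * coef f i"
      by (simp add: eq distrib_right)
    moreover have "(coef g i)\<^sup>2 = (\<mu> i)\<^sup>2 * (coef f i)\<^sup>2"
      by (simp add: eq power_mult_distrib)
    ultimately show ?thesis
      by (simp only: power_mult_distrib real_norm_def abs_mult abs_power2)
  qed
  have "\<forall>\<^sub>F (i, t) in sequentially \<times>\<^sub>F at_right 0. norm (?a i t) \<le> (coef g i)\<^sup>2"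
    unfolding eventually_prod_filter
    by (rule exI[of _ "\<lambda>_. True"], rule exI[of _ "\<lambda>t. 0 < t"])
      (use bound in \<open>auto simp: eventually_at_right_less\<close>)
  from tannerys_theorem[OF lim this bessel[OF g] trivial_limit_at_right_real]
  have "((\<lambda>t. \<Sum>i. ?a i t) \<longlongrightarrow> 0) (at_right 0)" by simp
  then have "((\<lambda>t. ennreal (\<Sum>i. ?a i t)) \<longlongrightarrow> ennreal 0) (at_right 0)"
    by (intro tendsto_ennrealI)
  then have "((\<lambda>t. ennreal (\<Sum>i. ?a i t)) \<longlongrightarrow> 0) (at_right 0)" by simp
  then have "((\<lambda>t. \<integral>\<^sup>+x. ennreal (((kernel_semigroup M p t f x - f x) / t - g x)\<^sup>2) \<partial>M) \<longlongrightarrow> 0) (at_right 0)"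
  proof (rule Lim_transform_eventually)
    show "\<forall>\<^sub>F t in at_right 0. ennreal (\<Sum>i. ?a i t)
      = (\<integral>\<^sup>+x. ennreal (((kernel_semigroup M p t f x - f x) / t - g x)\<^sup>2) \<partial>M)"
      using eventually_at_right_less[of 0] by eventually_elim (simp add: generator_distance(2)[OF f g])
  qed
  then show ?thesis using f g by (simp add: l2_generator_def)
qed

text \<open>In coordinates, minus the generator minus \<open>s\<close> is multiplication by
  \<open>\<mu> i - s\<close>, which is bounded below by the gap \<open>\<mu> k0 - s\<close>.
  Division by it gives the bound on the inverse and, through Riesz-Fischer, a solution for every
  right-hand side.\<close>

lemma below_spectrum:
  assumes s: "s < \<mu> k0"
  shows "s \<in> l2_resolvent_set M (\<lambda>f g. l2_generator M (kernel_semigroup M p) f (\<lambda>x. - g x))"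
proof -
  have gap: "(\<mu> k0 - s)\<^sup>2 \<le> (\<mu> i - s)\<^sup>2" for i
    using s \<mu>_min[of i] by (intro power_mono) auto
  have "l2_norm M f \<le> (1 / (\<mu> k0 - s)) * l2_norm M (\<lambda>x. g x - s * f x)"
    if gen: "l2_generator M (kernel_semigroup M p) f (\<lambda>x. - g x)" for f g
  proof -
    have f: "f \<in> L2 M" and g: "g \<in> L2 M"
      using gen L2_cmult[of "\<lambda>x. - g x" M "-1"] by (auto simp: l2_generator_def)
    have cg: "coef g i = \<mu> i * coef f i" for i
      using coef_generator[OF gen, of i] by (simp add: coef_def)
    have d: "(\<lambda>x. g x - s * f x) \<in> L2 M" by (intro L2_diff L2_cmult f g)
    have "coef (\<lambda>x. g x - s * f x) i = (\<mu> i - s) * coef f i" for i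
    proof -
      have "coef (\<lambda>x. g x - s * f x) i = (\<integral>x. g x * e i x - s * (f x * e i x) \<partial>M)"
        by (simp add: coef_def algebra_simps)
      also have "\<dots> = coef g i - s * coef f i"
        using L2_integrable_mult[OF f e_L2] L2_integrable_mult[OF g e_L2] by (simp add: coef_def)
      finally show ?thesis by (simp add: cg algebra_simps)
    qed
    then have "(\<lambda>i. (\<mu> i - s)\<^sup>2 * (coef f i)\<^sup>2) sums (\<integral>x. (g x - s * f x)\<^sup>2 \<partial>M)"
      using parseval_norm[OF d] by (simp add: power_mult_distrib)
    moreover have "(\<lambda>i. (\<mu> k0 - s)\<^sup>2 * (coef f i)\<^sup>2) sums ((\<mu> k0 - s)\<^sup>2 * (\<integral>x. (f x)\<^sup>2 \<partial>M))"
      by (intro sums_mult parseval_norm f)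
    ultimately have "(\<mu> k0 - s)\<^sup>2 * (\<integral>x. (f x)\<^sup>2 \<partial>M) \<le> (\<integral>x. (g x - s * f x)\<^sup>2 \<partial>M)"
      using gap by (elim sums_le[rotated]) (auto intro: mult_right_mono)
    then have "sqrt ((\<mu> k0 - s)\<^sup>2 * (\<integral>x. (f x)\<^sup>2 \<partial>M)) \<le> sqrt (\<integral>x. (g x - s * f x)\<^sup>2 \<partial>M)"
      by (rule real_sqrt_le_mono)
    then show ?thesis using s by (simp add: l2_norm_def real_sqrt_mult field_simps)
  qed
  then have "\<exists>C. \<forall>f g. l2_generator M (kernel_semigroup M p) f (\<lambda>x. - g x) \<longrightarrow>
      l2_norm M f \<le> C * l2_norm M (\<lambda>x. g x - s * f x)"
    by blast
  moreover have "\<exists>f g. l2_generator M (kernel_semigroup M p) f (\<lambda>x. - g x) \<and> (AE x in M. g x - s * f x = u x)"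
    if u: "u \<in> L2 M" for u
  proof -
    define c where "c i = coef u i / (\<mu> i - s)" for i
    have pos: "0 < \<mu> i - s" for i using s \<mu>_min[of i] by simp
    have "summable (\<lambda>i. (c i)\<^sup>2)"
    proof (rule summable_comparison_test')
      show "summable (\<lambda>i. (1 / (\<mu> k0 - s)\<^sup>2) * (coef u i)\<^sup>2)"
        by (intro summable_mult bessel u)
      show "norm ((c i)\<^sup>2) \<le> (1 / (\<mu> k0 - s)\<^sup>2) * (coef u i)\<^sup>2" for i
        using pos[of k0] pos[of i] gap[of i]
        by (auto simp: c_def power_divide intro!: divide_left_mono mult_pos_pos)
    qed
    then obtain F where F: "expands F c" by (rule riesz_fischer)
    have FL: "F \<in> L2 M" using F by (simp add: expands_def)
    have nL: "(\<lambda>x. - (u x + s * F x)) \<in> L2 M"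
      using L2_cmult[OF L2_add[OF u L2_cmult[OF FL, of s]], of "-1"] by simp
    have "coef (\<lambda>x. - (u x + s * F x)) i = - \<mu> i * coef F i" for i
    proof -
      have "coef (\<lambda>x. - (u x + s * F x)) i = (\<integral>x. - (u x * e i x) - s * (F x * e i x) \<partial>M)"
        by (simp add: coef_def algebra_simps)
      also have "\<dots> = - coef u i - s * coef F i"
        using L2_integrable_mult[OF u e_L2] L2_integrable_mult[OF FL e_L2] by (simp add: coef_def)
      finally show ?thesis using pos[of i] by (simp add: expands_coef[OF F] c_def field_simps)
    qed
    then have "l2_generator M (kernel_semigroup M p) F (\<lambda>x. - (u x + s * F x))"
      by (rule generatorI[OF FL nL])
    then show ?thesis by (intro exI[of _ F] exI[of _ "\<lambda>x. u x + s * F x"]) simp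
  qed
  ultimately show ?thesis by (simp add: l2_resolvent_set_def)
qed

text \<open>\<open>e k0\<close> is an eigenfunction for \<open>\<mu> k0\<close> of norm 1, which no
  bounded inverse permits; so the infimum is attained.\<close>

lemma spectral_bottom: "is_spectral_bottom M (kernel_semigroup M p) (\<mu> k0)"
proof -
  let ?G = "\<lambda>f g. l2_generator M (kernel_semigroup M p) f (\<lambda>x. - g x)"
  have "\<mu> k0 \<in> l2_spectrum M ?G"
  proof (rule ccontr)
    assume "\<mu> k0 \<notin> l2_spectrum M ?G"
    then obtain C where C: "\<And>f g. ?G f g \<Longrightarrow> l2_norm M f \<le> C * l2_norm M (\<lambda>x. g x - \<mu> k0 * f x)"
      by (auto simp: l2_spectrum_def l2_resolvent_set_def)
    have nL: "(\<lambda>x. - (\<mu> k0 * e k0 x)) \<in> L2 M"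
      using L2_cmult[OF e_L2, of "- \<mu> k0" k0] by simp
    have "coef (\<lambda>x. - (\<mu> k0 * e k0 x)) i = - \<mu> i * coef (e k0) i" for i
      by (simp add: coef_def mult.assoc ortho)
    then have "?G (e k0) (\<lambda>x. \<mu> k0 * e k0 x)"
      by (rule generatorI[OF e_L2 nL])
    from C[OF this] have "l2_norm M (e k0) \<le> 0" by (simp add: l2_norm_def)
    moreover have "l2_norm M (e k0) = 1"
      using ortho[of k0 k0] by (simp add: l2_norm_def power2_eq_square)
    ultimately show False by simp
  qed
  moreover have "\<mu> k0 \<le> s" if "s \<in> l2_spectrum M ?G" for s
    using below_spectrum[of s] that by (force simp: l2_spectrum_def)
  ultimately show ?thesis
    unfolding is_spectral_bottom_def
    by (intro antisym Inf_lower Inf_greatest) auto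
qed

end

section \<open>Determinants of functions\<close>

lemma det_mat_eq_sum:
  fixes A :: "nat \<Rightarrow> nat \<Rightarrow> 'a::comm_ring_1"
  shows "Determinant.det (mat n n (\<lambda>(i, j). A i j))
    = (\<Sum>p | p permutes {..<n}. of_int (sign p) * (\<Prod>i<n. A i (p i)))"
proof -
  have "Determinant.det (mat n n (\<lambda>(i, j). A i j)) = (\<Sum>p | p permutes {0..<n}.
      of_int (sign p) * (\<Prod>i = 0..<n. mat n n (\<lambda>(i, j). A i j) $$ (i, p i)))"
    by (rule det_def') simp
  also have "\<dots> = (\<Sum>p | p permutes {0..<n}. of_int (sign p) * (\<Prod>i = 0..<n. A i (p i)))"
    by (intro sum.cong refl arg_cong2[of _ _ _ _ "(*)"] prod.cong)
      (use permutes_in_image in fastforce)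
  finally show ?thesis by (simp add: lessThan_atLeast0)
qed

text \<open>Subtracting \<open>s\<close> times the second row clears the first row except for its
  first entry, the pivot of the Laplace expansion.\<close>

lemma det_mat_reduce_row:
  fixes A :: "nat \<Rightarrow> nat \<Rightarrow> 'a::comm_ring_1"
  assumes "\<And>j. 1 \<le> j \<Longrightarrow> j < Suc (Suc n) \<Longrightarrow> A 0 j = s * A 1 j"
  shows "Determinant.det (mat (Suc (Suc n)) (Suc (Suc n)) (\<lambda>(i, j). A i j))
    = (A 0 0 - s * A 1 0) * Determinant.det (mat (Suc n) (Suc n) (\<lambda>(i, j). A (Suc i) (Suc j)))"
proof -
  let ?n = "Suc (Suc n)"
  let ?A = "mat ?n ?n (\<lambda>(i, j). A i j)"
  let ?B = "addrow (- s) 0 1 ?A"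
  have B: "?B \<in> carrier_mat ?n ?n" by simp
  have "Determinant.det ?A = Determinant.det ?B"
    by (rule det_addrow[symmetric, of _ ?n]) auto
  also have "\<dots> = (\<Sum>j<?n. ?B $$ (0, j) * cofactor ?B 0 j)"
    by (rule laplace_expansion_row[OF B]) simp
  also have "\<dots> = (\<Sum>j<?n. if j = 0 then (A 0 0 - s * A 1 0) * cofactor ?B 0 0 else 0)"
    using assms by (intro sum.cong) (auto simp: mat_addrow_gen_def)
  also have "\<dots> = (A 0 0 - s * A 1 0) * cofactor ?B 0 0"
    by (subst sum.delta) auto
  also have "cofactor ?B 0 0 = Determinant.det (mat (Suc n) (Suc n) (\<lambda>(i, j). A (Suc i) (Suc j)))"
    unfolding cofactor_def mat_delete_def
    by (simp, rule arg_cong[of _ _ Determinant.det], rule eq_matI) (auto simp: mat_addrow_gen_def)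
  finally show ?thesis .
qed

text \<open>
  The multiplicativity \<open>G x y * G z z = G x z * G z y\<close> for \<open>x \<le> z \<le> y\<close> makes the first row, from its
  second entry on, a multiple of the second row (or the same for columns).
\<close>

lemma det_green_kernel_nonneg:
  fixes G :: "'a::linorder \<Rightarrow> 'a \<Rightarrow> real"
  assumes sym: "\<And>x y. x \<in> J \<Longrightarrow> y \<in> J \<Longrightarrow> G x y = G y x"
    and nonneg: "\<And>x y. x \<in> J \<Longrightarrow> y \<in> J \<Longrightarrow> 0 \<le> G x y"
    and pos: "\<And>x. x \<in> J \<Longrightarrow> 0 < G x x"
    and mult: "\<And>x y z. x \<in> J \<Longrightarrow> y \<in> J \<Longrightarrow> z \<in> J \<Longrightarrow> x \<le> z \<Longrightarrow> z \<le> y \<Longrightarrow> G x y * G z z = G x z * G z y"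
    and CS: "\<And>x y. x \<in> J \<Longrightarrow> y \<in> J \<Longrightarrow> (G x y)\<^sup>2 \<le> G x x * G y y"
    and x: "\<And>i. i < n \<Longrightarrow> x i \<in> J" "\<And>i j. i < j \<Longrightarrow> j < n \<Longrightarrow> x i \<le> x j"
    and y: "\<And>i. i < n \<Longrightarrow> y i \<in> J" "\<And>i j. i < j \<Longrightarrow> j < n \<Longrightarrow> y i \<le> y j"
  shows "0 \<le> Determinant.det (mat n n (\<lambda>(i, j). G (x i) (y j)))"
proof -
  \<comment> \<open>Nonnegativity of the pivot for \<open>s = G a p / G p p\<close>. It is an
    equality for \<open>b\<close> above \<open>p\<close>; for \<open>b\<close> below
    \<open>p\<close>, multiplicativity at the middle one of the three points leaves a square, which
    Cauchy-Schwarz bounds.\<close>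
  have minor: "G a p * G p b \<le> G a b * G p p" if J: "a \<in> J" "b \<in> J" "p \<in> J" and "a \<le> p" for a b p
  proof -
    consider "p \<le> b" | "a \<le> b" "b \<le> p" | "b \<le> a" "b \<le> p" using \<open>a \<le> p\<close> by force
    then show ?thesis
    proof cases
      case 1
      then show ?thesis using mult[of a b p] J \<open>a \<le> p\<close> by simp
    next
      case 2
      have "(G a p * G p b) * G b b = G a b * (G b p)\<^sup>2"
        using mult[of a p b] J 2 sym[of p b] by (simp add: power2_eq_square mult_ac)
      also have "\<dots> \<le> G a b * (G b b * G p p)"
        using J by (intro mult_left_mono CS nonneg)
      finally have "(G a p * G p b) * G b b \<le> (G a b * G p p) * G b b" by (simp add: mult_ac)
      then show ?thesis using pos[of b] J by simp
    next
      case 3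
      have "G b p * G a a = G b a * G a p"
        using mult[of b p a] J 3 \<open>a \<le> p\<close> by simp
      then have "(G a p * G p b) * G a a = G a b * (G a p)\<^sup>2"
        using J sym[of p b] sym[of b a] by (simp add: power2_eq_square mult_ac)
      also have "\<dots> \<le> G a b * (G a a * G p p)"
        using J by (intro mult_left_mono CS nonneg)
      finally have "(G a p * G p b) * G a a \<le> (G a b * G p p) * G a a" by (simp add: mult_ac)
      then show ?thesis using pos[of a] J by simp
    qed
  qed
  have step: "0 \<le> Determinant.det (mat (Suc (Suc n)) (Suc (Suc n)) (\<lambda>(i, j). G (x i) (y j)))"
    if IH: "0 \<le> Determinant.det (mat (Suc n) (Suc n) (\<lambda>(i, j). G (x (Suc i)) (y (Suc j))))"
      and xJ: "\<And>i. i < Suc (Suc n) \<Longrightarrow> x i \<in> J" and yJ: "\<And>i. i < Suc (Suc n) \<Longrightarrow> y i \<in> J"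
      and x01: "x 0 \<le> x 1" and xy: "\<And>j. 1 \<le> j \<Longrightarrow> j < Suc (Suc n) \<Longrightarrow> x 1 \<le> y j"
    for n x y
  proof -
    define s where "s = G (x 0) (x 1) / G (x 1) (x 1)"
    have p1: "0 < G (x 1) (x 1)" using pos xJ by simp
    have row: "G (x 0) (y j) = s * G (x 1) (y j)" if "1 \<le> j" "j < Suc (Suc n)" for j
      using mult[of "x 0" "y j" "x 1"] xJ[of 0] xJ[of 1] yJ[OF that(2)] x01 xy[OF that] p1
      by (simp add: s_def field_simps)
    have "s * G (x 1) (y 0) \<le> G (x 0) (y 0)"
      using minor[of "x 0" "y 0" "x 1"] xJ[of 0] xJ[of 1] yJ[of 0] x01 p1
      by (simp add: s_def field_simps)
    then show ?thesis
      using IH by (subst det_mat_reduce_row[OF row]) auto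
  qed
  show ?thesis
    using x y
  proof (induction n arbitrary: x y)
    case 0
    then show ?case by simp
  next
    case (Suc m)
    show ?case
    proof (cases m)
      case 0
      then show ?thesis
        using Suc.prems(1)[of 0] Suc.prems(3)[of 0] nonneg by (simp add: det_single)
    next
      case (Suc k)
      note prems = Suc.prems[unfolded Suc]
      have IH: "0 \<le> Determinant.det (mat (Suc k) (Suc k) (\<lambda>(i, j). G (x (Suc i)) (y (Suc j))))"
        using Suc.IH[of "\<lambda>i. x (Suc i)" "\<lambda>i. y (Suc i)"] prems Suc by auto
      have le1: "f 1 \<le> f j" if "\<And>i j. i < j \<Longrightarrow> j < Suc (Suc k) \<Longrightarrow> f i \<le> f j" "1 \<le> j" "j < Suc (Suc k)"
        for j and f :: "nat \<Rightarrow> 'a"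
        using that(1)[of 1 j] that(2,3) by (cases "j = 1") auto
      \<comment> \<open>The point of reduction has to lie below all later points of the other
        family: \<open>x 1\<close> does if \<open>x 1 \<le> y 1\<close>, and otherwise
        \<open>y 1\<close> does.\<close>
      show ?thesis
      proof (cases "x 1 \<le> y 1")
        case True
        have "x 1 \<le> y j" if "1 \<le> j" "j < Suc (Suc k)" for j
          using True le1[of y j] prems(4) that by force
        with IH prems show ?thesis
          unfolding Suc by (intro step) auto
      next
        case False
        have yx: "y 1 \<le> x j" if "1 \<le> j" "j < Suc (Suc k)" for j
          using False le1[of x j] prems(2) that by force
        have tr: "Determinant.det (mat q q (\<lambda>(i, j). G (u i) (v j)))
            = Determinant.det (mat q q (\<lambda>(i, j). G (v i) (u j)))"
          if "\<And>i. i < q \<Longrightarrow> u i \<in> J" "\<And>i. i < q \<Longrightarrow> v i \<in> J" for q u v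
        proof -
          have "mat q q (\<lambda>(i, j). G (v i) (u j)) = transpose_mat (mat q q (\<lambda>(i, j). G (u i) (v j)))"
            using that by (intro eq_matI) (auto intro: sym)
          then show ?thesis by (simp add: det_transpose[of _ q])
        qed
        have "0 \<le> Determinant.det (mat (Suc k) (Suc k) (\<lambda>(i, j). G (y (Suc i)) (x (Suc j))))"
          using IH prems by (subst tr) auto
        then have "0 \<le> Determinant.det (mat (Suc (Suc k)) (Suc (Suc k)) (\<lambda>(i, j). G (y i) (x j)))"
          using yx prems by (intro step) auto
        then show ?thesis
          unfolding Suc using prems by (subst tr) auto
      qed
    qed
  qed
qed

text \<open>The functions may themselves be sections of a kernel: \<open>u i = K (x i)\<close> gives
  the determinant of \<open>K (x i) (y j)\<close>. So the facts below serve the eigenfunctions,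
  \<open>G\<close> and \<open>q t\<close> alike.\<close>

definition alternant :: "nat \<Rightarrow> (nat \<Rightarrow> 'a \<Rightarrow> real) \<Rightarrow> (nat \<Rightarrow> 'a) \<Rightarrow> real" where
  "alternant n u x = Determinant.det (mat n n (\<lambda>(i, j). u i (x j)))"

lemma alternant_eq_sum:
  "alternant n u x = (\<Sum>p | p permutes {..<n}. of_int (sign p) * (\<Prod>i<n. u i (x (p i))))"
  unfolding alternant_def by (rule det_mat_eq_sum)

lemma permutation_of_permutes_lessThan: "p permutes {..<n::nat} \<Longrightarrow> permutation p"
  by (rule permutation_permutes[THEN iffD2]) auto

lemma alternant_permute:
  assumes "p permutes {..<n}"
  shows "alternant n u (x \<circ> p) = of_int (sign p) * alternant n u x"
proof -
  have "alternant n u x = (\<Sum>q | q permutes {..<n}. of_int (sign (p \<circ> q)) * (\<Prod>i<n. u i (x ((p \<circ> q) i))))"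
    unfolding alternant_eq_sum by (rule setum_permutations_compose_left[OF assms])
  also have "\<dots> = (\<Sum>q | q permutes {..<n}. of_int (sign p) * (of_int (sign q) * (\<Prod>i<n. u i ((x \<circ> p) (q i)))))"
    using assms by (intro sum.cong) (auto simp: sign_compose permutation_of_permutes_lessThan)
  also have "\<dots> = of_int (sign p) * alternant n u (x \<circ> p)"
    unfolding alternant_eq_sum sum_distrib_left ..
  finally show ?thesis by (cases p rule: sign_cases) auto
qed

lemma alternant_permute_functions:
  assumes "p permutes {..<n}"
  shows "alternant n (\<lambda>i. u (p i)) x = of_int (sign p) * alternant n u x"
proof -
  have "alternant n (\<lambda>i. u (p i)) x
      = (\<Sum>q | q permutes {..<n}. of_int (sign (q \<circ> p)) * (\<Prod>i<n. u (p i) (x ((q \<circ> p) i))))"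
    unfolding alternant_eq_sum by (rule sum_permutations_compose_right[OF assms])
  also have "\<dots> = (\<Sum>q | q permutes {..<n}. of_int (sign p) * (of_int (sign q) * (\<Prod>i<n. u i (x (q i)))))"
  proof (intro sum.cong refl)
    fix q assume "q \<in> {q. q permutes {..<n}}"
    moreover have "(\<Prod>i<n. u (p i) (x ((q \<circ> p) i))) = (\<Prod>i<n. u i (x (q i)))"
      using prod.permute[OF assms, of "\<lambda>i. u i (x (q i))"] by (simp add: comp_def)
    ultimately show "of_int (sign (q \<circ> p)) * (\<Prod>i<n. u (p i) (x ((q \<circ> p) i)))
        = real_of_int (sign p) * (of_int (sign q) * (\<Prod>i<n. u i (x (q i))))"
      using assms by (simp add: sign_compose permutation_of_permutes_lessThan)
  qed
  also have "\<dots> = of_int (sign p) * alternant n u x"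
    unfolding alternant_eq_sum sum_distrib_left ..
  finally show ?thesis .
qed

lemma alternant_repeated_function:
  assumes "i < n" "j < n" "i \<noteq> j" "u i = u j"
  shows "alternant n u x = 0"
proof -
  have "alternant n (\<lambda>k. u (Transposition.transpose i j k)) x
    = of_int (sign (Transposition.transpose i j)) * alternant n u x"
    using assms by (intro alternant_permute_functions permutes_swap_id) auto
  moreover have "(\<lambda>k. u (Transposition.transpose i j k)) = u"
    using assms by (auto simp: Transposition.transpose_def)
  ultimately show ?thesis using assms(3) by (simp add: sign_swap_id)
qed

text \<open>A sorting permutation is the inverse of the rank map, which counts smaller values;
  distinctness makes the rank map injective. Applied to real coordinates it says that almost every
  point lies in exactly one permuted chamber; applied to indices it sorts them into an increasing
  tuple.\<close>

lemma ex1_sorting_permutation: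
  fixes x :: "nat \<Rightarrow> 'a::linorder"
  assumes inj: "inj_on x {..<n}"
  shows "\<exists>!p. p permutes {..<n} \<and> (\<forall>i j. i < j \<and> j < n \<longrightarrow> x (p i) \<le> x (p j))"
proof -
  define rank where "rank i = (if i < n then card {k. k < n \<and> x k < x i} else i)" for i
  have rank_mono: "rank i < rank j" if "i < n" "j < n" "x i < x j" for i j
    unfolding rank_def using that by (auto intro!: psubset_card_mono)
  have "rank i < n" if "i < n" for i
  proof -
    have "card {k. k < n \<and> x k < x i} < card {..<n}"
      using that by (intro psubset_card_mono) auto
    then show ?thesis using that by (simp add: rank_def)
  qed
  then have sub: "rank ` {..<n} \<subseteq> {..<n}" by auto
  have rank_inj: "inj_on rank {..<n}"
  proof (rule inj_onI)
    fix i j assume ij: "i \<in> {..<n}" "j \<in> {..<n}" "rank i = rank j"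
    then have "\<not> x i < x j" "\<not> x j < x i" using rank_mono by force+
    then show "i = j" using inj ij by (auto dest: inj_onD)
  qed
  have "bij_betw rank {..<n} {..<n}"
    using rank_inj endo_inj_surj[OF _ sub rank_inj] by (simp add: bij_betw_def)
  then have perm: "rank permutes {..<n}"
    by (rule bij_imp_permutes) (simp add: rank_def)
  let ?q = "Hilbert_Choice.inv rank"
  have q: "?q permutes {..<n}" using perm by (rule permutes_inv)
  have rq: "rank (?q a) = a" for a using perm by (rule permutes_inverses)
  show ?thesis
  proof (rule ex1I[of _ ?q], intro conjI allI impI)
    show "?q permutes {..<n}" by (rule q)
    fix i j assume ij: "i < j \<and> j < n"
    then have "?q i < n" "?q j < n" using permutes_in_image[OF q] by force+
    show "x (?q i) \<le> x (?q j)"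
    proof (rule ccontr)
      assume "\<not> x (?q i) \<le> x (?q j)"
      then have "rank (?q j) < rank (?q i)"
        using \<open>?q i < n\<close> \<open>?q j < n\<close> by (intro rank_mono) auto
      then show False using ij by (simp add: rq)
    qed
  next
    fix p assume p: "p permutes {..<n} \<and> (\<forall>i j. i < j \<and> j < n \<longrightarrow> x (p i) \<le> x (p j))"
    then have pp: "p permutes {..<n}" by simp
    have pn: "p i < n \<longleftrightarrow> i < n" for i using permutes_in_image[OF pp, of i] by simp
    have lt: "x (p i) < x (p j)" if "i < j" "j < n" for i j
    proof -
      have "x (p i) \<noteq> x (p j)"
        using inj_onD[OF inj, of "p i" "p j"] pn[of i] pn[of j] that permutes_inj[OF pp]
        by (auto simp: inj_eq)
      then show ?thesis using p that by (simp add: order_less_le)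
    qed
    have lt_iff: "x (p i) < x (p j) \<longleftrightarrow> i < j" if "i < n" "j < n" for i j
      using lt[of i j] lt[of j i] that by (cases i j rule: linorder_cases) auto
    have "rank (p i) = i" for i
    proof (cases "i < n")
      case True
      have "{k. k < n \<and> x k < x (p i)} = p ` {..<i}"
      proof (intro equalityI subsetI)
        fix k assume k: "k \<in> {k. k < n \<and> x k < x (p i)}"
        then have "k \<in> p ` {..<n}" using permutes_image[OF pp] by auto
        then obtain k' where "k = p k'" "k' < n" by auto
        then show "k \<in> p ` {..<i}" using k lt_iff[of k' i] True by auto
      qed (use True pn lt in auto)
      then show ?thesis
        using True pn by (simp add: rank_def card_image[OF permutes_inj_on[OF pp]])
    next
      case False
      then show ?thesis using pp by (simp add: rank_def permutes_not_in)
    qed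
    then have "?q (rank (p i)) = ?q i" for i by simp
    then show "p = ?q" using permutes_inverses(2)[OF perm] by auto
  qed
qed

lemma indicator_mult_square: "(indicator A x * f x)\<^sup>2 = indicator A x * (f x)\<^sup>2" for f :: "'a \<Rightarrow> real"
  by (simp split: split_indicator)

lemma indicator_square: "(indicator A x :: real)\<^sup>2 = indicator A x"
  by (simp split: split_indicator)

section \<open>The Weyl chamber in the product space\<close>

text \<open>\<open>borel_id\<close> makes comparisons of coordinates measurable, and
  \<open>nonatomic\<close> makes the diagonals null, so that the permuted chambers overlap in null
  sets only.\<close>

locale weyl_product = sigma_finite_measure M for M :: "real measure" +
  fixes n :: nat
  assumes borel_id: "(\<lambda>x. x) \<in> borel_measurable M"
    and nonatomic: "AE x in M. x \<noteq> y"
begin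

sublocale product: product_sigma_finite "\<lambda>_::nat. M"
  by standard

abbreviation "prodM \<equiv> Pi\<^sub>M {..<n} (\<lambda>_. M)"
abbreviation "W \<equiv> weyl_chamber n (space M)"
abbreviation "chamM \<equiv> chamber_measure n M"

lemma sigma_finite_prodM: "sigma_finite_measure prodM"
  by (rule product.sigma_finite) simp

lemma component_borel: "i < n \<Longrightarrow> (\<lambda>x. x i) \<in> borel_measurable prodM"
  by (rule measurable_compose[OF measurable_component_singleton[of i "{..<n}" "\<lambda>_. M"] borel_id]) simp

lemma weyl_chamber_sets: "W \<in> sets prodM"
proof -
  have "W = {x \<in> space prodM. \<forall>j\<in>{..<n}. \<forall>i\<in>{..<j}. x i \<le> x j}"
    by (auto simp: weyl_chamber_def space_PiM)
  also have "\<dots> \<in> sets prodM"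
    by (intro sets.sets_Collect_finite_All borel_measurable_le component_borel) auto
  finally show ?thesis .
qed

lemma space_chamM: "space chamM = W"
  using sets.sets_into_space[OF weyl_chamber_sets] by (auto simp: chamber_measure_def space_restrict_space)

lemma weyl_chamber_Int_sets [simp]: "W \<inter> space prodM \<in> sets prodM"
  using weyl_chamber_sets by auto

lemma borel_measurable_chamM_iff:
  "f \<in> borel_measurable chamM \<longleftrightarrow> (\<lambda>x. indicator W x * f x :: real) \<in> borel_measurable prodM"
  unfolding chamber_measure_def by (subst borel_measurable_restrict_space_iff) auto

lemma L2_chamM_iff: "f \<in> L2 chamM \<longleftrightarrow> (\<lambda>x. indicator W x * f x) \<in> L2 prodM"
proof -
  have "integrable chamM (\<lambda>x. (f x)\<^sup>2) \<longleftrightarrow> integrable prodM (\<lambda>x. (indicator W x * f x)\<^sup>2)"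
    unfolding chamber_measure_def
    by (subst integrable_restrict_space) (auto simp: indicator_mult_square)
  then show ?thesis by (simp add: L2_def borel_measurable_chamM_iff)
qed

lemma integral_chamM: "(\<integral>x. f x \<partial>chamM) = (\<integral>x. indicator W x * f x \<partial>prodM)" for f :: "_ \<Rightarrow> real"
  unfolding chamber_measure_def by (subst integral_restrict_space) auto

lemma L2_restrict_chamM:
  assumes "f \<in> L2 prodM"
  shows "f \<in> L2 chamM"
proof -
  have "integrable prodM (\<lambda>x. indicator W x * (f x)\<^sup>2)"
    using integrable_real_mult_indicator[OF weyl_chamber_sets, of "\<lambda>x. (f x)\<^sup>2"] assms
    by (simp add: L2_def mult.commute)
  then show ?thesis
    using assms weyl_chamber_sets by (subst L2_chamM_iff) (auto simp: L2_def indicator_mult_square)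
qed

lemma permute_measurable:
  assumes "p permutes {..<n}"
  shows "(\<lambda>x. x \<circ> p) \<in> prodM \<rightarrow>\<^sub>M prodM"
proof (rule measurable_PiM_single')
  show "(\<lambda>x. (x \<circ> p) i) \<in> prodM \<rightarrow>\<^sub>M M" if "i \<in> {..<n}" for i
    using that permutes_in_image[OF assms, of i] by (auto intro: measurable_component_singleton)
  show "(\<lambda>x i. (x \<circ> p) i) \<in> space prodM \<rightarrow> {..<n} \<rightarrow>\<^sub>E space M"
    using permutes_in_image[OF assms] permutes_not_in[OF assms]
    by (auto simp: space_PiM PiE_iff extensional_def)
qed

text \<open>A product measure is determined by rectangles, and the preimage of a rectangle has the
  same sides in another order.\<close>

lemma distr_permute:
  assumes p: "p permutes {..<n}"
  shows "distr prodM prodM (\<lambda>x. x \<circ> p) = prodM"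
proof (rule product.PiM_eqI)
  fix A :: "nat \<Rightarrow> real set" assume A: "\<And>i. i \<in> {..<n} \<Longrightarrow> A i \<in> sets M"
  let ?q = "Hilbert_Choice.inv p"
  have q: "?q permutes {..<n}" using p by (rule permutes_inv)
  have qn: "?q i < n \<longleftrightarrow> i < n" for i using permutes_in_image[OF q, of i] by simp
  have pn: "p i < n \<longleftrightarrow> i < n" for i using permutes_in_image[OF p, of i] by simp
  have As: "A i \<subseteq> space M" if "i < n" for i using A[of i] that sets.sets_into_space by auto
  have "(\<lambda>x. x \<circ> p) -` Pi\<^sub>E {..<n} A \<inter> space prodM = Pi\<^sub>E {..<n} (\<lambda>i. A (?q i))"
  proof (intro equalityI subsetI)
    fix x assume x: "x \<in> (\<lambda>x. x \<circ> p) -` Pi\<^sub>E {..<n} A \<inter> space prodM"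
    then have "x (p i) \<in> A i" if "i < n" for i using that by (auto simp: PiE_iff)
    then have "x i \<in> A (?q i)" if "i < n" for i
      using that qn[of i] permutes_inverses(1)[OF p, of i] by metis
    with x show "x \<in> Pi\<^sub>E {..<n} (\<lambda>i. A (?q i))" by (auto simp: PiE_iff space_PiM)
  next
    fix x assume x: "x \<in> Pi\<^sub>E {..<n} (\<lambda>i. A (?q i))"
    have "x (p i) \<in> A i" if "i < n" for i
      using x that pn[of i] permutes_inverses(2)[OF p, of i] by (force simp: PiE_iff)
    moreover have "x i \<in> space M" if "i < n" for i
      using x that As[of "?q i"] qn[of i] by (auto simp: PiE_iff)
    ultimately show "x \<in> (\<lambda>x. x \<circ> p) -` Pi\<^sub>E {..<n} A \<inter> space prodM"
      using x permutes_not_in[OF p] by (auto simp: PiE_iff space_PiM extensional_def)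
  qed
  then have "emeasure (distr prodM prodM (\<lambda>x. x \<circ> p)) (Pi\<^sub>E {..<n} A)
      = emeasure prodM (Pi\<^sub>E {..<n} (\<lambda>i. A (?q i)))"
    using A by (subst emeasure_distr[OF permute_measurable[OF p]]) (auto intro: sets_PiM_I_finite)
  also have "\<dots> = (\<Prod>i<n. emeasure M (A (?q i)))"
    using A qn by (subst product.emeasure_PiM) auto
  also have "\<dots> = (\<Prod>i<n. emeasure M (A i))"
    using prod.permute[OF q, of "\<lambda>i. emeasure M (A i)"] by (simp add: comp_def)
  finally show "emeasure (distr prodM prodM (\<lambda>x. x \<circ> p)) (Pi\<^sub>E {..<n} A) = (\<Prod>i<n. emeasure M (A i))" .
qed simp_all

lemma integral_permute:
  fixes f :: "(nat \<Rightarrow> real) \<Rightarrow> real"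
  assumes "p permutes {..<n}" "f \<in> borel_measurable prodM"
  shows "(\<integral>x. f (x \<circ> p) \<partial>prodM) = (\<integral>x. f x \<partial>prodM)"
  using integral_distr[OF permute_measurable[OF assms(1)] assms(2)] by (simp add: distr_permute[OF assms(1)])

lemma integrable_permute:
  fixes f :: "(nat \<Rightarrow> real) \<Rightarrow> real"
  assumes "p permutes {..<n}" "integrable prodM f"
  shows "integrable prodM (\<lambda>x. f (x \<circ> p))"
proof -
  have "integrable (distr prodM prodM (\<lambda>x. x \<circ> p)) f"
    using assms by (simp add: distr_permute)
  then show ?thesis by (rule integrable_distr[OF permute_measurable[OF assms(1)]])
qed

lemma L2_permute:
  assumes "p permutes {..<n}" "f \<in> L2 prodM"
  shows "(\<lambda>x. f (x \<circ> p)) \<in> L2 prodM"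
  using assms integrable_permute[of p "\<lambda>x. (f x)\<^sup>2"] measurable_compose[OF permute_measurable[OF assms(1)], of f borel]
  by (simp add: L2_def)

text \<open>Integrate first over coordinate \<open>i\<close>: with the others fixed,
  \<open>x i = x j\<close> describes a single point, which is null.\<close>

lemma AE_distinct: "AE x in prodM. inj_on x {..<n}"
proof -
  have "AE x in prodM. x i \<noteq> x j" if ij: "i < n" "j < n" "i \<noteq> j" for i j
  proof -
    let ?I = "{..<n} - {i}"
    have I: "insert i ?I = {..<n}" using ij by auto
    have [measurable]: "(\<lambda>x. x i) \<in> borel_measurable prodM" "(\<lambda>x. x j) \<in> borel_measurable prodM"
      using ij by (auto intro: component_borel)
    let ?f = "\<lambda>x. indicator {x \<in> space prodM. x i = x j} x :: ennreal"
    have f: "?f \<in> borel_measurable prodM" by measurable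
    have "(\<integral>\<^sup>+x. ?f x \<partial>prodM) = (\<integral>\<^sup>+x. ?f x \<partial>Pi\<^sub>M (insert i ?I) (\<lambda>_. M))"
      by (simp only: I)
    also have "\<dots> = (\<integral>\<^sup>+x. (\<integral>\<^sup>+y. ?f (x(i := y)) \<partial>M) \<partial>Pi\<^sub>M ?I (\<lambda>_. M))"
      using f by (intro product.product_nn_integral_insert) (auto simp only: I)
    also have "\<dots> = (\<integral>\<^sup>+x. 0 \<partial>Pi\<^sub>M ?I (\<lambda>_. M))"
    proof (intro nn_integral_cong)
      fix x
      have "(\<integral>\<^sup>+y. ?f (x(i := y)) \<partial>M) = (\<integral>\<^sup>+y. 0 \<partial>M)"
        using nonatomic[of "x j"] ij by (intro nn_integral_cong_AE) (auto elim!: eventually_mono)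
      then show "(\<integral>\<^sup>+y. ?f (x(i := y)) \<partial>M) = 0" by simp
    qed
    finally have "AE x in prodM. ?f x = 0"
      using nn_integral_0_iff_AE[OF f] by simp
    then show ?thesis using AE_space by eventually_elim (auto simp: indicator_def split: if_splits)
  qed
  then have "AE x in prodM. \<forall>i\<in>{..<n}. \<forall>j\<in>{..<n}. i \<noteq> j \<longrightarrow> x i \<noteq> x j"
    by (intro AE_finite_allI) auto
  then show ?thesis by eventually_elim (auto simp: inj_on_def)
qed

section \<open>Tensor products, skew-symmetric extension and Andreief's identity\<close>

lemma L2_tensor:
  assumes u: "\<And>i. i < n \<Longrightarrow> u i \<in> L2 M"
  shows "(\<lambda>x. \<Prod>i<n. u i (x i)) \<in> L2 prodM"
    and "(\<integral>x. (\<Prod>i<n. u i (x i))\<^sup>2 \<partial>prodM) = (\<Prod>i<n. \<integral>x. (u i x)\<^sup>2 \<partial>M)"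
proof -
  have "(\<lambda>x. u i (x i)) \<in> borel_measurable prodM" if "i < n" for i
    using measurable_compose[OF measurable_component_singleton[of i "{..<n}" "\<lambda>_. M"] L2_measurable[OF u]] that
    by simp
  then have "(\<lambda>x. \<Prod>i<n. u i (x i)) \<in> borel_measurable prodM"
    by (intro borel_measurable_prod) auto
  moreover have "integrable prodM (\<lambda>x. \<Prod>i<n. (u i (x i))\<^sup>2)"
    using u by (intro product.product_integrable_prod) (auto intro: L2_integrable_square)
  ultimately show "(\<lambda>x. \<Prod>i<n. u i (x i)) \<in> L2 prodM"
    by (simp add: L2_def prod_power_distrib)
  show "(\<integral>x. (\<Prod>i<n. u i (x i))\<^sup>2 \<partial>prodM) = (\<Prod>i<n. \<integral>x. (u i x)\<^sup>2 \<partial>M)"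
    unfolding prod_power_distrib
    using u by (intro product.product_integral_prod) (auto intro: L2_integrable_square)
qed

lemma L2_tensor_permute:
  assumes "\<And>i. i < n \<Longrightarrow> u i \<in> L2 M" "p permutes {..<n}"
  shows "(\<lambda>x. \<Prod>i<n. u i (x (p i))) \<in> L2 prodM"
  using L2_permute[OF assms(2) L2_tensor(1)[of u]] assms(1) by simp

lemma L2_alternant:
  assumes "\<And>i. i < n \<Longrightarrow> u i \<in> L2 M"
  shows "alternant n u \<in> L2 prodM"
proof -
  have "(\<lambda>x. \<Sum>p | p permutes {..<n}. of_int (sign p) * (\<Prod>i<n. u i (x (p i)))) \<in> L2 prodM"
    by (intro L2_sum L2_cmult L2_tensor_permute assms) auto
  then show ?thesis by (simp add: alternant_eq_sum[abs_def])
qed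

text \<open>The skew-symmetric extension of a function from the chamber to the whole product: where
  coordinates are distinct exactly one summand survives. It converts integrals against determinants
  on the chamber into integrals against tensor products on the product space.\<close>

definition skew_ext :: "((nat \<Rightarrow> real) \<Rightarrow> real) \<Rightarrow> (nat \<Rightarrow> real) \<Rightarrow> real" where
  "skew_ext f x = (\<Sum>p | p permutes {..<n}. of_int (sign p) * (indicator W (x \<circ> p) * f (x \<circ> p)))"

lemma L2_skew_ext:
  assumes "f \<in> L2 chamM"
  shows "skew_ext f \<in> L2 prodM"
proof -
  have "(\<lambda>x. \<Sum>p | p permutes {..<n}. of_int (sign p) * (indicator W (x \<circ> p) * f (x \<circ> p))) \<in> L2 prodM"
    using assms by (intro L2_sum L2_cmult L2_permute[where f = "\<lambda>x. indicator W x * f x"]) (auto simp: L2_chamM_iff)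
  then show ?thesis by (simp add: skew_ext_def[abs_def])
qed

lemma comp_permute_in_weyl_chamber_iff:
  assumes x: "x \<in> space prodM" and p: "p permutes {..<n}"
  shows "x \<circ> p \<in> W \<longleftrightarrow> (\<forall>i j. i < j \<and> j < n \<longrightarrow> x (p i) \<le> x (p j))"
  using measurable_space[OF permute_measurable[OF p] x] by (auto simp: weyl_chamber_def space_PiM)

lemma skew_ext_eq:
  assumes x: "x \<in> space prodM" "inj_on x {..<n}" and p: "p permutes {..<n}" "x \<circ> p \<in> W"
  shows "skew_ext f x = of_int (sign p) * f (x \<circ> p)"
proof -
  have "x \<circ> q \<in> W \<longleftrightarrow> q = p" if "q permutes {..<n}" for q
    using ex1_sorting_permutation[OF x(2)] p that comp_permute_in_weyl_chamber_iff[OF x(1)] by blast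
  then have "skew_ext f x = (\<Sum>q | q permutes {..<n}. if q = p then of_int (sign p) * f (x \<circ> p) else 0)"
    unfolding skew_ext_def by (intro sum.cong) auto
  then show ?thesis using p by (simp add: finite_permutations)
qed

lemma skew_ext_eq_on_chamber:
  assumes "x \<in> W" "inj_on x {..<n}"
  shows "skew_ext f x = f x"
  using skew_ext_eq[of x id f] assms sets.sets_into_space[OF weyl_chamber_sets] by (auto simp: permutes_id)

lemma skew_ext_alternant:
  assumes x: "x \<in> space prodM" "inj_on x {..<n}"
  shows "skew_ext (alternant n u) x = alternant n u x"
proof -
  obtain p where p: "p permutes {..<n}" "x \<circ> p \<in> W"
    using ex1_sorting_permutation[OF x(2)] comp_permute_in_weyl_chamber_iff[OF x(1)] by blast
  show ?thesis
    unfolding skew_ext_eq[OF x p] alternant_permute[OF p(1)] by (cases p rule: sign_cases) auto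
qed

text \<open>Expand the determinant and, in the term of \<open>p\<close>, substitute the inverse of
  \<open>p\<close>: the tensor product becomes the same in every term and the permuted copies of
  \<open>f\<close> add up to the extension.\<close>

lemma integral_chamber_alternant:
  assumes f: "f \<in> L2 chamM" and u: "\<And>i. i < n \<Longrightarrow> u i \<in> L2 M"
  shows "(\<integral>x. f x * alternant n u x \<partial>chamM) = (\<integral>x. skew_ext f x * (\<Prod>i<n. u i (x i)) \<partial>prodM)"
proof -
  let ?P = "{p. p permutes {..<n}}"
  let ?f = "\<lambda>x. indicator W x * f x"
  let ?I = "\<lambda>p. \<integral>x. ?f (x \<circ> p) * (\<Prod>i<n. u i (x i)) \<partial>prodM"
  have fL: "?f \<in> L2 prodM" using f by (simp add: L2_chamM_iff)
  have int1: "integrable prodM (\<lambda>x. ?f x * (\<Prod>i<n. u i (x (p i))))" if "p \<in> ?P" for p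
    using that by (intro L2_integrable_mult fL L2_tensor_permute u) auto
  have int2: "integrable prodM (\<lambda>x. ?f (x \<circ> p) * (\<Prod>i<n. u i (x i)))" if "p \<in> ?P" for p
    using that by (intro L2_integrable_mult L2_permute[OF _ fL] L2_tensor u) auto
  have "(\<integral>x. f x * alternant n u x \<partial>chamM)
     = (\<integral>x. (\<Sum>p\<in>?P. of_int (sign p) * (?f x * (\<Prod>i<n. u i (x (p i))))) \<partial>prodM)"
    unfolding integral_chamM alternant_eq_sum by (simp add: sum_distrib_left mult_ac)
  also have "\<dots> = (\<Sum>p\<in>?P. of_int (sign p) * (\<integral>x. ?f x * (\<Prod>i<n. u i (x (p i))) \<partial>prodM))"
    using int1 by simp
  also have "\<dots> = (\<Sum>p\<in>?P. of_int (sign (Hilbert_Choice.inv p)) * ?I (Hilbert_Choice.inv p))"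
  proof (intro sum.cong refl arg_cong2[of _ _ _ _ "(*)"])
    fix p assume "p \<in> ?P"
    then have p: "p permutes {..<n}" by simp
    show "real_of_int (sign p) = of_int (sign (Hilbert_Choice.inv p))"
      using sign_inverse[OF permutation_of_permutes_lessThan[OF p]] by simp
    have "(\<integral>x. ?f x * (\<Prod>i<n. u i (x (p i))) \<partial>prodM)
       = (\<integral>x. ?f (x \<circ> Hilbert_Choice.inv p) * (\<Prod>i<n. u i ((x \<circ> Hilbert_Choice.inv p) (p i))) \<partial>prodM)"
      using int1[of p] p
      by (intro integral_permute[symmetric, where f = "\<lambda>x. ?f x * (\<Prod>i<n. u i (x (p i)))"] permutes_inv) auto
    then show "(\<integral>x. ?f x * (\<Prod>i<n. u i (x (p i))) \<partial>prodM) = ?I (Hilbert_Choice.inv p)"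
      by (simp add: permutes_inverses(2)[OF p])
  qed
  also have "\<dots> = (\<Sum>p\<in>?P. of_int (sign p) * ?I p)"
    by (rule sum_permutations_inverse[symmetric])
  also have "\<dots> = (\<integral>x. (\<Sum>p\<in>?P. of_int (sign p) * (?f (x \<circ> p) * (\<Prod>i<n. u i (x i)))) \<partial>prodM)"
    using int2 by simp
  also have "\<dots> = (\<integral>x. skew_ext f x * (\<Prod>i<n. u i (x i)) \<partial>prodM)"
    unfolding skew_ext_def by (simp add: sum_distrib_right mult.assoc)
  finally show ?thesis .
qed

text \<open>The factor \<open>n!\<close> of the version over the whole product is absent, since only
  one chamber is integrated over.\<close>

lemma andreief_identity:
  assumes u: "\<And>i. i < n \<Longrightarrow> u i \<in> L2 M" and v: "\<And>i. i < n \<Longrightarrow> v i \<in> L2 M"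
  shows "(\<integral>x. alternant n u x * alternant n v x \<partial>chamM)
    = Determinant.det (mat n n (\<lambda>(i, j). \<integral>x. u i x * v j x \<partial>M))"
proof -
  let ?P = "{p. p permutes {..<n}}"
  let ?Q = "\<lambda>p x. \<Prod>i<n. v i (x (p i))"
  let ?I = "\<lambda>p. \<Prod>i<n. \<integral>x. u i x * v (p i) x \<partial>M"
  have vu: "alternant n v \<in> L2 chamM"
    by (intro L2_restrict_chamM L2_alternant v)
  have int: "integrable prodM (\<lambda>x. ?Q p x * (\<Prod>i<n. u i (x i)))" if "p \<in> ?P" for p
    using that by (intro L2_integrable_mult L2_tensor_permute L2_tensor u v) auto
  have "(\<integral>x. alternant n u x * alternant n v x \<partial>chamM) = (\<integral>x. alternant n v x * alternant n u x \<partial>chamM)"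
    by (simp add: mult.commute)
  also have "\<dots> = (\<integral>x. skew_ext (alternant n v) x * (\<Prod>i<n. u i (x i)) \<partial>prodM)"
    by (rule integral_chamber_alternant[OF vu u])
  \<comment> \<open>An alternant is skew-symmetric, so its extension is itself wherever coordinates
    are distinct.\<close>
  also have "\<dots> = (\<integral>x. alternant n v x * (\<Prod>i<n. u i (x i)) \<partial>prodM)"
  proof (intro integral_cong_AE)
    show "AE x in prodM. skew_ext (alternant n v) x * (\<Prod>i<n. u i (x i)) = alternant n v x * (\<Prod>i<n. u i (x i))"
      using AE_distinct AE_space by eventually_elim (simp add: skew_ext_alternant)
    show "(\<lambda>x. skew_ext (alternant n v) x * (\<Prod>i<n. u i (x i))) \<in> borel_measurable prodM"
      by (intro borel_measurable_times L2_measurable L2_skew_ext vu L2_tensor u)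
    show "(\<lambda>x. alternant n v x * (\<Prod>i<n. u i (x i))) \<in> borel_measurable prodM"
      by (intro borel_measurable_times L2_measurable L2_alternant v L2_tensor u)
  qed
  also have "\<dots> = (\<integral>x. (\<Sum>p\<in>?P. of_int (sign p) * (?Q p x * (\<Prod>i<n. u i (x i)))) \<partial>prodM)"
    unfolding alternant_eq_sum by (simp add: sum_distrib_right mult.assoc)
  also have "\<dots> = (\<Sum>p\<in>?P. of_int (sign p) * (\<integral>x. ?Q p x * (\<Prod>i<n. u i (x i)) \<partial>prodM))"
    using int by simp
  also have "\<dots> = (\<Sum>p\<in>?P. of_int (sign (Hilbert_Choice.inv p)) * ?I (Hilbert_Choice.inv p))"
  proof (intro sum.cong refl arg_cong2[of _ _ _ _ "(*)"])
    fix p assume "p \<in> ?P"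
    then have p: "p permutes {..<n}" by simp
    then have q: "Hilbert_Choice.inv p permutes {..<n}" by (rule permutes_inv)
    show "real_of_int (sign p) = of_int (sign (Hilbert_Choice.inv p))"
      using sign_inverse[OF permutation_of_permutes_lessThan[OF p]] by simp
    have "?Q p x = (\<Prod>i<n. v (Hilbert_Choice.inv p i) (x i))" for x
      using prod.permute[OF q, of "\<lambda>i. v i (x (p i))"] by (simp add: comp_def permutes_inverses(1)[OF p])
    then have "(\<integral>x. ?Q p x * (\<Prod>i<n. u i (x i)) \<partial>prodM)
        = (\<integral>x. (\<Prod>i<n. u i (x i) * v (Hilbert_Choice.inv p i) (x i)) \<partial>prodM)"
      by (simp add: prod.distrib mult.commute)
    also have "\<dots> = ?I (Hilbert_Choice.inv p)"
      using permutes_in_image[OF q]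
      by (intro product.product_integral_prod[where f = "\<lambda>i x. u i x * v (Hilbert_Choice.inv p i) x"] L2_integrable_mult u v) auto
    finally show "(\<integral>x. ?Q p x * (\<Prod>i<n. u i (x i)) \<partial>prodM) = ?I (Hilbert_Choice.inv p)" .
  qed
  also have "\<dots> = (\<Sum>p\<in>?P. of_int (sign p) * ?I p)"
    by (rule sum_permutations_inverse[symmetric])
  also have "\<dots> = Determinant.det (mat n n (\<lambda>(i, j). \<integral>x. u i x * v j x \<partial>M))"
    by (rule det_mat_eq_sum[symmetric])
  finally show ?thesis .
qed

section \<open>Completeness of the alternating products\<close>

text \<open>The positive and negative parts of \<open>F\<close> on a set of finite measure are
  densities of two finite measures that agree on rectangles, hence everywhere.\<close>

lemma AE_zero_if_rectangle_integrals_zero: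
  assumes F: "F \<in> L2 prodM"
    and zero: "\<And>A. (\<And>i. i < n \<Longrightarrow> A i \<in> sets M) \<Longrightarrow> (\<And>i. i < n \<Longrightarrow> emeasure M (A i) \<noteq> \<infinity>) \<Longrightarrow>
      (\<integral>x. F x * (\<Prod>i<n. indicator (A i) (x i)) \<partial>prodM) = 0"
  shows "AE x in prodM. F x = 0"
proof -
  \<comment> \<open>\<open>F\<close> is only square integrable; on the \<open>n\<close>-fold product
    of a set \<open>C m\<close> of finite measure it is integrable.\<close>
  obtain C :: "nat \<Rightarrow> real set" where C: "range C \<subseteq> sets M" "(\<Union>i. C i) = space M" "\<And>i. emeasure M (C i) \<noteq> \<infinity>" "incseq C"
    using sigma_finite_incseq by blast
  have Cs: "C m \<in> sets M" for m using C(1) by auto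
  have ind_L2: "(\<lambda>x. indicator A x :: real) \<in> L2 M" if "A \<in> sets M" "emeasure M A \<noteq> \<infinity>" for A
    using that by (auto simp: L2_def indicator_square less_top)
  have prod_ind: "(\<Prod>i<n. indicator (A i) (x i) :: real) = indicator (Pi\<^sub>E {..<n} A) x"
    if "x \<in> space prodM" for A and x :: "nat \<Rightarrow> real"
    using that by (auto simp: indicator_def PiE_iff space_PiM prod_zero_iff)
  have "AE x in prodM. indicator (Pi\<^sub>E {..<n} (\<lambda>_. C m)) x * F x = 0" for m
  proof -
    let ?R = "Pi\<^sub>E {..<n} (\<lambda>_. C m)"
    have R: "?R \<in> sets prodM" using Cs by (intro sets_PiM_I_finite) auto
    let ?p = "\<lambda>x. max 0 (indicator ?R x * F x)"
    let ?q = "\<lambda>x. max 0 (- (indicator ?R x * F x))"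
    have Fm[measurable]: "F \<in> borel_measurable prodM" using F by (rule L2_measurable)
    note [measurable] = R
    have int: "integrable prodM (\<lambda>x. F x * (\<Prod>i<n. indicator (A i) (x i)))"
      if "\<And>i. i < n \<Longrightarrow> A i \<in> sets M" "\<And>i. i < n \<Longrightarrow> emeasure M (A i) \<noteq> \<infinity>" for A
      using that by (intro L2_integrable_mult F L2_tensor(1)[of "\<lambda>i. indicator (A i)"] ind_L2) auto
    have intR: "integrable prodM (\<lambda>x. indicator ?R x * F x)"
      using int[of "\<lambda>_. C m"] Cs C(3)
      by (subst Bochner_Integration.integrable_cong[where g = "\<lambda>x. F x * (\<Prod>i<n. indicator (C m) (x i))", OF refl])
        (auto simp: prod_ind mult.commute)
    have intp: "integrable prodM (\<lambda>x. ?p x * indicator B x)" and intq: "integrable prodM (\<lambda>x. ?q x * indicator B x)"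
      if "B \<in> sets prodM" for B
      using that intR by (auto intro!: integrable_real_mult_indicator)
    have meas: "emeasure (density prodM (\<lambda>x. ennreal (h x))) B = ennreal (\<integral>x. h x * indicator B x \<partial>prodM)"
      if "B \<in> sets prodM" "\<And>x. 0 \<le> h x" "integrable prodM (\<lambda>x. h x * indicator B x)" "h \<in> borel_measurable prodM" for h B
    proof -
      have "emeasure (density prodM (\<lambda>x. ennreal (h x))) B = (\<integral>\<^sup>+x. ennreal (h x * indicator B x) \<partial>prodM)"
        using that by (subst emeasure_density) (auto intro!: nn_integral_cong split: split_indicator)
      also have "\<dots> = ennreal (\<integral>x. h x * indicator B x \<partial>prodM)"
        using that by (intro nn_integral_eq_integral) auto
      finally show ?thesis .
    qed
    have "density prodM (\<lambda>x. ennreal (?p x)) = density prodM (\<lambda>x. ennreal (?q x))"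
    proof (rule measure_eqI_PiM_finite)
      fix A :: "nat \<Rightarrow> real set" assume A: "\<And>i. i \<in> {..<n} \<Longrightarrow> A i \<in> sets M"
      let ?B = "Pi\<^sub>E {..<n} A"
      have B: "?B \<in> sets prodM" using A by (intro sets_PiM_I_finite) auto
      have AC: "A i \<inter> C m \<in> sets M" "emeasure M (A i \<inter> C m) \<noteq> \<infinity>" if "i < n" for i
        using A[of i] that Cs C(3)[of m] emeasure_mono[of "A i \<inter> C m" "C m" M] by (auto simp: top_unique)
      have RB: "indicator ?R x * indicator ?B x = (\<Prod>i<n. indicator (A i \<inter> C m) (x i) :: real)"
        if "x \<in> space prodM" for x
        using prod_ind[OF that, of "\<lambda>i. A i \<inter> C m"] by (auto simp: indicator_def PiE_iff)
      have "(\<integral>x. ?p x * indicator ?B x \<partial>prodM) - (\<integral>x. ?q x * indicator ?B x \<partial>prodM)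
          = (\<integral>x. ?p x * indicator ?B x - ?q x * indicator ?B x \<partial>prodM)"
        using intp[OF B] intq[OF B] by simp
      also have "\<dots> = (\<integral>x. F x * (indicator ?R x * indicator ?B x) \<partial>prodM)"
      proof (rule Bochner_Integration.integral_cong[OF refl])
        fix x assume "x \<in> space prodM"
        have "max 0 a * b - max 0 (- a) * b = a * b" for a b :: real by (simp add: max_def)
        then show "?p x * indicator ?B x - ?q x * indicator ?B x = F x * (indicator ?R x * indicator ?B x)"
          by (simp only: mult_ac)
      qed
      also have "\<dots> = (\<integral>x. F x * (\<Prod>i<n. indicator (A i \<inter> C m) (x i)) \<partial>prodM)"
      proof (rule Bochner_Integration.integral_cong[OF refl])
        fix x assume "x \<in> space prodM"
        show "F x * (indicator ?R x * indicator ?B x) = F x * (\<Prod>i<n. indicator (A i \<inter> C m) (x i))"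
          unfolding RB[OF \<open>x \<in> space prodM\<close>] ..
      qed
      also have "\<dots> = 0" using AC by (rule zero)
      finally show "emeasure (density prodM (\<lambda>x. ennreal (?p x))) ?B = emeasure (density prodM (\<lambda>x. ennreal (?q x))) ?B"
        by (subst (1 2) meas) (use B intp intq in auto)
    next
      show "range (\<lambda>i::nat. space prodM) \<subseteq> prod_algebra {..<n} (\<lambda>_. M)"
        by (auto simp: space_PiM intro: prod_algebraI_finite)
      show "emeasure (density prodM (\<lambda>x. ennreal (?p x))) (space prodM) \<noteq> \<infinity>" for i :: nat
        by (subst meas) (use intp in auto)
    qed auto
    then have "AE x in prodM. ennreal (?p x) = ennreal (?q x)"
      by (intro sigma_finite_measure.density_unique[OF sigma_finite_prodM]) auto
    then show ?thesis by eventually_elim (auto simp: max_def split: if_splits)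
  qed
  then have "AE x in prodM. \<forall>m. indicator (Pi\<^sub>E {..<n} (\<lambda>_. C m)) x * F x = 0"
    unfolding AE_all_countable by blast
  then show ?thesis
    using AE_space
  proof eventually_elim
    case (elim x)
    \<comment> \<open>Each coordinate has its own index; as \<open>C\<close> is increasing, the
      largest one serves for all.\<close>
    have "\<exists>k. x i \<in> C k" if "i < n" for i
      using elim(2) that C(2) by (auto simp: space_PiM PiE_iff)
    then have "\<forall>i. \<exists>k. i < n \<longrightarrow> x i \<in> C k" by blast
    from choice[OF this] obtain k where k: "\<And>i. i < n \<Longrightarrow> x i \<in> C (k i)" by blast
    have "C (k i) \<subseteq> C (Max (k ` {..<n}))" if "i < n" for i
      using that by (intro incseqD[OF C(4)] Max_ge) auto
    then have "x i \<in> C (Max (k ` {..<n}))" if "i < n" for i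
      using k[OF that] that by blast
    then have "x \<in> Pi\<^sub>E {..<n} (\<lambda>_. C (Max (k ` {..<n})))"
      using elim(2) by (auto simp: space_PiM PiE_iff)
    then have "indicator (Pi\<^sub>E {..<n} (\<lambda>_. C (Max (k ` {..<n})))) x = (1::real)" by simp
    then show ?case using spec[OF elim(1), of "Max (k ` {..<n})"] by simp
  qed
qed

text \<open>The eigenfunctions are replaced by arbitrary square integrable functions one coordinate
  at a time, which avoids the theory of tensor products of Hilbert spaces. Indicators then lead to
  rectangles.\<close>

lemma AE_zero_if_tensor_coefs_zero:
  assumes "l2_total M \<phi>" and F: "F \<in> L2 prodM"
    and zero: "\<And>k. (\<integral>x. F x * (\<Prod>i<n. \<phi> (k i) (x i)) \<partial>prodM) = 0"
  shows "AE x in prodM. F x = 0"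
proof -
  interpret l2_total M \<phi> by fact
  define I where "I u = (\<integral>x. F x * (\<Prod>i<n. u i (x i)) \<partial>prodM)" for u
  \<comment> \<open>\<open>m\<close> counts the coordinates that are already arbitrary; the
    induction step frees coordinate \<open>m\<close>.\<close>
  have I_zero: "I u = 0"
    if "m \<le> n" "\<And>i. i < m \<Longrightarrow> u i \<in> L2 M" "\<And>i. m \<le> i \<Longrightarrow> i < n \<Longrightarrow> u i \<in> range \<phi>" for m u
    using that
  proof (induction m arbitrary: u)
    case 0
    have "\<exists>k. i < n \<longrightarrow> u i = \<phi> k" for i using 0(3)[of i] by auto
    then obtain k where "\<And>i. i < n \<Longrightarrow> u i = \<phi> (k i)" by metis
    then show ?case using zero[of k] by (simp add: I_def)
  next
    case (Suc m)
    have uL: "u i \<in> L2 M" if "i < n" for i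
      using Suc.prems(2)[of i] Suc.prems(3)[of i] that e_L2 by (cases "i < Suc m") auto
    have m: "m < n" using Suc.prems(1) by simp
    have split: "(\<Prod>i<n. (u(m := g)) i (x i)) = (\<Prod>i\<in>{..<n} - {m}. u i (x i)) * g (x m)" for g x
      using m prod.remove[of "{..<n}" m "\<lambda>i. (u(m := g)) i (x i)"] by simp
    have int: "integrable prodM (\<lambda>x. F x * ((\<Prod>i\<in>{..<n} - {m}. u i (x i)) * g (x m)))" if "g \<in> L2 M" for g
    proof -
      have "integrable prodM (\<lambda>x. F x * (\<Prod>i<n. (u(m := g)) i (x i)))"
        using uL that by (intro L2_integrable_mult F L2_tensor(1)) auto
      then show ?thesis by (simp only: split)
    qed
    have I_split: "I (u(m := g)) = (\<integral>x. F x * ((\<Prod>i\<in>{..<n} - {m}. u i (x i)) * g (x m)) \<partial>prodM)" for g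
      by (simp only: I_def split)
    have phi: "I (u(m := \<phi> k)) = 0" for k
      using Suc.prems by (intro Suc.IH) auto
    define c where "c = coef (u m)"
    have part: "I (u(m := partial c N)) = 0" for N
    proof -
      have "I (u(m := partial c N))
          = (\<integral>x. (\<Sum>k<N. c k * (F x * ((\<Prod>i\<in>{..<n} - {m}. u i (x i)) * \<phi> k (x m)))) \<partial>prodM)"
        unfolding I_split partial_def by (simp add: sum_distrib_left sum_distrib_right mult_ac)
      also have "\<dots> = (\<Sum>k<N. c k * I (u(m := \<phi> k)))"
        unfolding I_split using int[OF e_L2] by simp
      finally show ?thesis by (simp add: phi)
    qed
    \<comment> \<open>By Cauchy-Schwarz the functional is continuous in the factor at coordinate
      \<open>m\<close>; \<open>K\<close> collects what does not depend on the approximation.\<close>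
    define K where "K = (\<integral>x. (F x)\<^sup>2 \<partial>prodM) * (\<Prod>i\<in>{..<n} - {m}. \<integral>x. (u i x)\<^sup>2 \<partial>M)"
    have "(I u)\<^sup>2 \<le> K * (\<integral>x. (u m x - partial c N x)\<^sup>2 \<partial>M)" for N
    proof -
      let ?d = "\<lambda>x. u m x - partial c N x"
      have d: "?d \<in> L2 M" by (intro L2_diff uL m partial_L2)
      have "I (u(m := ?d)) = I (u(m := u m)) - I (u(m := partial c N))"
        unfolding I_split using int[OF uL[OF m]] int[OF partial_L2, of c N] by (simp add: right_diff_distrib)
      then have "I u = I (u(m := ?d))" by (simp add: part)
      moreover have "(I (u(m := ?d)))\<^sup>2
          \<le> (\<integral>x. (F x)\<^sup>2 \<partial>prodM) * (\<integral>x. (\<Prod>i<n. (u(m := ?d)) i (x i))\<^sup>2 \<partial>prodM)"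
        unfolding I_def using uL d by (intro L2_Cauchy_Schwarz F L2_tensor(1)) auto
      moreover have "(\<integral>x. (\<Prod>i<n. (u(m := ?d)) i (x i))\<^sup>2 \<partial>prodM) = (\<Prod>i<n. \<integral>x. ((u(m := ?d)) i x)\<^sup>2 \<partial>M)"
        using uL d by (intro L2_tensor(2)) auto
      moreover have "\<dots> = (\<integral>x. (?d x)\<^sup>2 \<partial>M) * (\<Prod>i\<in>{..<n} - {m}. \<integral>x. (u i x)\<^sup>2 \<partial>M)"
        using m prod.remove[of "{..<n}" m "\<lambda>i. \<integral>x. ((u(m := ?d)) i x)\<^sup>2 \<partial>M"] by simp
      ultimately show ?thesis by (simp add: K_def mult_ac)
    qed
    moreover have "(\<lambda>N. K * (\<integral>x. (u m x - partial c N x)\<^sup>2 \<partial>M)) \<longlonglongrightarrow> K * 0"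
      using expands_of_coef[OF uL[OF m] refl] by (intro tendsto_mult_left) (simp add: expands_def c_def)
    ultimately have "(I u)\<^sup>2 \<le> K * 0"
      by (intro tendsto_lowerbound[OF _ _ sequentially_bot]) auto
    then show ?case by simp
  qed
  show ?thesis
  proof (rule AE_zero_if_rectangle_integrals_zero[OF F])
    fix A :: "nat \<Rightarrow> real set"
    assume A: "\<And>i. i < n \<Longrightarrow> A i \<in> sets M" "\<And>i. i < n \<Longrightarrow> emeasure M (A i) \<noteq> \<infinity>"
    then have "I (\<lambda>i. indicator (A i)) = 0"
      by (intro I_zero[of n]) (auto simp: L2_def indicator_square less_top)
    then show "(\<integral>x. F x * (\<Prod>i<n. indicator (A i) (x i)) \<partial>prodM) = 0" by (simp add: I_def)
  qed
qed

end

section \<open>Enumeration of the strictly increasing index tuples\<close>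

definition increasing_tuples :: "nat \<Rightarrow> (nat \<Rightarrow> nat) set" where
  "increasing_tuples n = {k \<in> {..<n} \<rightarrow>\<^sub>E UNIV. \<forall>i j. i < j \<and> j < n \<longrightarrow> k i < k j}"

text \<open>The basis of the chamber has to be indexed by naturals. The order of the enumeration is
  arbitrary, so the tuple \<open>0, ..., n - 1\<close> has some unknown index, later called
  \<open>s0\<close>.\<close>

definition tuple :: "nat \<Rightarrow> nat \<Rightarrow> nat \<Rightarrow> nat" where
  "tuple n = from_nat_into (increasing_tuples n)"

text \<open>The shifts of \<open>0, ..., n - 1\<close> are infinitely many tuples; for
  \<open>n = 0\<close> there would be only one.\<close>

lemma bij_betw_tuple:
  assumes "1 \<le> n"
  shows "bij_betw (tuple n) UNIV (increasing_tuples n)"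
proof -
  have "countable (increasing_tuples n)"
    unfolding increasing_tuples_def
    by (rule countable_subset[of _ "{..<n} \<rightarrow>\<^sub>E UNIV"]) (auto intro: countable_PiE)
  moreover have "infinite (increasing_tuples n)"
  proof -
    let ?f = "\<lambda>m. \<lambda>i\<in>{..<n}. m + i"
    have "inj ?f"
    proof (rule injI)
      fix a b assume "?f a = ?f b"
      then have "?f a 0 = ?f b 0" by simp
      then show "a = b" using assms by simp
    qed
    then have "infinite (range ?f)" using infinite_UNIV_nat finite_imageD by blast
    moreover have "range ?f \<subseteq> increasing_tuples n" by (auto simp: increasing_tuples_def split: if_splits)
    ultimately show ?thesis using finite_subset by blast
  qed
  ultimately show ?thesis unfolding tuple_def by (rule bij_betw_from_nat_into)
qed

lemma tuple_less: "1 \<le> n \<Longrightarrow> i < j \<Longrightarrow> j < n \<Longrightarrow> tuple n s i < tuple n s j"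
  using bij_betw_apply[OF bij_betw_tuple, of n s] by (auto simp: increasing_tuples_def)

text \<open>Makes the tuple \<open>0, ..., n - 1\<close> minimal in every entry, which is the source
  of the minimality of its eigenvalue.\<close>

lemma tuple_ge: "1 \<le> n \<Longrightarrow> i < n \<Longrightarrow> i \<le> tuple n s i"
proof (induction i)
  case (Suc i)
  then show ?case using tuple_less[of n i "Suc i" s] by simp
qed simp

text \<open>A strictly increasing tuple is the sorted list of its entries.\<close>

lemma tuple_eq_iff:
  assumes "1 \<le> n"
  shows "tuple n s ` {..<n} = tuple n s' ` {..<n} \<longleftrightarrow> s = s'"
proof
  assume eq: "tuple n s ` {..<n} = tuple n s' ` {..<n}"
  have s: "sorted (map (tuple n s) [0..<n])" "distinct (map (tuple n s) [0..<n])" for s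
  proof -
    have "sorted_wrt (<) (map (tuple n s) [0..<n])"
      using tuple_less[OF assms] by (auto simp: sorted_wrt_iff_nth_less)
    then show "sorted (map (tuple n s) [0..<n])" "distinct (map (tuple n s) [0..<n])"
      by (auto simp: strict_sorted_iff)
  qed
  have "map (tuple n s) [0..<n] = map (tuple n s') [0..<n]"
    using eq by (intro sorted_distinct_set_unique s) (auto simp: lessThan_atLeast0)
  then have "tuple n s i = tuple n s' i" if "i < n" for i using that by simp
  moreover have "tuple n s \<in> extensional {..<n}" for s
    using bij_betw_apply[OF bij_betw_tuple[OF assms], of s] by (auto simp: increasing_tuples_def PiE_iff)
  ultimately have "tuple n s = tuple n s'" by (intro extensionalityI[of _ "{..<n}"]) auto
  then show "s = s'" using bij_betw_imp_inj_on[OF bij_betw_tuple[OF assms]] by (simp add: inj_eq)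
qed simp

context weyl_product
begin

lemma integral_alternant_tuple:
  assumes \<phi>: "l2_orthonormal M \<phi>" and n: "1 \<le> n"
  shows "(\<integral>x. alternant n (\<lambda>i. \<phi> (tuple n s i)) x * alternant n (\<lambda>i. \<phi> (tuple n s' i)) x \<partial>chamM)
    = (if s = s' then 1 else 0)"
proof -
  interpret l2_orthonormal M \<phi> by fact
  let ?d = "\<lambda>i j. if tuple n s i = tuple n s' j then 1 else 0 :: real"
  have "(\<integral>x. alternant n (\<lambda>i. \<phi> (tuple n s i)) x * alternant n (\<lambda>i. \<phi> (tuple n s' i)) x \<partial>chamM)
    = Determinant.det (mat n n (\<lambda>(i, j). ?d i j))"
    by (subst andreief_identity) (auto simp: e_L2 ortho)
  also have "\<dots> = (if s = s' then 1 else 0)"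
  proof (cases "s = s'")
    case True
    have "tuple n s i = tuple n s j \<longleftrightarrow> i = j" if "i < n" "j < n" for i j
      using tuple_less[OF n, of i j s] tuple_less[OF n, of j i s] that
      by (cases i j rule: linorder_cases) auto
    then have "mat n n (\<lambda>(i, j). ?d i j) = 1\<^sub>m n" using True by (intro eq_matI) auto
    then show ?thesis using True by simp
  next
    case False
    then have "tuple n s ` {..<n} \<noteq> tuple n s' ` {..<n}" using tuple_eq_iff[OF n] by simp
    moreover have "card (tuple n s ` {..<n}) = n" for s
    proof -
      have "inj_on (tuple n s) {..<n}"
        using tuple_less[OF n, of _ _ s] by (intro linorder_inj_onI') (metis lessThan_iff less_irrefl)+
      then show ?thesis by (simp add: card_image)
    qed
    \<comment> \<open>Distinct ranges of equal size: some index of \<open>s\<close> is matched by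
      none of \<open>s'\<close>, which gives a zero row.\<close>
    ultimately have "\<not> tuple n s ` {..<n} \<subseteq> tuple n s' ` {..<n}"
      by (metis card_subset_eq finite_imageI finite_lessThan)
    then obtain i where i: "i < n" "\<And>j. j < n \<Longrightarrow> tuple n s i \<noteq> tuple n s' j" by fast
    have "(\<Prod>j<n. ?d j (p j)) = 0" if "p permutes {..<n}" for p
      using i permutes_in_image[OF that, of i] by (intro prod_zero) (auto intro!: bexI[of _ i])
    then show ?thesis using False by (subst det_mat_eq_sum) (auto intro!: sum.neutral)
  qed
  finally show ?thesis .
qed

text \<open>If \<open>f\<close> is orthogonal to the determinants of increasing tuples, it is
  orthogonal to those of all index tuples: repeated indices give 0 and sorting costs a sign. So the
  skew extension of \<open>f\<close> is orthogonal to all tensor products of eigenfunctions.\<close>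

lemma l2_total_alternants:
  assumes \<phi>: "l2_total M \<phi>" and n: "1 \<le> n"
  shows "l2_total chamM (\<lambda>s. alternant n (\<lambda>i. \<phi> (tuple n s i)))"
proof -
  interpret l2_total M \<phi> by fact
  have L2: "alternant n (\<lambda>i. \<phi> (k i)) \<in> L2 chamM" for k
    by (intro L2_restrict_chamM L2_alternant e_L2)
  interpret H: l2_orthonormal chamM "\<lambda>s. alternant n (\<lambda>i. \<phi> (tuple n s i))"
    using L2 integral_alternant_tuple[OF l2_orthonormal_axioms n] by unfold_locales auto
  show ?thesis
  proof
    fix f assume f: "f \<in> L2 chamM" and c: "\<And>s. H.coef f s = 0"
    have zero: "(\<integral>x. f x * alternant n (\<lambda>i. \<phi> (k i)) x \<partial>chamM) = 0" for k :: "nat \<Rightarrow> nat"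
    proof (cases "inj_on k {..<n}")
      case False
      then obtain i j where "i < n" "j < n" "i \<noteq> j" "k i = k j" by (auto simp: inj_on_def)
      then have "alternant n (\<lambda>i. \<phi> (k i)) x = 0" for x
        by (intro alternant_repeated_function[of i n j]) auto
      then show ?thesis by simp
    next
      case True
      then obtain p where p: "p permutes {..<n}" "\<And>i j. i < j \<Longrightarrow> j < n \<Longrightarrow> k (p i) \<le> k (p j)"
        using ex1_sorting_permutation[of k n] by blast
      have "k (p i) \<noteq> k (p j)" if "i < j" "j < n" for i j
        using inj_onD[OF True, of "p i" "p j"] permutes_in_image[OF p(1), of i]
          permutes_in_image[OF p(1), of j] permutes_inj[OF p(1)] that by (auto simp: inj_eq)
      then have "(\<lambda>i\<in>{..<n}. k (p i)) \<in> increasing_tuples n"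
        using p(2) by (auto simp: increasing_tuples_def order_less_le)
      then obtain s where s: "tuple n s = (\<lambda>i\<in>{..<n}. k (p i))"
        using bij_betw_imp_surj_on[OF bij_betw_tuple[OF n]] by (metis (no_types, lifting) imageE)
      have "alternant n (\<lambda>i. \<phi> (tuple n s i)) x = alternant n (\<lambda>i. \<phi> (k (p i))) x" for x
        unfolding alternant_def s by (rule arg_cong[of _ _ Determinant.det]) (auto intro!: eq_matI)
      also have "alternant n (\<lambda>i. \<phi> (k (p i))) x = of_int (sign p) * alternant n (\<lambda>i. \<phi> (k i)) x" for x
        by (rule alternant_permute_functions[OF p(1), of "\<lambda>i. \<phi> (k i)"])
      finally have "H.coef f s = (\<integral>x. of_int (sign p) * (f x * alternant n (\<lambda>i. \<phi> (k i)) x) \<partial>chamM)"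
        by (simp only: H.coef_def mult.left_commute)
      then show ?thesis using c[of s] by simp
    qed
    have "(\<integral>x. skew_ext f x * (\<Prod>i<n. \<phi> (k i) (x i)) \<partial>prodM) = 0" for k
      using zero[of k] by (subst (asm) integral_chamber_alternant[OF f]) (auto simp: e_L2)
    then have "AE x in prodM. skew_ext f x = 0"
      by (rule AE_zero_if_tensor_coefs_zero[OF \<phi> L2_skew_ext[OF f]])
    then have "AE x in prodM. x \<in> W \<longrightarrow> f x = 0"
      using AE_distinct by eventually_elim (auto simp: skew_ext_eq_on_chamber)
    then show "AE x in chamM. f x = 0"
      unfolding chamber_measure_def by (subst AE_restrict_space_iff) auto
  qed
qed

end

section \<open>The strong Markov property at hitting times\<close>

text \<open>Approximates a time by times from a countable grid; used for joint measurability of the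
  process and for measurability of passage events.\<close>

lemma tendsto_floor_grid: "(\<lambda>k. real_of_int \<lfloor>real (Suc k) * t\<rfloor> / real (Suc k)) \<longlonglongrightarrow> t"
proof (rule tendsto_sandwich)
  have "(\<lambda>k. t - inverse (real (Suc k))) \<longlonglongrightarrow> t - 0"
    by (intro tendsto_diff tendsto_const LIMSEQ_inverse_real_of_nat)
  then show "(\<lambda>k. t - inverse (real (Suc k))) \<longlonglongrightarrow> t" by simp
  show "\<forall>\<^sub>F k in sequentially. t - inverse (real (Suc k)) \<le> real_of_int \<lfloor>real (Suc k) * t\<rfloor> / real (Suc k)"
  proof (rule always_eventually, rule allI)
    fix k
    have "real (Suc k) * t - 1 \<le> real_of_int \<lfloor>real (Suc k) * t\<rfloor>" by linarith
    then have "(real (Suc k) * t - 1) / real (Suc k) \<le> real_of_int \<lfloor>real (Suc k) * t\<rfloor> / real (Suc k)"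
      by (intro divide_right_mono) auto
    then show "t - inverse (real (Suc k)) \<le> real_of_int \<lfloor>real (Suc k) * t\<rfloor> / real (Suc k)"
      by (simp add: diff_divide_distrib inverse_eq_divide)
  qed
  show "\<forall>\<^sub>F k in sequentially. real_of_int \<lfloor>real (Suc k) * t\<rfloor> / real (Suc k) \<le> t"
  proof (rule always_eventually, rule allI)
    fix k
    have "real_of_int \<lfloor>real (Suc k) * t\<rfloor> / real (Suc k) \<le> (real (Suc k) * t) / real (Suc k)"
      by (intro divide_right_mono) auto
    then show "real_of_int \<lfloor>real (Suc k) * t\<rfloor> / real (Suc k) \<le> t" by simp
  qed
qed simp

text \<open>The density of an exponential time of rate 1. A positive rate keeps the resolvent finite
  even if \<open>lam 0 = 0\<close>; rate 1 makes its mass at most 1.\<close>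

definition exp_weight :: "real \<Rightarrow> ennreal" where
  "exp_weight t = ennreal (exp (- t)) * indicator {0..} t"

lemma exp_weight_measurable [measurable]: "exp_weight \<in> borel_measurable borel"
  unfolding exp_weight_def by measurable

lemma nn_integral_exp_tail: "(\<integral>\<^sup>+t. ennreal (exp (- t)) * indicator {a..} t \<partial>lborel) = ennreal (exp (- a))"
proof -
  have "((\<lambda>x::real. - exp (- x)) \<longlongrightarrow> 0) at_top"
    using tendsto_minus[OF filterlim_compose[OF exp_at_bot filterlim_uminus_at_bot_at_top]] by simp
  then have "(\<integral>\<^sup>+t. ennreal (exp (- t)) * indicator {a..} t \<partial>lborel) = ennreal (0 - - exp (- a))"
    by (intro nn_integral_FTC_atLeast) (auto intro!: derivative_eq_intros)
  then show ?thesis by simp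
qed

lemma nn_integral_exp_weight: "(\<integral>\<^sup>+t. exp_weight t \<partial>lborel) = 1"
  using nn_integral_exp_tail[of 0] by (simp add: exp_weight_def)

locale diffusion_process =
  fixes l r :: ereal and I :: "real set" and Om :: "'w measure"
    and P :: "ereal \<Rightarrow> 'w measure" and X :: "real \<Rightarrow> 'w \<Rightarrow> ereal"
  assumes diffusion: "diffusion l r I Om P X"
begin

abbreviation "nfilt \<equiv> natural_filtration Om X"

lemma X_measurable: "0 \<le> t \<Longrightarrow> X t \<in> Om \<rightarrow>\<^sub>M borel"
  and X_continuous: "\<omega> \<in> space Om \<Longrightarrow> continuous_on {0..} (\<lambda>t. X t \<omega>)"
  and AE_X0: "x \<in> {l..r} \<Longrightarrow> AE \<omega> in P x. X 0 \<omega> = x"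
  and strong_markov: "strong_markov Om P X {l..r}"
  using diffusion by (auto simp: diffusion_def)

lemma P_in_prob_algebra: "x \<in> {l..r} \<Longrightarrow> P x \<in> space (prob_algebra Om)"
  using diffusion by (auto simp: diffusion_def space_restrict_space dest!: measurable_space)

lemma sets_P: "x \<in> {l..r} \<Longrightarrow> sets (P x) = sets Om"
  and prob_P: "x \<in> {l..r} \<Longrightarrow> prob_space (P x)"
  using P_in_prob_algebra by (auto simp: space_prob_algebra)

lemma space_P: "x \<in> {l..r} \<Longrightarrow> space (P x) = space Om"
  using sets_P by (rule sets_eq_imp_space_eq)

lemma event_measurable: "0 \<le> t \<Longrightarrow> B \<in> sets borel \<Longrightarrow> {\<omega> \<in> space Om. X t \<omega> \<in> B} \<in> sets Om"
  using measurable_sets[OF X_measurable, of t B] by (simp add: vimage_def Int_def conj_commute)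

lemma space_nfilt: "space (nfilt t) = space Om"
  using filtration.space_F[OF filtration_natural_filtration] .

lemma sets_nfilt: "sets (nfilt t) = sigma_sets (space Om) {X s -` B \<inter> space Om | s B. 0 \<le> s \<and> s \<le> t \<and> B \<in> sets borel}"
  unfolding natural_filtration_def by (rule sets_measure_of) auto

lemma X_nfilt_measurable: "0 \<le> s \<Longrightarrow> s \<le> t \<Longrightarrow> X s \<in> nfilt t \<rightarrow>\<^sub>M borel"
  by (rule measurableI) (auto simp: space_nfilt sets_nfilt intro!: sigma_sets.Basic)

lemma sets_nfilt_subset: "sets (nfilt t) \<subseteq> sets Om"
  unfolding sets_nfilt
  by (rule sets.sigma_sets_subset) (auto intro!: measurable_sets[OF X_measurable])

text \<open>The process extended to all times, so that joint measurability can be stated without restricting the time set.\<close>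

definition Y :: "real \<Rightarrow> 'w \<Rightarrow> ereal" where "Y t \<omega> = X (max 0 t) \<omega>"

text \<open>By continuity of the paths, \<open>Y\<close> is a limit of processes that are constant
  in time on grid cells.\<close>

lemma Y_measurable [measurable]: "(\<lambda>(t, \<omega>). Y t \<omega>) \<in> borel \<Otimes>\<^sub>M Om \<rightarrow>\<^sub>M borel"
proof -
  let ?g = "\<lambda>k t. real_of_int \<lfloor>real (Suc k) * max 0 t\<rfloor> / real (Suc k)"
  have "(\<lambda>x. X (?g k (fst x)) (snd x)) \<in> borel \<Otimes>\<^sub>M Om \<rightarrow>\<^sub>M borel" for k
  proof -
    \<comment> \<open>The countable index runs over all integers, including those that the floor
      never takes; \<open>max 0\<close> keeps every time in the range where \<open>X\<close> is
      measurable.\<close>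
    have "(\<lambda>x. X (real_of_int (max 0 \<lfloor>real (Suc k) * max 0 (fst x)\<rfloor>) / real (Suc k)) (snd x)) \<in> borel \<Otimes>\<^sub>M Om \<rightarrow>\<^sub>M borel"
    proof (rule measurable_compose_countable[where f = "\<lambda>j x. X (real_of_int (max 0 j) / real (Suc k)) (snd x)"])
      show "(\<lambda>x. X (real_of_int (max 0 j) / real (Suc k)) (snd x)) \<in> borel \<Otimes>\<^sub>M Om \<rightarrow>\<^sub>M borel" for j
        by (rule measurable_compose[OF measurable_snd X_measurable]) auto
      show "(\<lambda>x. \<lfloor>real (Suc k) * max 0 (fst x)\<rfloor>) \<in> borel \<Otimes>\<^sub>M Om \<rightarrow>\<^sub>M count_space UNIV"
        by measurable
    qed
    then show ?thesis by (simp add: max_def)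
  qed
  then have "(\<lambda>x. liminf (\<lambda>k. X (?g k (fst x)) (snd x))) \<in> borel \<Otimes>\<^sub>M Om \<rightarrow>\<^sub>M borel"
    by (rule borel_measurable_liminf)
  moreover have "liminf (\<lambda>k. X (?g k (fst x)) (snd x)) = (case x of (t, \<omega>) \<Rightarrow> Y t \<omega>)"
    if sp: "x \<in> space (borel \<Otimes>\<^sub>M Om)" for x :: "real \<times> 'w"
  proof -
    obtain t \<omega> where x: "x = (t, \<omega>)" "\<omega> \<in> space Om"
      using sp by (cases x) (auto simp: space_pair_measure)
    have "(\<lambda>k. X (?g k t) \<omega>) \<longlonglongrightarrow> X (max 0 t) \<omega>"
      by (rule continuous_on_tendsto_compose[OF X_continuous[OF x(2)] tendsto_floor_grid]) auto
    then show ?thesis using x by (simp add: lim_imp_Liminf Y_def)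
  qed
  ultimately show ?thesis by (subst (asm) measurable_cong) auto
qed

lemma Y_compose_measurable:
  assumes "f \<in> borel_measurable N" "g \<in> N \<rightarrow>\<^sub>M Om"
  shows "(\<lambda>x. Y (f x) (g x)) \<in> borel_measurable N"
  using measurable_compose[OF measurable_Pair[OF assms] Y_measurable] by simp

section \<open>First passage times\<close>

definition hits :: "ereal \<Rightarrow> real \<Rightarrow> 'w set" where
  "hits z u = {\<omega> \<in> space Om. \<exists>s\<in>{0..u}. z \<le> X s \<omega>}"

text \<open>The value is meaningful only on paths that reach \<open>z\<close>; otherwise it is the
  infimum of the empty set, and every use is restricted to \<open>hits\<close>.\<close>

definition hit_time :: "ereal \<Rightarrow> 'w \<Rightarrow> real" where
  "hit_time z \<omega> = Inf {s. 0 \<le> s \<and> z \<le> X s \<omega>}"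

text \<open>Replaces an uncountable union over times by a countable supremum. The grid is scaled to
  \<open>u\<close>, so no time after \<open>u\<close> is inspected. That the supremum reaching
  \<open>z\<close> suffices is due to the maximum on \<open>{0..u}\<close> being attained.\<close>

lemma hits_iff_SUP:
  assumes \<omega>: "\<omega> \<in> space Om" and u: "0 \<le> u"
  shows "(\<exists>s\<in>{0..u}. z \<le> X s \<omega>)
    \<longleftrightarrow> z \<le> (SUP (k, j) \<in> {(k, j). j \<le> Suc k}. X (u * (real j / real (Suc k))) \<omega>)"
    (is "_ \<longleftrightarrow> z \<le> ?S")
proof
  assume "\<exists>s\<in>{0..u}. z \<le> X s \<omega>"
  then obtain s where s: "0 \<le> s" "s \<le> u" "z \<le> X s \<omega>" by auto
  let ?j = "\<lambda>k. nat \<lfloor>real (Suc k) * (s / u)\<rfloor>"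
  have su: "0 \<le> s / u" "s / u \<le> 1" using s by (auto simp: divide_le_eq_1)
  have j: "?j k \<le> Suc k" for k
  proof -
    have "real (Suc k) * (s / u) \<le> real (Suc k)" using mult_left_mono[OF su(2), of "real (Suc k)"] by simp
    then have "\<lfloor>real (Suc k) * (s / u)\<rfloor> \<le> int (Suc k)" by linarith
    then show ?thesis by linarith
  qed
  have rj: "real (?j k) = real_of_int \<lfloor>real (Suc k) * (s / u)\<rfloor>" for k
  proof -
    have "0 \<le> real (Suc k) * (s / u)" using su(1) by (intro mult_nonneg_nonneg) auto
    then have "0 \<le> \<lfloor>real (Suc k) * (s / u)\<rfloor>" by (simp only: zero_le_floor)
    then show ?thesis by (simp only: of_nat_nat)
  qed
  \<comment> \<open>For \<open>u = 0\<close> the quotient is 0 by convention, and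
    \<open>s = 0\<close> too.\<close>
  have us: "u * (s / u) = s" using s by (cases "u = 0") auto
  have "(\<lambda>k. u * (real_of_int \<lfloor>real (Suc k) * (s / u)\<rfloor> / real (Suc k))) \<longlonglongrightarrow> u * (s / u)"
    by (intro tendsto_mult_left tendsto_floor_grid)
  then have "(\<lambda>k. u * (real (?j k) / real (Suc k))) \<longlonglongrightarrow> s"
    by (simp only: rj us)
  then have "(\<lambda>k. X (u * (real (?j k) / real (Suc k))) \<omega>) \<longlonglongrightarrow> X s \<omega>"
    using s(1) u by (intro continuous_on_tendsto_compose[OF X_continuous[OF \<omega>]]) auto
  moreover have "X (u * (real (?j k) / real (Suc k))) \<omega> \<le> ?S" for k
    using j[of k] by (intro SUP_upper2[of "(k, ?j k)"]) auto
  ultimately have "X s \<omega> \<le> ?S" by (intro LIMSEQ_le_const2) auto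
  with s(3) show "z \<le> ?S" by simp
next
  assume z: "z \<le> ?S"
  have "continuous_on {0..u} (\<lambda>s. X s \<omega>)"
    using X_continuous[OF \<omega>] by (rule continuous_on_subset) auto
  then obtain s where s: "s \<in> {0..u}" "\<And>t. t \<in> {0..u} \<Longrightarrow> X t \<omega> \<le> X s \<omega>"
    using continuous_attains_sup[of "{0..u}" "\<lambda>s. X s \<omega>"] u by auto
  have "?S \<le> X s \<omega>"
  proof (rule SUP_least, clarify)
    fix k j :: nat assume "j \<le> Suc k"
    then have "real j / real (Suc k) \<le> 1" by (simp add: divide_le_eq_1)
    then have "u * (real j / real (Suc k)) \<le> u" using mult_left_mono[of "real j / real (Suc k)" 1 u] u by simp
    then show "X (u * (real j / real (Suc k))) \<omega> \<le> X s \<omega>" using u by (intro s(2)) auto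
  qed
  with z have "z \<le> X s \<omega>" by (rule order_trans)
  with s(1) show "\<exists>s\<in>{0..u}. z \<le> X s \<omega>" by blast
qed

text \<open>Whether a continuous path has reached a closed set by time \<open>u\<close> is decided
  by its values up to \<open>u\<close>. This makes first passage a stopping time of the raw
  filtration, without passing to a right-continuous one.\<close>

lemma hits_nfilt: "u \<le> t \<Longrightarrow> hits z u \<in> sets (nfilt t)"
proof (cases "0 \<le> u")
  case True
  assume "u \<le> t"
  have "(\<lambda>\<omega>. SUP (k, j) \<in> {(k, j). j \<le> Suc k}. X (u * (real j / real (Suc k))) \<omega>) \<in> borel_measurable (nfilt t)"
  proof (rule borel_measurable_SUP)
    fix i :: "nat \<times> nat" assume i: "i \<in> {(k, j). j \<le> Suc k}"
    obtain k j where ij: "i = (k, j)" "j \<le> Suc k" using i by auto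
    then have "real j / real (Suc k) \<le> 1" by (simp add: divide_le_eq_1)
    then have "u * (real j / real (Suc k)) \<le> t"
      using mult_left_mono[of "real j / real (Suc k)" 1 u] True \<open>u \<le> t\<close> by simp
    then show "(\<lambda>\<omega>. case i of (k, j) \<Rightarrow> X (u * (real j / real (Suc k))) \<omega>) \<in> borel_measurable (nfilt t)"
      using True ij by (auto intro!: X_nfilt_measurable)
  qed auto
  then have "{\<omega> \<in> space (nfilt t). z \<le> (SUP (k, j) \<in> {(k, j). j \<le> Suc k}. X (u * (real j / real (Suc k))) \<omega>)} \<in> sets (nfilt t)"
    by measurable
  also have "{\<omega> \<in> space (nfilt t). z \<le> (SUP (k, j) \<in> {(k, j). j \<le> Suc k}. X (u * (real j / real (Suc k))) \<omega>)} = hits z u"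
    unfolding hits_def space_nfilt using hits_iff_SUP[OF _ True] by blast
  finally show ?thesis .
qed (simp add: hits_def)

lemma hits_sets: "hits z u \<in> sets Om"
  using hits_nfilt[of u u z] sets_nfilt_subset by auto

lemma hit_time:
  assumes "\<omega> \<in> hits z u"
  shows "0 \<le> hit_time z \<omega>" "hit_time z \<omega> \<le> u" "z \<le> X (hit_time z \<omega>) \<omega>"
proof -
  let ?S = "{s. 0 \<le> s \<and> z \<le> X s \<omega>}"
  obtain s where s: "0 \<le> s" "s \<le> u" "z \<le> X s \<omega>" and \<omega>: "\<omega> \<in> space Om"
    using assms by (auto simp: hits_def)
  have "closed ({0..} \<inter> (\<lambda>s. X s \<omega>) -` {z..})"
    by (intro continuous_closed_preimage X_continuous \<omega>) auto
  also have "{0..} \<inter> (\<lambda>s. X s \<omega>) -` {z..} = ?S" by auto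
  finally have cl: "closed ?S" .
  have bdd: "bdd_below ?S" by (rule bdd_belowI[of _ 0]) auto
  have "Inf ?S \<in> ?S" using s by (intro closed_contains_Inf bdd cl) auto
  then show "0 \<le> hit_time z \<omega>" "z \<le> X (hit_time z \<omega>) \<omega>" by (auto simp: hit_time_def)
  have "Inf ?S \<le> s" using s by (intro cInf_lower bdd) auto
  with s show "hit_time z \<omega> \<le> u" by (simp add: hit_time_def)
qed

lemma before_hit_time: "0 \<le> s \<Longrightarrow> s < hit_time z \<omega> \<Longrightarrow> X s \<omega> < z"
proof (rule ccontr)
  assume s: "0 \<le> s" "s < hit_time z \<omega>" "\<not> X s \<omega> < z"
  then have "Inf {s. 0 \<le> s \<and> z \<le> X s \<omega>} \<le> s" by (intro cInf_lower bdd_belowI[of _ 0]) auto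
  then show False using s by (simp add: hit_time_def)
qed

text \<open>The path is below \<open>z\<close> before the passage time, and its value there is a
  limit from the left, so it cannot jump over \<open>z\<close>.\<close>

lemma X_hit_time:
  assumes hit: "\<omega> \<in> hits z u" and start: "X 0 \<omega> < z"
  shows "X (hit_time z \<omega>) \<omega> = z"
proof (rule antisym)
  let ?\<tau> = "hit_time z \<omega>"
  show "z \<le> X ?\<tau> \<omega>" using hit by (rule hit_time)
  have \<omega>: "\<omega> \<in> space Om" using hit by (simp add: hits_def)
  have pos: "0 < ?\<tau>"
    using hit_time[OF hit] start by (cases "?\<tau> = 0") auto
  have "(\<lambda>k. ?\<tau> * (1 - inverse (real (Suc k)))) \<longlonglongrightarrow> ?\<tau> * (1 - 0)"
    by (intro tendsto_intros LIMSEQ_inverse_real_of_nat)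
  then have lim: "(\<lambda>k. X (?\<tau> * (1 - inverse (real (Suc k)))) \<omega>) \<longlonglongrightarrow> X ?\<tau> \<omega>"
    using pos by (intro continuous_on_tendsto_compose[OF X_continuous[OF \<omega>]])
      (auto intro!: always_eventually mult_nonneg_nonneg simp: inverse_le_1_iff)
  have "X (?\<tau> * (1 - inverse (real (Suc k)))) \<omega> \<le> z" for k
    using pos by (intro less_imp_le[OF before_hit_time])
      (auto intro!: mult_nonneg_nonneg simp: inverse_le_1_iff)
  then show "X ?\<tau> \<omega> \<le> z" by (intro LIMSEQ_le_const2[OF lim]) auto
qed

lemma hits_iff_hit_time:
  assumes "\<omega> \<in> hits z u" "0 \<le> t"
  shows "\<omega> \<in> hits z t \<longleftrightarrow> hit_time z \<omega> \<le> t"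
  using hit_time[OF assms(1)] hit_time(2)[of \<omega> z t] assms by (auto simp: hits_def)

text \<open>On \<open>hits z u\<close> the path is at \<open>z\<close> at the stopping time, so the
  law of the future is the fixed measure \<open>P z\<close> and leaves the integral.\<close>

lemma strong_markov_hit:
  assumes x: "x \<in> {l..r}" and z: "z \<in> {l..r}" "x < z" and u: "0 \<le> u" and s: "0 \<le> s" and B: "B \<in> sets borel"
  shows "emeasure (P x) {\<omega> \<in> hits z u. X (hit_time z \<omega> + s) \<omega> \<in> B}
    = emeasure (P x) (hits z u) * emeasure (P z) {\<omega> \<in> space Om. X s \<omega> \<in> B}"
proof -
  \<comment> \<open>Stopping times in \<open>strong_markov\<close> are real valued, so the passage
    time is truncated: \<open>T = u\<close> on paths that have not reached \<open>z\<close> by time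
    \<open>u\<close>.\<close>
  define T where "T \<omega> = (if \<omega> \<in> hits z u then hit_time z \<omega> else u)" for \<omega>
  have T0: "0 \<le> T \<omega>" for \<omega> using hit_time(1)[of \<omega> z u] u by (simp add: T_def)
  have Tle: "{\<omega> \<in> space Om. T \<omega> \<le> t} = (if u \<le> t then space Om else if 0 \<le> t then hits z t else {})" for t
  proof -
    have Tu: "T \<omega> \<le> u" for \<omega> using hit_time(2)[of \<omega> z u] by (simp add: T_def)
    consider "u \<le> t" | "t < u" "0 \<le> t" | "t < u" "t < 0" by linarith
    then show ?thesis
    proof cases
      case 1
      then show ?thesis using Tu order_trans by auto
    next
      case 2
      have "\<omega> \<in> space Om \<and> T \<omega> \<le> t \<longleftrightarrow> \<omega> \<in> hits z t" for \<omega>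
      proof
        assume *: "\<omega> \<in> space Om \<and> T \<omega> \<le> t"
        then have "\<omega> \<in> hits z u" using 2 by (auto simp: T_def split: if_splits)
        with * show "\<omega> \<in> hits z t" using hits_iff_hit_time[of \<omega> z u t] 2 by (simp add: T_def)
      next
        assume *: "\<omega> \<in> hits z t"
        then have "\<omega> \<in> hits z u" using 2 by (auto simp: hits_def)
        with * show "\<omega> \<in> space Om \<and> T \<omega> \<le> t"
          using hit_time(2)[OF *] by (auto simp: T_def hits_def)
      qed
      then show ?thesis using 2 by auto
    next
      case 3
      then have "\<not> T \<omega> \<le> t" for \<omega> using T0[of \<omega>] by linarith
      then show ?thesis using 3 by simp
    qed
  qed
  have stop: "stopping_time nfilt T"
    unfolding stopping_time_def pred_def space_nfilt Tle
    using sets.top[of "nfilt _"] by (auto simp: space_nfilt intro: hits_nfilt)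
  have A: "hits z u \<in> sets (filtration.pre_sigma (space Om) nfilt T)"
  proof (rule filtration.sets_pre_sigmaI[OF filtration_natural_filtration stop])
    fix t
    have "{\<omega> \<in> hits z u. T \<omega> \<le> t} = hits z u \<inter> {\<omega> \<in> space Om. T \<omega> \<le> t}" by (auto simp: hits_def)
    also have "\<dots> = (if u \<le> t then hits z u else if 0 \<le> t then hits z t else {})"
      unfolding Tle by (auto simp: hits_def)
    finally show "{\<omega> \<in> hits z u. T \<omega> \<le> t} \<in> sets (nfilt t)" by (auto intro: hits_nfilt)
  qed
  have "{\<omega> \<in> hits z u. X (hit_time z \<omega> + s) \<omega> \<in> B} = {\<omega> \<in> hits z u. X (T \<omega> + s) \<omega> \<in> B}"
    by (auto simp: T_def)
  then have "emeasure (P x) {\<omega> \<in> hits z u. X (hit_time z \<omega> + s) \<omega> \<in> B}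
     = (\<integral>\<^sup>+\<omega>\<in>hits z u. emeasure (P (X (T \<omega>) \<omega>)) {\<omega>' \<in> space Om. X s \<omega>' \<in> B} \<partial>P x)"
    using strong_markov x stop T0 A s B unfolding strong_markov_def by simp
  also have "\<dots> = (\<integral>\<^sup>+\<omega>. emeasure (P z) {\<omega>' \<in> space Om. X s \<omega>' \<in> B} * indicator (hits z u) \<omega> \<partial>P x)"
    using AE_X0[OF x] z(2)
    by (intro nn_integral_cong_AE) (auto elim!: eventually_mono simp: T_def X_hit_time split: split_indicator)
  also have "\<dots> = emeasure (P x) (hits z u) * emeasure (P z) {\<omega> \<in> space Om. X s \<omega> \<in> B}"
    using hits_sets[of z u] sets_P[OF x] by (subst nn_integral_cmult_indicator) (auto simp: mult.commute)
  finally show ?thesis .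
qed

section \<open>The resolvent: the law at an independent exponential time of rate 1\<close>

definition resolvent :: "ereal \<Rightarrow> ereal set \<Rightarrow> ennreal" where
  "resolvent x B = (\<integral>\<^sup>+t. exp_weight t * emeasure (P x) {\<omega> \<in> space Om. X t \<omega> \<in> B} \<partial>lborel)"

lemma resolvent_le_1:
  assumes "x \<in> {l..r}"
  shows "resolvent x B \<le> 1"
proof -
  interpret prob_space "P x" using assms by (rule prob_P)
  have "resolvent x B \<le> (\<integral>\<^sup>+t. exp_weight t * 1 \<partial>lborel)"
    unfolding resolvent_def by (intro nn_integral_mono mult_left_mono emeasure_le_1) auto
  then show ?thesis by (simp add: nn_integral_exp_weight)
qed

text \<open>\<open>\<psi>\<close> is the expectation of \<open>exp (- \<tau>)\<close>,
  \<open>\<tau>\<close> the passage time of \<open>z\<close>, written as an integral of passage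
  probabilities so that \<open>strong_markov_hit\<close> applies to events only. That identity is
  integrated against \<open>exp (- u) * exp (- s)\<close>; pathwise, the integral over
  \<open>u \<ge> \<tau>\<close> gives \<open>exp (- \<tau>)\<close>, and the substitution
  \<open>t = \<tau> + s\<close> completes the resolvent from \<open>x\<close>. It matters that
  \<open>\<psi>\<close> is the same for all \<open>B\<close>.\<close>

lemma resolvent_strong_markov:
  assumes x: "x \<in> {l..r}" and z: "z \<in> {l..r}" "x < z"
  obtains \<psi> where "\<psi> \<le> 1" "\<And>B. B \<in> sets borel \<Longrightarrow> B \<subseteq> {z..} \<Longrightarrow> resolvent x B = \<psi> * resolvent z B"
proof
  interpret Px: prob_space "P x" using x by (rule prob_P)
  interpret Pz: prob_space "P z" using z(1) by (rule prob_P)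
  note [measurable_cong] = sets_P[OF x] sets_P[OF z(1)]
  interpret lP: pair_sigma_finite lborel "P x" by unfold_locales
  define \<psi> where "\<psi> = (\<integral>\<^sup>+u. exp_weight u * emeasure (P x) (hits z u) \<partial>lborel)"
  show "\<psi> \<le> 1"
  proof -
    have "\<psi> \<le> (\<integral>\<^sup>+t. exp_weight t * 1 \<partial>lborel)"
      unfolding \<psi>_def by (intro nn_integral_mono mult_left_mono Px.emeasure_le_1) auto
    then show ?thesis by (simp add: nn_integral_exp_weight)
  qed
  fix B :: "ereal set" assume B[measurable]: "B \<in> sets borel" and Bz: "B \<subseteq> {z..}"
  \<comment> \<open>The event that \<open>z\<close> is ever reached.\<close>
  define H where "H = (\<Union>k::nat. hits z (real k))"
  have H[measurable]: "H \<in> sets Om" unfolding H_def by (intro sets.countable_UN) (auto intro: hits_sets)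
  have H_iff: "\<omega> \<in> H \<longleftrightarrow> (\<exists>u. \<omega> \<in> hits z u)" for \<omega>
  proof
    assume "\<exists>u. \<omega> \<in> hits z u"
    then obtain u where "\<omega> \<in> hits z u" ..
    then obtain s where s: "0 \<le> s" "s \<le> u" "z \<le> X s \<omega>" "\<omega> \<in> space Om" by (auto simp: hits_def)
    have "s \<le> real (nat \<lceil>u\<rceil>)" using s(2) real_nat_ceiling_ge[of u] by (rule order_trans)
    with s have "\<omega> \<in> hits z (real (nat \<lceil>u\<rceil>))"
      unfolding hits_def by (intro CollectI conjI bexI[of _ s]) auto
    then show "\<omega> \<in> H" by (auto simp: H_def)
  qed (auto simp: H_def)
  \<comment> \<open>Off \<open>H\<close> the value 0 is a placeholder that keeps
    \<open>\<tau>\<close> nonnegative and measurable.\<close>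
  define \<tau> where "\<tau> \<omega> = (if \<omega> \<in> H then hit_time z \<omega> else 0)" for \<omega>
  have \<tau>0: "0 \<le> \<tau> \<omega>" for \<omega> using hit_time(1)[of \<omega> z] by (auto simp: \<tau>_def H_iff)
  have \<tau>_iff: "\<omega> \<in> hits z u \<longleftrightarrow> \<omega> \<in> H \<and> \<tau> \<omega> \<le> u" for \<omega> u
  proof
    assume "\<omega> \<in> hits z u"
    then show "\<omega> \<in> H \<and> \<tau> \<omega> \<le> u"
      using hit_time(2)[of \<omega> z u] H_iff[of \<omega>] by (auto simp: \<tau>_def)
  next
    assume *: "\<omega> \<in> H \<and> \<tau> \<omega> \<le> u"
    then obtain v where v: "\<omega> \<in> hits z v" using H_iff[of \<omega>] by auto
    show "\<omega> \<in> hits z u"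
      using * hits_iff_hit_time[OF v, of u] hit_time(1)[OF v] by (auto simp: \<tau>_def)
  qed
  have \<tau>[measurable]: "\<tau> \<in> borel_measurable Om"
  proof (rule borel_measurableI_le)
    fix u
    have "{\<omega> \<in> space Om. \<tau> \<omega> \<le> u} = hits z u \<union> (if 0 \<le> u then space Om - H else {})"
      using \<tau>_iff sets.sets_into_space[OF H] by (auto simp: \<tau>_def)
    then show "{\<omega> \<in> space Om. \<tau> \<omega> \<le> u} \<in> sets Om" using hits_sets H by auto
  qed
  let ?i = "\<lambda>u s \<omega>. indicator H \<omega> * indicator {\<tau> \<omega>..} u * indicator B (Y (\<tau> \<omega> + s) \<omega>) :: ennreal"
  let ?k = "\<lambda>u s \<omega>. exp_weight u * exp_weight s * ?i u s \<omega>"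
  have Px_hits: "emeasure (P x) {\<omega> \<in> hits z u. X (hit_time z \<omega> + s) \<omega> \<in> B}
      = (\<integral>\<^sup>+\<omega>. ?i u s \<omega> \<partial>P x)"
    if "0 \<le> s" for u s
  proof -
    have eq: "{\<omega> \<in> hits z u. X (hit_time z \<omega> + s) \<omega> \<in> B} = {\<omega> \<in> space Om. \<omega> \<in> H \<and> \<tau> \<omega> \<le> u \<and> Y (\<tau> \<omega> + s) \<omega> \<in> B}"
      using \<tau>_iff \<tau>0 that sets.sets_into_space[OF H] by (auto simp: \<tau>_def Y_def max_def)
    have Ym[measurable]: "(\<lambda>\<omega>. Y (\<tau> \<omega> + s) \<omega>) \<in> borel_measurable Om"
      by (intro Y_compose_measurable) measurable
    have "{\<omega> \<in> space Om. \<omega> \<in> H \<and> \<tau> \<omega> \<le> u \<and> Y (\<tau> \<omega> + s) \<omega> \<in> B} \<in> sets (P x)"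
      by measurable
    then have "emeasure (P x) {\<omega> \<in> hits z u. X (hit_time z \<omega> + s) \<omega> \<in> B}
        = (\<integral>\<^sup>+\<omega>. indicator {\<omega> \<in> space Om. \<omega> \<in> H \<and> \<tau> \<omega> \<le> u \<and> Y (\<tau> \<omega> + s) \<omega> \<in> B} \<omega> \<partial>P x)"
      unfolding eq by simp
    also have "\<dots> = (\<integral>\<^sup>+\<omega>. ?i u s \<omega> \<partial>P x)"
      by (intro nn_integral_cong) (auto simp: space_P[OF x] split: split_indicator)
    finally show ?thesis .
  qed
  have Pz_meas: "(\<lambda>s. exp_weight s * emeasure (P z) {\<omega> \<in> space Om. X s \<omega> \<in> B}) \<in> borel_measurable lborel"
  proof -
    have "(\<lambda>s. exp_weight s * (\<integral>\<^sup>+\<omega>. indicator B (Y s \<omega>) \<partial>P z)) \<in> borel_measurable lborel"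
      by measurable
    moreover have "exp_weight s * emeasure (P z) {\<omega> \<in> space Om. X s \<omega> \<in> B} = exp_weight s * (\<integral>\<^sup>+\<omega>. indicator B (Y s \<omega>) \<partial>P z)" for s
    proof (cases "0 \<le> s")
      case True
      have "(\<integral>\<^sup>+\<omega>. indicator B (Y s \<omega>) \<partial>P z) = (\<integral>\<^sup>+\<omega>. indicator {\<omega> \<in> space Om. X s \<omega> \<in> B} \<omega> \<partial>P z)"
        using True by (intro nn_integral_cong) (auto simp: Y_def max_def space_P[OF z(1)] split: split_indicator)
      then show ?thesis using event_measurable[OF True B] sets_P[OF z(1)] by simp
    qed (simp add: exp_weight_def)
    ultimately show ?thesis by simp
  qed
  have Rx: "resolvent x B = (\<integral>\<^sup>+\<omega>. (\<integral>\<^sup>+t. exp_weight t * indicator B (Y t \<omega>) \<partial>lborel) \<partial>P x)"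
  proof -
    have "resolvent x B = (\<integral>\<^sup>+t. (\<integral>\<^sup>+\<omega>. exp_weight t * indicator B (Y t \<omega>) \<partial>P x) \<partial>lborel)"
      unfolding resolvent_def
    proof (intro nn_integral_cong)
      fix t
      show "exp_weight t * emeasure (P x) {\<omega> \<in> space Om. X t \<omega> \<in> B} = (\<integral>\<^sup>+\<omega>. exp_weight t * indicator B (Y t \<omega>) \<partial>P x)"
      proof (cases "0 \<le> t")
        case True
        have "(\<integral>\<^sup>+\<omega>. exp_weight t * indicator B (Y t \<omega>) \<partial>P x)
           = (\<integral>\<^sup>+\<omega>. exp_weight t * indicator {\<omega> \<in> space Om. X t \<omega> \<in> B} \<omega> \<partial>P x)"
          using True by (intro nn_integral_cong) (auto simp: Y_def max_def space_P[OF x] split: split_indicator)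
        then show ?thesis using event_measurable[OF True B] sets_P[OF x]
          by (simp add: nn_integral_cmult_indicator)
      qed (simp add: exp_weight_def)
    qed
    also have "\<dots> = (\<integral>\<^sup>+\<omega>. (\<integral>\<^sup>+t. exp_weight t * indicator B (Y t \<omega>) \<partial>lborel) \<partial>P x)"
      by (rule lP.Fubini'[symmetric]) measurable
    finally show ?thesis .
  qed
  have "\<psi> * resolvent z B
      = (\<integral>\<^sup>+u. exp_weight u * emeasure (P x) (hits z u) * resolvent z B \<partial>lborel)"
  proof -
    have "(\<lambda>u. exp_weight u * emeasure (P x) (hits z u)) \<in> borel_measurable lborel"
    proof -
      have "emeasure (P x) (hits z u) = (\<integral>\<^sup>+\<omega>. indicator H \<omega> * indicator {\<tau> \<omega>..} u \<partial>P x)" for u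
      proof -
        have "(\<integral>\<^sup>+\<omega>. indicator H \<omega> * indicator {\<tau> \<omega>..} u \<partial>P x) = (\<integral>\<^sup>+\<omega>. indicator (hits z u) \<omega> \<partial>P x)"
          using \<tau>_iff[of _ u] by (intro nn_integral_cong) (auto split: split_indicator)
        then show ?thesis using hits_sets[of z u] sets_P[OF x] by simp
      qed
      \<comment> \<open>The indicator of \<open>\<tau> \<omega> \<le> u\<close> is written with a
        set of paths instead of a set of times, the form in which measurability in
        \<open>\<omega>\<close> is derived.\<close>
      moreover have "(\<lambda>u. exp_weight u * (\<integral>\<^sup>+\<omega>. indicator H \<omega> * indicator {\<omega>. \<tau> \<omega> \<le> u} \<omega> \<partial>P x)) \<in> borel_measurable lborel"
        by measurable
      ultimately show ?thesis by (simp add: indicator_def)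
    qed
    then show ?thesis unfolding \<psi>_def by (rule nn_integral_multc[symmetric])
  qed
  also have "\<dots> = (\<integral>\<^sup>+u. (\<integral>\<^sup>+s. (\<integral>\<^sup>+\<omega>. ?k u s \<omega> \<partial>P x) \<partial>lborel) \<partial>lborel)"
  proof (intro nn_integral_cong)
    fix u :: real
    have Ym[measurable]: "(\<lambda>\<omega>. Y (\<tau> \<omega> + s) \<omega>) \<in> borel_measurable Om" for s
      by (intro Y_compose_measurable) measurable
    have "exp_weight u * emeasure (P x) (hits z u) * resolvent z B
       = (\<integral>\<^sup>+s. exp_weight u * emeasure (P x) (hits z u) * (exp_weight s * emeasure (P z) {\<omega> \<in> space Om. X s \<omega> \<in> B}) \<partial>lborel)"
      unfolding resolvent_def by (rule nn_integral_cmult[symmetric, OF Pz_meas])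
    also have "\<dots> = (\<integral>\<^sup>+s. (\<integral>\<^sup>+\<omega>. ?k u s \<omega> \<partial>P x) \<partial>lborel)"
    proof (intro nn_integral_cong)
      fix s :: real
      show "exp_weight u * emeasure (P x) (hits z u) * (exp_weight s * emeasure (P z) {\<omega> \<in> space Om. X s \<omega> \<in> B})
        = (\<integral>\<^sup>+\<omega>. ?k u s \<omega> \<partial>P x)"
      proof (cases "0 \<le> u \<and> 0 \<le> s")
        case True
        have "(\<integral>\<^sup>+\<omega>. ?k u s \<omega> \<partial>P x)
          = exp_weight u * exp_weight s * (\<integral>\<^sup>+\<omega>. ?i u s \<omega> \<partial>P x)"
        proof (rule nn_integral_cmult)
          have "(\<lambda>\<omega>. indicator H \<omega> * indicator {\<omega>. \<tau> \<omega> \<le> u} \<omega> * indicator B (Y (\<tau> \<omega> + s) \<omega>) :: ennreal) \<in> borel_measurable (P x)"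
            by measurable
          then show "(\<lambda>\<omega>. ?i u s \<omega>) \<in> borel_measurable (P x)"
            by (simp add: indicator_def)
        qed
        then show ?thesis
          using Px_hits[of s u] strong_markov_hit[OF x z, of u s B] True B by (simp add: mult_ac)
      qed (auto simp: exp_weight_def)
    qed
    finally show "exp_weight u * emeasure (P x) (hits z u) * resolvent z B
       = (\<integral>\<^sup>+s. (\<integral>\<^sup>+\<omega>. ?k u s \<omega> \<partial>P x) \<partial>lborel)" .
  qed
  also have "\<dots> = (\<integral>\<^sup>+\<omega>. (\<integral>\<^sup>+u. (\<integral>\<^sup>+s. ?k u s \<omega> \<partial>lborel) \<partial>lborel) \<partial>P x)"
  proof -
    have Ym[measurable]: "(\<lambda>p. Y (\<tau> (g p) + h p) (g p)) \<in> borel_measurable N"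
      if "g \<in> N \<rightarrow>\<^sub>M Om" "h \<in> borel_measurable N" for g h and N :: "'z measure"
      using that by (intro Y_compose_measurable) measurable
    have "(\<integral>\<^sup>+u. (\<integral>\<^sup>+s. (\<integral>\<^sup>+\<omega>. ?k u s \<omega> \<partial>P x) \<partial>lborel) \<partial>lborel)
      = (\<integral>\<^sup>+u. (\<integral>\<^sup>+\<omega>. (\<integral>\<^sup>+s. ?k u s \<omega> \<partial>lborel) \<partial>P x) \<partial>lborel)"
    proof (intro nn_integral_cong, rule lP.Fubini'[symmetric])
      fix u :: real
      have "(\<lambda>p. exp_weight u * exp_weight (fst p) *
          (indicator H (snd p) * indicator {\<omega>. \<tau> \<omega> \<le> u} (snd p) * indicator B (Y (\<tau> (snd p) + fst p) (snd p))))
        \<in> borel_measurable (lborel \<Otimes>\<^sub>M P x)"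
        by measurable
      then show "(\<lambda>(s, \<omega>). ?k u s \<omega>)
        \<in> borel_measurable (lborel \<Otimes>\<^sub>M P x)"
        by (simp add: case_prod_beta' indicator_def)
    qed
    also have "\<dots> = (\<integral>\<^sup>+\<omega>. (\<integral>\<^sup>+u. (\<integral>\<^sup>+s. ?k u s \<omega> \<partial>lborel) \<partial>lborel) \<partial>P x)"
    proof (rule lP.Fubini'[symmetric])
      have "(\<lambda>p. \<integral>\<^sup>+s. exp_weight (fst p) * exp_weight s *
          (indicator H (snd p) * indicator {p. \<tau> (snd p) \<le> fst p} p * indicator B (Y (\<tau> (snd p) + s) (snd p))) \<partial>lborel)
        \<in> borel_measurable (lborel \<Otimes>\<^sub>M P x)"
        by measurable
      then show "(\<lambda>(u, \<omega>). \<integral>\<^sup>+s. ?k u s \<omega> \<partial>lborel)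
        \<in> borel_measurable (lborel \<Otimes>\<^sub>M P x)"
        by (simp add: case_prod_beta' indicator_def)
    qed
    finally show ?thesis .
  qed
  also have "\<dots> = resolvent x B"
    unfolding Rx
  proof (rule nn_integral_cong)
    fix \<omega> assume "\<omega> \<in> space (P x)"
    then have \<omega>: "\<omega> \<in> space Om" using space_P[OF x] by simp
    have [measurable]: "(\<lambda>t. Y (f t) \<omega>) \<in> borel_measurable borel" if "f \<in> borel_measurable borel" for f
      using that \<omega> by (intro Y_compose_measurable) auto
    let ?b = "\<lambda>s. exp_weight s * indicator B (Y (\<tau> \<omega> + s) \<omega>)"
    have "(\<integral>\<^sup>+u. (\<integral>\<^sup>+s. ?k u s \<omega> \<partial>lborel) \<partial>lborel)
      = (\<integral>\<^sup>+u. (\<integral>\<^sup>+s. (indicator H \<omega> * (ennreal (exp (- u)) * indicator {\<tau> \<omega>..} u)) * ?b s \<partial>lborel) \<partial>lborel)"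
      using \<tau>0[of \<omega>] by (intro nn_integral_cong) (auto simp: exp_weight_def mult_ac split: split_indicator)
    also have "\<dots> = (\<integral>\<^sup>+u. (indicator H \<omega> * (ennreal (exp (- u)) * indicator {\<tau> \<omega>..} u)) * (\<integral>\<^sup>+s. ?b s \<partial>lborel) \<partial>lborel)"
      by (intro nn_integral_cong nn_integral_cmult) measurable
    also have "\<dots> = (\<integral>\<^sup>+u. indicator H \<omega> * (ennreal (exp (- u)) * indicator {\<tau> \<omega>..} u) \<partial>lborel) * (\<integral>\<^sup>+s. ?b s \<partial>lborel)"
      by (rule nn_integral_multc) measurable
    also have "(\<integral>\<^sup>+u. indicator H \<omega> * (ennreal (exp (- u)) * indicator {\<tau> \<omega>..} u) \<partial>lborel)
        = indicator H \<omega> * ennreal (exp (- \<tau> \<omega>))"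
      by (subst nn_integral_cmult) (auto simp: nn_integral_exp_tail)
    also have "indicator H \<omega> * ennreal (exp (- \<tau> \<omega>)) * (\<integral>\<^sup>+s. ?b s \<partial>lborel)
        = (\<integral>\<^sup>+s. indicator H \<omega> * ennreal (exp (- \<tau> \<omega>)) * ?b s \<partial>lborel)"
      by (rule nn_integral_cmult[symmetric]) measurable
    also have "\<dots> = (\<integral>\<^sup>+s. exp_weight (\<tau> \<omega> + 1 * s) * indicator B (Y (\<tau> \<omega> + 1 * s) \<omega>) \<partial>lborel)"
    proof (intro nn_integral_cong)
      fix s :: real
      \<comment> \<open>The substitution extends the range from \<open>s \<ge> 0\<close> to
        \<open>s \<ge> - \<tau> \<omega>\<close>. The new times contribute nothing: before passage
        the path is below \<open>z\<close>, hence outside \<open>B\<close>, and off \<open>H\<close>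
        it never enters \<open>B\<close>.\<close>
      have notB: "Y t \<omega> \<notin> B" if "0 \<le> t" "\<omega> \<in> H \<longrightarrow> t < \<tau> \<omega>" for t
      proof
        assume "Y t \<omega> \<in> B"
        then have "z \<le> X t \<omega>" using Bz that(1) by (auto simp: Y_def max_def)
        then have "\<omega> \<in> hits z t" using that(1) \<omega> by (auto simp: hits_def)
        then show False using \<tau>_iff[of \<omega> t] that(2) by simp
      qed
      consider "0 \<le> s" "\<omega> \<in> H" | "\<tau> \<omega> + s < 0" | "0 \<le> \<tau> \<omega> + s" "\<omega> \<in> H \<longrightarrow> s < 0"
        by force
      then show "indicator H \<omega> * ennreal (exp (- \<tau> \<omega>)) * ?b s = exp_weight (\<tau> \<omega> + 1 * s) * indicator B (Y (\<tau> \<omega> + 1 * s) \<omega>)"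
      proof cases
        case 1
        then show ?thesis using \<tau>0[of \<omega>]
          by (simp add: exp_weight_def exp_add[symmetric] ennreal_mult[symmetric] mult.assoc[symmetric])
      next
        case 2
        then show ?thesis using \<tau>0[of \<omega>] by (simp add: exp_weight_def)
      next
        case 3
        then have "Y (\<tau> \<omega> + s) \<omega> \<notin> B" by (intro notB) auto
        then show ?thesis by simp
      qed
    qed
    also have "\<dots> = (\<integral>\<^sup>+t. exp_weight t * indicator B (Y t \<omega>) \<partial>lborel)"
      by (subst nn_integral_real_affine[where c = 1 and t = "\<tau> \<omega>" and f = "\<lambda>t. exp_weight t * indicator B (Y t \<omega>)"]) auto
    finally show "(\<integral>\<^sup>+u. (\<integral>\<^sup>+s. ?k u s \<omega> \<partial>lborel) \<partial>lborel)
      = (\<integral>\<^sup>+t. exp_weight t * indicator B (Y t \<omega>) \<partial>lborel)" .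
  qed
  finally show "resolvent x B = \<psi> * resolvent z B" by (rule sym)
qed

end

section \<open>The Green kernel\<close>

lemma nn_integral_exp_rate:
  assumes "0 < c"
  shows "(\<integral>\<^sup>+t. ennreal (exp (- (c * t))) * indicator {0..} t \<partial>lborel) = ennreal (1 / c)"
proof -
  have "((\<lambda>x. - exp (- (c * x)) / c) \<longlongrightarrow> - 0 / c) at_top"
    using assms by (intro tendsto_intros filterlim_compose[OF exp_at_bot] filterlim_compose[OF filterlim_uminus_at_bot_at_top]
      filterlim_tendsto_pos_mult_at_top[OF tendsto_const] filterlim_ident) auto
  then have "(\<integral>\<^sup>+t. ennreal (exp (- (c * t))) * indicator {0..} t \<partial>lborel) = ennreal (- 0 / c - - exp (- (c * 0)) / c)"
    using assms by (intro nn_integral_FTC_atLeast) (auto intro!: derivative_eq_intros)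
  then show ?thesis by simp
qed

lemma suminf_Cauchy_Schwarz:
  fixes a b :: "nat \<Rightarrow> real"
  assumes a: "summable (\<lambda>k. (a k)\<^sup>2)" and b: "summable (\<lambda>k. (b k)\<^sup>2)"
  shows "summable (\<lambda>k. \<bar>a k * b k\<bar>)" and "(\<Sum>k. a k * b k)\<^sup>2 \<le> (\<Sum>k. (a k)\<^sup>2) * (\<Sum>k. (b k)\<^sup>2)"
proof -
  have bd: "\<bar>a k * b k\<bar> \<le> (a k)\<^sup>2 + (b k)\<^sup>2" for k
    using sum_squares_bound[of "a k" "b k"] sum_squares_bound[of "a k" "- b k"] by (auto simp: abs_if)
  show abs: "summable (\<lambda>k. \<bar>a k * b k\<bar>)"
    by (rule summable_comparison_test'[OF summable_add[OF a b], of 0]) (use bd in auto)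
  have "(\<lambda>N. (\<Sum>k<N. a k * b k)\<^sup>2) \<longlonglongrightarrow> (\<Sum>k. a k * b k)\<^sup>2"
    by (rule tendsto_power[OF summable_LIMSEQ[OF summable_rabs_cancel[OF abs]]])
  moreover have "(\<Sum>k<N. a k * b k)\<^sup>2 \<le> (\<Sum>k. (a k)\<^sup>2) * (\<Sum>k. (b k)\<^sup>2)" for N
  proof -
    have "(\<Sum>k<N. a k * b k)\<^sup>2 \<le> (\<Sum>k<N. (a k)\<^sup>2) * (\<Sum>k<N. (b k)\<^sup>2)"
      by (rule Cauchy_Schwarz_ineq_sum)
    also have "\<dots> \<le> (\<Sum>k. (a k)\<^sup>2) * (\<Sum>k. (b k)\<^sup>2)"
      by (intro mult_mono sum_le_suminf a b suminf_nonneg sum_nonneg) auto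
    finally show ?thesis .
  qed
  ultimately show "(\<Sum>k. a k * b k)\<^sup>2 \<le> (\<Sum>k. (a k)\<^sup>2) * (\<Sum>k. (b k)\<^sup>2)"
    by (intro LIMSEQ_le_const2) auto
qed

text \<open>Divide by the leading exponential and let \<open>t\<close> tend to infinity.\<close>

lemma exponential_series_zero:
  fixes c lam :: "nat \<Rightarrow> real"
  assumes lam: "strict_mono lam" and c: "summable (\<lambda>k. exp (- lam k) * \<bar>c k\<bar>)"
    and zero: "\<exists>\<^sub>F t in at_top. (\<lambda>k. exp (- lam k * t) * c k) sums 0"
  shows "c k = 0"
proof (induction k rule: less_induct)
  case (less k)
  define S where "S = (\<Sum>i. exp (- lam (i + Suc k)) * \<bar>c (i + Suc k)\<bar>)"
  let ?g = "\<lambda>t. exp (lam k * t - lam (Suc k) * (t - 1)) * S"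
  have S: "summable (\<lambda>i. exp (- lam (i + Suc k)) * \<bar>c (i + Suc k)\<bar>)"
    by (rule summable_ignore_initial_segment[OF c])
  have le: "\<bar>c k\<bar> \<le> ?g t" if t: "1 \<le> t" and sums: "(\<lambda>k. exp (- lam k * t) * c k) sums 0" for t
  proof -
    have "(\<Sum>i<Suc k. exp (- lam i * t) * c i) = exp (- lam k * t) * c k"
      using less by simp
    then have A: "(\<lambda>i. exp (- lam (i + Suc k) * t) * c (i + Suc k)) sums (0 - exp (- lam k * t) * c k)"
      using sums_split_initial_segment[OF sums, of "Suc k"] by simp
    \<comment> \<open>One unit of time is held back: the coefficients are summable only against
      \<open>exp (- lam k)\<close>, so the decay in \<open>t\<close> is extracted from the remaining
      \<open>t - 1\<close>.\<close>
    have B: "norm (exp (- lam (i + Suc k) * t) * c (i + Suc k))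
        \<le> exp (- lam (Suc k) * (t - 1)) * (exp (- lam (i + Suc k)) * \<bar>c (i + Suc k)\<bar>)" for i
    proof -
      have "lam (Suc k) * (t - 1) \<le> lam (i + Suc k) * (t - 1)"
        using t strict_mono_less_eq[OF lam] by (intro mult_right_mono) auto
      then have "- lam (i + Suc k) * t \<le> - lam (Suc k) * (t - 1) + - lam (i + Suc k)"
        by (simp add: algebra_simps)
      then have "exp (- lam (i + Suc k) * t) \<le> exp (- lam (Suc k) * (t - 1)) * exp (- lam (i + Suc k))"
        unfolding exp_add[symmetric] by simp
      then have "exp (- lam (i + Suc k) * t) * \<bar>c (i + Suc k)\<bar>
          \<le> exp (- lam (Suc k) * (t - 1)) * exp (- lam (i + Suc k)) * \<bar>c (i + Suc k)\<bar>"
        by (rule mult_right_mono) simp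
      then show ?thesis by (simp add: abs_mult mult.assoc)
    qed
    have "norm (0 - exp (- lam k * t) * c k) \<le> exp (- lam (Suc k) * (t - 1)) * S"
      unfolding S_def suminf_mult[OF S, symmetric] sums_unique[OF A]
      by (rule norm_suminf_le[OF B summable_mult[OF S]])
    then have "exp (- lam k * t) * \<bar>c k\<bar> \<le> exp (- lam (Suc k) * (t - 1)) * S" by (simp add: abs_mult)
    then have "exp (lam k * t) * (exp (- lam k * t) * \<bar>c k\<bar>) \<le> exp (lam k * t) * (exp (- lam (Suc k) * (t - 1)) * S)"
      by (intro mult_left_mono) auto
    then show ?thesis
      by (simp add: mult.assoc[symmetric] exp_add[symmetric])
  qed
  have "((\<lambda>t. exp (- ((lam (Suc k) - lam k) * t))) \<longlongrightarrow> 0) at_top"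
    using strict_monoD[OF lam, of k "Suc k"]
    by (intro filterlim_compose[OF exp_at_bot] filterlim_compose[OF filterlim_uminus_at_bot_at_top]
        filterlim_tendsto_pos_mult_at_top[OF tendsto_const] filterlim_ident) auto
  then have "((\<lambda>t. exp (lam (Suc k)) * S * exp (- ((lam (Suc k) - lam k) * t))) \<longlongrightarrow> exp (lam (Suc k)) * S * 0) at_top"
    by (rule tendsto_mult_left)
  moreover have "exp (lam (Suc k)) * S * exp (- ((lam (Suc k) - lam k) * t)) = ?g t" for t
  proof -
    have "lam k * t - lam (Suc k) * (t - 1) = lam (Suc k) + - ((lam (Suc k) - lam k) * t)"
      by (simp add: algebra_simps)
    then show ?thesis by (simp only: exp_add mult_ac)
  qed
  ultimately have "(?g \<longlongrightarrow> 0) at_top" by simp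
  show "c k = 0"
  proof (rule ccontr)
    assume "c k \<noteq> 0"
    then have "\<forall>\<^sub>F t in at_top. ?g t < \<bar>c k\<bar>"
      using \<open>(?g \<longlongrightarrow> 0) at_top\<close> by (intro order_tendstoD) auto
    with eventually_ge_at_top[of 1]
    have "\<forall>\<^sub>F t in at_top. \<not> (\<lambda>k. exp (- lam k * t) * c k) sums 0"
      by eventually_elim (use le in force)
    with zero show False by (simp add: frequently_def)
  qed
qed

text \<open>\<open>M\<close> stands for the speed measure. \<open>support_M\<close> says that every
  nonempty open set is charged, which makes almost everywhere identities available arbitrarily close
  to any point.\<close>

locale discrete_diffusion = diffusion_process l r I Om P X + M: sigma_finite_measure M
  for l r :: ereal and I and Om :: "'w measure" and P X and M :: "real measure" +
  fixes a b :: "real \<Rightarrow> real" and q :: "real \<Rightarrow> real \<Rightarrow> real \<Rightarrow> real"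
    and lam :: "nat \<Rightarrow> real" and \<phi> :: "nat \<Rightarrow> real \<Rightarrow> real"
  assumes sets_M: "sets M = sets (restrict_space borel (einterval l r))"
    and support_M: "open U \<Longrightarrow> U \<subseteq> einterval l r \<Longrightarrow> U \<noteq> {} \<Longrightarrow> emeasure M U \<noteq> 0"
    and transition_density: "has_transition_density l r Om P X M q"
    and spectrum: "discrete_spectrum l r a b M q lam \<phi>"
begin

abbreviation "J \<equiv> einterval l r"

sublocale l2_total M \<phi>
  using spectrum by (intro l2_total_of_basis) (simp add: discrete_spectrum_def)

lemma open_J: "open J"
  by (rule open_einterval)

lemma space_M: "space M = J"
  using sets_eq_imp_space_eq[OF sets_M] by (simp add: space_restrict_space)

lemma sets_M_iff: "A \<in> sets M \<longleftrightarrow> A \<in> sets borel \<and> A \<subseteq> J"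
  unfolding sets_M using sets_restrict_space_iff[of J borel A] open_J by auto

lemma borel_M: "f \<in> borel_measurable borel \<Longrightarrow> f \<in> borel_measurable M"
  by (subst measurable_cong_sets[OF sets_M refl]) (rule measurable_restrict_space1)

lemma id_M: "(\<lambda>x. x) \<in> borel_measurable M"
  by (rule borel_M) simp

lemma between_in_J: "x \<in> J \<Longrightarrow> y \<in> J \<Longrightarrow> x \<le> z \<Longrightarrow> z \<le> y \<Longrightarrow> z \<in> J"
  using less_le_trans[of l "ereal x" "ereal z"] le_less_trans[of "ereal z" "ereal y" r]
  by (simp add: einterval_def)

lemma ereal_J: "x \<in> J \<Longrightarrow> ereal x \<in> {l..r}"
  by (auto simp: einterval_def)

lemma AE_M_dense:
  assumes "AE y in M. Q y" "u \<in> J" "v \<in> J" "u < v"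
  obtains y where "u < y" "y < v" "Q y" "y \<in> J"
proof -
  obtain N where N: "N \<in> null_sets M" "{y \<in> space M. \<not> Q y} \<subseteq> N"
    using assms(1) unfolding eventually_ae_filter by blast
  have sub: "{u<..<v} \<subseteq> J" using between_in_J[OF assms(2,3)] by auto
  have "emeasure M {u<..<v} \<noteq> 0" using assms(4) sub by (intro support_M) auto
  then have "\<not> {u<..<v} \<subseteq> N"
    using N(1) emeasure_mono[of "{u<..<v}" N M] by (auto simp: null_sets_def)
  then obtain y where y: "y \<in> {u<..<v}" "y \<notin> N" by blast
  then have "y \<in> J" using sub by blast
  moreover have "Q y" using N(2) y \<open>y \<in> J\<close> by (auto simp: space_M)
  ultimately show ?thesis using that[of y] y by simp
qed

lemma J_neighbourhood:
  assumes "z \<in> J" "0 < d"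
  obtains u v where "u \<in> J" "v \<in> J" "z - d < u" "u < z" "z < v" "v < z + d"
proof -
  obtain e where e: "0 < e" "ball z e \<subseteq> J" using open_J assms(1) open_contains_ball by blast
  let ?e = "min d e / 2"
  have "z - ?e \<in> ball z e" "z + ?e \<in> ball z e" using e(1) assms(2) by (auto simp: dist_real_def)
  then show ?thesis using e assms(2) by (intro that[of "z - ?e" "z + ?e"]) auto
qed

text \<open>One-sided, because the continuity of the Green kernel that can be proved is continuity
  on an interval ending at the given point.\<close>

lemma agree_at_left_limit:
  fixes f g :: "real \<Rightarrow> real"
  assumes f: "continuous_on {u..y} f" and g: "continuous_on {u..y} g" and uy: "u < y"
    and eq: "\<And>v. u \<le> v \<Longrightarrow> v < y \<Longrightarrow> \<exists>s. v < s \<and> s < y \<and> f s = g s"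
  shows "f y = g y"
proof -
  let ?S = "{s \<in> {u..y}. f s - g s = 0}"
  have "closed ({u..y} \<inter> (\<lambda>s. f s - g s) -` {0})"
    by (intro continuous_closed_preimage continuous_on_diff f g closed_singleton closed_atLeastAtMost)
  then have cl: "closed ?S" by (simp add: vimage_def Int_def)
  have "y \<in> closure ?S"
    unfolding closure_approachable
  proof (intro allI impI)
    fix e :: real assume "0 < e"
    with uy have "u \<le> max u (y - e)" "max u (y - e) < y" by auto
    from eq[OF this] obtain s where "max u (y - e) < s" "s < y" "f s = g s" by blast
    then show "\<exists>s\<in>?S. dist s y < e" by (intro bexI[of _ s]) (auto simp: dist_real_def)
  qed
  then have "y \<in> ?S" using cl by (simp add: closure_closed)
  then show ?thesis by simp
qed

section \<open>The transition density and its eigenfunction series\<close>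

lemma lam_mono: "strict_mono lam" and lam_nonneg: "0 \<le> lam k"
proof -
  show m: "strict_mono lam" using spectrum by (simp add: discrete_spectrum_def)
  have "0 \<le> lam 0" using spectrum by (simp add: discrete_spectrum_def)
  also have "lam 0 \<le> lam k" using strict_mono_less_eq[OF m] by simp
  finally show "0 \<le> lam k" .
qed

lemma continuous_\<phi>: "continuous_on J (\<phi> k)"
  using spectrum by (auto simp: discrete_spectrum_def C2_on_def intro: C1_differentiable_imp_continuous_on)

lemma \<phi>_measurable [measurable]: "\<phi> k \<in> borel_measurable M"
  by (rule L2_measurable[OF e_L2])

lemma q_uniform_limit:
  "0 < t \<Longrightarrow> compact K \<Longrightarrow> K \<subseteq> J \<Longrightarrow> uniform_limit (K \<times> K)
     (\<lambda>N (x, y). \<Sum>k<N. exp (- lam k * t) * \<phi> k x * \<phi> k y) (\<lambda>(x, y). q t x y) sequentially"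
  using spectrum unfolding discrete_spectrum_def by blast

lemma q_sums:
  assumes "0 < t" "x \<in> J" "y \<in> J"
  shows "(\<lambda>k. exp (- lam k * t) * \<phi> k x * \<phi> k y) sums q t x y"
  using tendsto_uniform_limitI[OF q_uniform_limit[OF assms(1), of "{x, y}"], of "(x, y)"] assms
  by (simp add: sums_def)

lemma q_sym: "0 < t \<Longrightarrow> x \<in> J \<Longrightarrow> y \<in> J \<Longrightarrow> q t x y = q t y x"
  using sums_unique2[OF q_sums[of t x y]] q_sums[of t y x] by (simp add: mult_ac)

lemma q_nonneg: "0 < t \<Longrightarrow> x \<in> J \<Longrightarrow> y \<in> J \<Longrightarrow> 0 \<le> q t x y"
  using transition_density by (simp add: has_transition_density_def)

lemma transition_emeasure:
  "0 < t \<Longrightarrow> x \<in> J \<Longrightarrow> B \<in> sets M \<Longrightarrow>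
    emeasure (P (ereal x)) {\<omega> \<in> space Om. X t \<omega> \<in> ereal ` B} = (\<integral>\<^sup>+y\<in>B. ennreal (q t x y) \<partial>M)"
  using transition_density by (simp add: has_transition_density_def)

lemma q_measurable: "0 < t \<Longrightarrow> x \<in> J \<Longrightarrow> q t x \<in> borel_measurable M"
  using transition_density by (simp add: has_transition_density_def)

lemma continuous_q:
  assumes t: "0 < t" and x: "x \<in> J"
  shows "continuous_on J (q t x)"
  unfolding continuous_on_eq_continuous_at[OF open_J]
proof
  fix y assume "y \<in> J"
  then obtain e where e: "0 < e" "cball y e \<subseteq> J" using open_J open_contains_cball by blast
  \<comment> \<open>Convergence is uniform on squares, so one compact set must contain both the
    point \<open>x\<close> and a neighbourhood of \<open>y\<close>.\<close>
  let ?K = "cball y e \<union> {x}"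
  have K: "?K \<subseteq> J" using e x by auto
  have "continuous_on (?K \<times> ?K) (\<lambda>(x, y). q t x y)"
  proof (rule uniform_limit_theorem[OF _ q_uniform_limit[OF t _ K]])
    have c: "continuous_on (?K \<times> ?K) (\<lambda>p. \<phi> k (fst p))" "continuous_on (?K \<times> ?K) (\<lambda>p. \<phi> k (snd p))" for k
      using K by (auto intro!: continuous_on_compose2[OF continuous_\<phi>] continuous_intros)
    show "\<forall>\<^sub>F N in sequentially. continuous_on (?K \<times> ?K) (\<lambda>(x, y). \<Sum>k<N. exp (- lam k * t) * \<phi> k x * \<phi> k y)"
      unfolding case_prod_beta by (intro always_eventually allI continuous_intros c)
  qed auto
  then have "continuous_on (cball y e) (\<lambda>s. (\<lambda>(x, y). q t x y) (x, s))"
    by (rule continuous_on_compose2) (auto intro!: continuous_intros)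
  then have "continuous_on (cball y e) (q t x)" by simp
  then show "isCont (q t x) y" by (rule continuous_on_interior) (use e in auto)
qed

text \<open>Half of the exponential goes to each eigenfunction; the squares then form the series of
  \<open>q t\<close> on the diagonal, and Cauchy-Schwarz applies.\<close>

lemma q_summable_abs:
  assumes t: "0 < t" and x: "x \<in> J" and y: "y \<in> J"
  shows "summable (\<lambda>k. exp (- lam k * t) * \<bar>\<phi> k x * \<phi> k y\<bar>)"
proof -
  have "summable (\<lambda>k. (exp (- lam k * (t / 2)) * \<phi> k z)\<^sup>2)" if "z \<in> J" for z
  proof -
    have "(exp (- lam k * (t / 2)))\<^sup>2 = exp (- lam k * t)" for k
      by (simp add: power2_eq_square exp_add[symmetric])
    then have "(exp (- lam k * (t / 2)) * \<phi> k z)\<^sup>2 = exp (- lam k * t) * \<phi> k z * \<phi> k z" for k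
      by (simp only: power_mult_distrib) (simp add: power2_eq_square)
    then show ?thesis
      using sums_summable[OF q_sums[OF t that that]] by simp
  qed
  from suminf_Cauchy_Schwarz(1)[OF this[OF x] this[OF y]]
  have "summable (\<lambda>k. \<bar>exp (- lam k * (t / 2)) * exp (- lam k * (t / 2)) * (\<phi> k x * \<phi> k y)\<bar>)"
    by (simp add: mult_ac)
  then show ?thesis by (simp add: exp_add[symmetric] abs_mult mult.commute)
qed

text \<open>At nonpositive times \<open>q\<close> is unspecified; the value 0 allows joint
  measurability over all real times.\<close>

definition Q :: "real \<Rightarrow> real \<Rightarrow> real \<Rightarrow> real" where
  "Q t x y = (if 0 < t then q t x y else 0)"

lemma Q_measurable [measurable]: "(\<lambda>(t, x, y). Q t x y) \<in> borel_measurable (borel \<Otimes>\<^sub>M (M \<Otimes>\<^sub>M M))"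
proof (rule borel_measurable_LIMSEQ_real)
  fix p :: "real \<times> real \<times> real" assume p: "p \<in> space (borel \<Otimes>\<^sub>M (M \<Otimes>\<^sub>M M))"
  obtain t x y where txy: "p = (t, x, y)" by (cases p)
  then have "x \<in> J" "y \<in> J" using p by (auto simp: space_pair_measure space_M)
  then show "(\<lambda>N. if 0 < fst p then \<Sum>k<N. exp (- lam k * fst p) * \<phi> k (fst (snd p)) * \<phi> k (snd (snd p)) else 0)
      \<longlonglongrightarrow> (case p of (t, x, y) \<Rightarrow> Q t x y)"
    using q_sums[of t x y] txy by (auto simp: Q_def sums_def)
next
  show "(\<lambda>p. if 0 < fst p then \<Sum>k<N. exp (- lam k * fst p) * \<phi> k (fst (snd p)) * \<phi> k (snd (snd p)) else 0)
      \<in> borel_measurable (borel \<Otimes>\<^sub>M (M \<Otimes>\<^sub>M M))" for N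
    by measurable
qed

text \<open>Extended-valued, as finiteness is known only after \<open>green_diagonal_bound\<close>;
  the real kernel is \<open>G 1\<close>.\<close>

definition green :: "real \<Rightarrow> real \<Rightarrow> ennreal" where
  "green x y = (\<integral>\<^sup>+t. exp_weight t * ennreal (Q t x y) \<partial>lborel)"

lemma green_measurable [measurable]: "(\<lambda>(x, y). green x y) \<in> borel_measurable (M \<Otimes>\<^sub>M M)"
proof -
  have "(\<lambda>p. \<integral>\<^sup>+t. exp_weight t * ennreal (case (t, p) of (t, x, y) \<Rightarrow> Q t x y) \<partial>lborel) \<in> borel_measurable (M \<Otimes>\<^sub>M M)"
    by measurable
  then show ?thesis by (simp add: green_def[abs_def] case_prod_beta')
qed

lemma green_measurable1: "x \<in> J \<Longrightarrow> green x \<in> borel_measurable M"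
  using measurable_compose[OF measurable_Pair1'[of x M M] green_measurable] by (simp add: space_M)

lemma green_sym: "x \<in> J \<Longrightarrow> y \<in> J \<Longrightarrow> green x y = green y x"
  unfolding green_def by (intro nn_integral_cong) (auto simp: Q_def q_sym)

lemma Q_measurable_time:
  assumes "x \<in> J" "y \<in> J"
  shows "(\<lambda>t. exp_weight t * ennreal (Q t x y)) \<in> borel_measurable lborel"
proof -
  have "(\<lambda>t. (t, x, y)) \<in> borel \<rightarrow>\<^sub>M borel \<Otimes>\<^sub>M (M \<Otimes>\<^sub>M M)"
    using assms by (intro measurable_Pair measurable_ident_sets measurable_const) (auto simp: space_M)
  from measurable_compose[OF this Q_measurable]
  have [measurable]: "(\<lambda>t. Q t x y) \<in> borel_measurable borel" by simp
  show ?thesis by measurable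
qed

text \<open>Tonelli exchanges the integrals over time and space; time 0, for which no density is
  given, is a null set.\<close>

lemma resolvent_eq_green:
  assumes x: "x \<in> J" and B: "B \<in> sets M"
  shows "resolvent (ereal x) (ereal ` B) = (\<integral>\<^sup>+y\<in>B. green x y \<partial>M)"
proof -
  interpret lM: pair_sigma_finite lborel M by unfold_locales
  note [measurable] = B
  have Qx[measurable]: "(\<lambda>p. Q (fst p) x (snd p)) \<in> borel_measurable (borel \<Otimes>\<^sub>M M)"
  proof -
    have "(\<lambda>p. (fst p, x, snd p)) \<in> borel \<Otimes>\<^sub>M M \<rightarrow>\<^sub>M borel \<Otimes>\<^sub>M (M \<Otimes>\<^sub>M M)"
      using x by (intro measurable_Pair measurable_fst measurable_snd measurable_const) (simp add: space_M)
    from measurable_compose[OF this Q_measurable] show ?thesis by simp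
  qed
  have "resolvent (ereal x) (ereal ` B) = (\<integral>\<^sup>+t. (\<integral>\<^sup>+y. exp_weight t * ennreal (Q t x y) * indicator B y \<partial>M) \<partial>lborel)"
    unfolding resolvent_def
  proof (rule nn_integral_cong_AE, use AE_lborel_singleton[of 0] in eventually_elim)
    fix t :: real assume "t \<noteq> 0"
    show "exp_weight t * emeasure (P (ereal x)) {\<omega> \<in> space Om. X t \<omega> \<in> ereal ` B}
      = (\<integral>\<^sup>+y. exp_weight t * ennreal (Q t x y) * indicator B y \<partial>M)"
    proof (cases "0 < t")
      case True
      have "(\<integral>\<^sup>+y. exp_weight t * ennreal (Q t x y) * indicator B y \<partial>M)
        = (\<integral>\<^sup>+y. exp_weight t * (ennreal (q t x y) * indicator B y) \<partial>M)"
        using True by (simp add: Q_def mult.assoc)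
      also have "\<dots> = exp_weight t * (\<integral>\<^sup>+y. ennreal (q t x y) * indicator B y \<partial>M)"
      proof (rule nn_integral_cmult)
        note [measurable] = q_measurable[OF True x]
        show "(\<lambda>y. ennreal (q t x y) * indicator B y) \<in> borel_measurable M" by measurable
      qed
      finally show ?thesis using transition_emeasure[OF True x B] by simp
    next
      case False
      then show ?thesis using \<open>t \<noteq> 0\<close> by (simp add: exp_weight_def)
    qed
  qed
  also have "\<dots> = (\<integral>\<^sup>+y. (\<integral>\<^sup>+t. exp_weight t * ennreal (Q t x y) * indicator B y \<partial>lborel) \<partial>M)"
  proof (rule lM.Fubini'[symmetric])
    have "(\<lambda>p. exp_weight (fst p) * ennreal (Q (fst p) x (snd p)) * indicator B (snd p)) \<in> borel_measurable (lborel \<Otimes>\<^sub>M M)"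
      by measurable
    then show "(\<lambda>(t, y). exp_weight t * ennreal (Q t x y) * indicator B y) \<in> borel_measurable (lborel \<Otimes>\<^sub>M M)"
      by (simp add: case_prod_beta')
  qed
  also have "\<dots> = (\<integral>\<^sup>+y\<in>B. green x y \<partial>M)"
  proof (intro nn_integral_cong)
    fix y assume y: "y \<in> space M"
    then have "(\<lambda>t. exp_weight t * ennreal (Q t x y)) \<in> borel_measurable lborel"
      using x by (intro Q_measurable_time) (auto simp: space_M)
    then show "(\<integral>\<^sup>+t. exp_weight t * ennreal (Q t x y) * indicator B y \<partial>lborel) = green x y * indicator B y"
      unfolding green_def by (rule nn_integral_multc)
  qed
  finally show ?thesis .
qed

lemma ereal_image_borel: "B \<in> sets M \<Longrightarrow> ereal ` B \<in> sets borel"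
proof -
  assume "B \<in> sets M"
  then have B: "B \<in> sets borel" by (simp add: sets_M_iff)
  have "ereal ` B = {x \<in> space borel. real_of_ereal x \<in> B \<and> x \<noteq> \<infinity> \<and> x \<noteq> -\<infinity>}"
  proof (intro equalityI subsetI)
    fix x assume "x \<in> {x \<in> space borel. real_of_ereal x \<in> B \<and> x \<noteq> \<infinity> \<and> x \<noteq> -\<infinity>}"
    then show "x \<in> ereal ` B" by (cases x) auto
  qed auto
  also have "\<dots> \<in> sets borel" using B by measurable
  finally show ?thesis .
qed

section \<open>Finiteness of the Green kernel on the diagonal\<close>

lemma green_strong_markov:
  assumes x: "x \<in> J" and z: "z \<in> J" "x < z"
  obtains \<psi> where "\<psi> \<le> 1"
    "\<And>B. B \<in> sets M \<Longrightarrow> B \<subseteq> {z..} \<Longrightarrow> (\<integral>\<^sup>+y\<in>B. green x y \<partial>M) = \<psi> * (\<integral>\<^sup>+y\<in>B. green z y \<partial>M)"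
proof -
  obtain \<psi> where \<psi>: "\<psi> \<le> 1" "\<And>B. B \<in> sets borel \<Longrightarrow> B \<subseteq> {ereal z..} \<Longrightarrow> resolvent (ereal x) B = \<psi> * resolvent (ereal z) B"
    using resolvent_strong_markov[OF ereal_J[OF x] ereal_J[OF z(1)]] z(2) by auto
  show ?thesis
  proof (rule that[OF \<psi>(1)])
    fix B assume B: "B \<in> sets M" "B \<subseteq> {z..}"
    then have "resolvent (ereal x) (ereal ` B) = \<psi> * resolvent (ereal z) (ereal ` B)"
      by (intro \<psi>(2) ereal_image_borel) auto
    then show "(\<integral>\<^sup>+y\<in>B. green x y \<partial>M) = \<psi> * (\<integral>\<^sup>+y\<in>B. green z y \<partial>M)"
      by (simp add: resolvent_eq_green x z B)
  qed
qed

text \<open>Otherwise \<open>q t z\<close> vanishes for all \<open>t\<close>, although paths from \<open>z\<close> stay in \<open>J\<close> for a short time.\<close>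

lemma \<phi>_nonvanishing:
  assumes z: "z \<in> J"
  shows "\<exists>k. \<phi> k z \<noteq> 0"
proof (rule ccontr)
  assume "\<nexists>k. \<phi> k z \<noteq> 0"
  then have "q t z y = 0" if "0 < t" "y \<in> J" for t y
    using sums_unique[OF q_sums[OF that(1) z that(2)]] by simp
  then have "(\<integral>\<^sup>+y\<in>J. ennreal (q t z y) \<partial>M) = (\<integral>\<^sup>+y. 0 \<partial>M)" if "0 < t" for t
    using that by (intro nn_integral_cong) (auto split: split_indicator)
  then have null: "emeasure (P (ereal z)) {\<omega> \<in> space Om. X t \<omega> \<in> ereal ` J} = 0" if "0 < t" for t
    using transition_emeasure[OF that z sets.top] that by (simp add: space_M)
  have J: "J \<in> sets M" using sets.top[of M] by (simp add: space_M)
  let ?t = "\<lambda>n. inverse (real (Suc n))"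
  interpret prob_space "P (ereal z)" using ereal_J[OF z] by (rule prob_P)
  have "AE \<omega> in P (ereal z). X (?t n) \<omega> \<notin> ereal ` J" for n
  proof (rule AE_I)
    show "{\<omega> \<in> space (P (ereal z)). \<not> X (?t n) \<omega> \<notin> ereal ` J} \<subseteq> {\<omega> \<in> space Om. X (?t n) \<omega> \<in> ereal ` J}"
      using space_P[OF ereal_J[OF z]] by auto
    show "emeasure (P (ereal z)) {\<omega> \<in> space Om. X (?t n) \<omega> \<in> ereal ` J} = 0" by (rule null) simp
    show "{\<omega> \<in> space Om. X (?t n) \<omega> \<in> ereal ` J} \<in> sets (P (ereal z))"
      using event_measurable[OF _ ereal_image_borel[OF J], of "?t n"] sets_P[OF ereal_J[OF z]] by simp
  qed
  then have "AE \<omega> in P (ereal z). \<forall>n. X (?t n) \<omega> \<notin> ereal ` J" by (simp add: AE_all_countable)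
  then have "AE \<omega> in P (ereal z). False"
    using AE_X0[OF ereal_J[OF z]] AE_space
  proof eventually_elim
    case (elim \<omega>)
    then have \<omega>: "\<omega> \<in> space Om" using space_P[OF ereal_J[OF z]] by simp
    have "(\<lambda>n. X (?t n) \<omega>) \<longlonglongrightarrow> X 0 \<omega>"
      by (intro continuous_on_tendsto_compose[OF X_continuous[OF \<omega>]] LIMSEQ_inverse_real_of_nat) auto
    then have "\<forall>\<^sub>F n in sequentially. X (?t n) \<omega> \<in> {l<..<r}"
      using elim(2) z by (intro topological_tendstoD) (auto simp: einterval_def)
    then obtain n where n: "X (?t n) \<omega> \<in> {l<..<r}" by (auto simp: eventually_sequentially)
    then have "X (?t n) \<omega> \<in> ereal ` J" by (cases "X (?t n) \<omega>") (auto simp: einterval_def)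
    then show False using elim(1) by blast
  qed
  then show False by simp
qed

text \<open>Otherwise \<open>q t x y\<close> vanishes at arbitrarily large \<open>t\<close> for
  almost all \<open>x < z \<le> y\<close>, and uniqueness of exponential series gives
  \<open>\<phi> k x * \<phi> k y = 0\<close> for every \<open>k\<close>. This fails near
  \<open>z\<close>, where some \<open>\<phi> k\<close> is nonzero. The gap between \<open>u\<close>
  and \<open>z\<close> leaves room for a bound on a whole interval.\<close>

lemma green_communicates:
  assumes z: "z \<in> J"
  obtains u where "u \<in> J" "u < z" "(\<integral>\<^sup>+x\<in>{x\<in>J. x < u}. (\<integral>\<^sup>+y\<in>{y\<in>J. z \<le> y}. green x y \<partial>M) \<partial>M) \<noteq> 0"
proof -
  have C: "{y \<in> J. z \<le> y} \<in> sets M" "{x \<in> J. x < u} \<in> sets M" for u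
    using open_J by (auto simp: sets_M_iff intro!: borel_measurable_le)
  note [measurable] = C
  have "\<exists>u\<in>J. u < z \<and> (\<integral>\<^sup>+x\<in>{x\<in>J. x < u}. (\<integral>\<^sup>+y\<in>{y\<in>J. z \<le> y}. green x y \<partial>M) \<partial>M) \<noteq> 0"
  proof (rule ccontr)
    assume contra: "\<not> ?thesis"
    have AE_left: "AE x in M. x < u \<longrightarrow> (AE y in M. z \<le> y \<longrightarrow> (\<forall>k. \<phi> k x * \<phi> k y = 0))"
      if u: "u \<in> J" "u < z" for u
    proof -
      have m: "(\<lambda>x. \<integral>\<^sup>+y\<in>{y\<in>J. z \<le> y}. green x y \<partial>M) \<in> borel_measurable M"
        by measurable
      have "(\<integral>\<^sup>+x\<in>{x\<in>J. x < u}. (\<integral>\<^sup>+y\<in>{y\<in>J. z \<le> y}. green x y \<partial>M) \<partial>M) = 0"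
        using contra u by blast
      then have "AE x in M. (\<integral>\<^sup>+y\<in>{y\<in>J. z \<le> y}. green x y \<partial>M) * indicator {x\<in>J. x < u} x = 0"
        using m by (subst (asm) nn_integral_0_iff_AE) auto
      then show ?thesis
        using AE_space
      proof eventually_elim
        case (elim x)
        then have x: "x \<in> J" by (simp add: space_M)
        note [measurable] = green_measurable1[OF x]
        show ?case
        proof
          assume "x < u"
          then have "(\<integral>\<^sup>+y\<in>{y\<in>J. z \<le> y}. green x y \<partial>M) = 0" using elim(1) x by simp
          then have "AE y in M. green x y * indicator {y\<in>J. z \<le> y} y = 0"
            by (subst (asm) nn_integral_0_iff_AE) auto
          then show "AE y in M. z \<le> y \<longrightarrow> (\<forall>k. \<phi> k x * \<phi> k y = 0)"
            using AE_space
          proof eventually_elim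
            case (elim y)
            then have y: "y \<in> J" by (simp add: space_M)
            show ?case
            proof (intro impI allI)
              fix k assume "z \<le> y"
              then have "(\<integral>\<^sup>+t. exp_weight t * ennreal (Q t x y) \<partial>lborel) = 0"
                using elim(1) y by (simp add: green_def)
              then have AE: "AE t in lborel. exp_weight t * ennreal (Q t x y) = 0"
                using Q_measurable_time[OF x y] by (subst (asm) nn_integral_0_iff_AE) auto
              \<comment> \<open>The exceptional times form a null set, which contains no interval
                \<open>{K..K + 1}\<close>.\<close>
              have "\<exists>\<^sub>F t in at_top. (\<lambda>k. exp (- lam k * t) * (\<phi> k x * \<phi> k y)) sums 0"
                unfolding frequently_def eventually_at_top_linorder
              proof
                assume "\<exists>N. \<forall>t\<ge>N. \<not> (\<lambda>k. exp (- lam k * t) * (\<phi> k x * \<phi> k y)) sums 0"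
                then obtain N where N: "\<And>t. N \<le> t \<Longrightarrow> \<not> (\<lambda>k. exp (- lam k * t) * (\<phi> k x * \<phi> k y)) sums 0"
                  by blast
                obtain K where K: "N \<le> K" "1 \<le> K" by (meson max.cobounded1 max.cobounded2)
                have "t \<notin> {K..K + 1}" if "exp_weight t * ennreal (Q t x y) = 0" for t
                proof
                  assume t: "t \<in> {K..K + 1}"
                  then have t0: "0 < t" using K by auto
                  then have "q t x y \<le> 0"
                    using that by (simp add: exp_weight_def Q_def ennreal_eq_0_iff)
                  then have "q t x y = 0" using q_nonneg[OF t0 x y] by simp
                  then show False
                    using q_sums[OF t0 x y] N[of t] t K by (simp add: mult.assoc)
                qed
                then have "AE t in lborel. t \<notin> {K..K + 1}"
                  using AE by (auto elim!: eventually_mono)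
                then have "{K..K + 1} \<in> null_sets lborel" by (subst AE_iff_null_sets) auto
                then have "emeasure lborel {K..K + 1} = 0" by (rule null_setsD1)
                moreover have "emeasure lborel {K..K + 1} = ennreal 1" by (subst emeasure_lborel_Icc) auto
                ultimately show False by simp
              qed
              from exponential_series_zero[OF lam_mono _ this, of k]
              show "\<phi> k x * \<phi> k y = 0"
                using q_summable_abs[of 1 x y] x y by simp
            qed
          qed
        qed
      qed
    qed
    obtain k where k: "\<phi> k z \<noteq> 0" using \<phi>_nonvanishing[OF z] by blast
    have "isCont (\<phi> k) z"
      using continuous_\<phi>[of k] z open_J by (simp add: continuous_on_eq_continuous_at)
    then have "\<forall>\<^sub>F s in at z. \<phi> k s \<noteq> 0"
      using k by (intro tendsto_imp_eventually_ne) (auto simp: isCont_def)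
    then obtain d where d: "0 < d" "\<And>s. s \<noteq> z \<Longrightarrow> dist s z < d \<Longrightarrow> \<phi> k s \<noteq> 0"
      by (auto simp: eventually_at)
    obtain u v where uv: "u \<in> J" "v \<in> J" "z - d < u" "u < z" "z < v" "v < z + d"
      using J_neighbourhood[OF z d(1)] by blast
    \<comment> \<open>\<open>AE_left\<close> needs a threshold strictly below \<open>z\<close>;
      \<open>x\<close> is then found between \<open>u\<close> and \<open>u'\<close>, where
      \<open>\<phi> k\<close> does not vanish.\<close>
    obtain u' where u': "u < u'" "u' < z" using dense uv(4) by blast
    have u'J: "u' \<in> J" using between_in_J[OF uv(1) z, of u'] u' by simp
    obtain x where x: "u < x" "x < u'" "x < u' \<longrightarrow> (AE y in M. z \<le> y \<longrightarrow> (\<forall>k. \<phi> k x * \<phi> k y = 0))"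
      using AE_M_dense[OF AE_left[OF u'J u'(2)] uv(1) u'J u'(1)] by blast
    then have "AE y in M. z \<le> y \<longrightarrow> (\<forall>k. \<phi> k x * \<phi> k y = 0)" by simp
    from AE_M_dense[OF this z uv(2) uv(5)] obtain y
      where y: "z < y" "y < v" "z \<le> y \<longrightarrow> (\<forall>k. \<phi> k x * \<phi> k y = 0)" by blast
    have "\<phi> k x \<noteq> 0"
      by (rule d(2)) (use x uv u' in \<open>auto simp: dist_real_def\<close>)
    moreover have "\<phi> k y \<noteq> 0"
      by (rule d(2)) (use y uv in \<open>auto simp: dist_real_def\<close>)
    ultimately have "\<phi> k x * \<phi> k y \<noteq> 0" by simp
    then show False using y by auto
  qed
  then show ?thesis using that by blast
qed

text \<open>Fatou's lemma and the continuity of \<open>q t x\<close>. Lower semicontinuity requires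
  no finiteness and is enough to bound a value by averages nearby.\<close>

lemma green_lsc:
  assumes x: "x \<in> J" and y: "y \<in> J" and c: "c < green x y"
  obtains d where "0 < d" "\<And>s. s \<in> J \<Longrightarrow> \<bar>s - y\<bar> < d \<Longrightarrow> c < green x s"
proof -
  have "\<exists>d>0. \<forall>s\<in>J. \<bar>s - y\<bar> < d \<longrightarrow> c < green x s"
  proof (rule ccontr)
    assume contra: "\<not> ?thesis"
    have "\<exists>s. s \<in> J \<and> \<bar>s - y\<bar> < inverse (real (Suc n)) \<and> green x s \<le> c" for n
    proof -
      have "0 < inverse (real (Suc n))" by simp
      then show ?thesis using contra by (meson not_less)
    qed
    then obtain s where s: "\<And>n. s n \<in> J" "\<And>n. \<bar>s n - y\<bar> < inverse (real (Suc n))" "\<And>n. green x (s n) \<le> c"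
      by metis
    have "(\<lambda>n. \<bar>s n - y\<bar>) \<longlonglongrightarrow> 0"
        using abs_ge_zero less_imp_le[OF s(2)] by (rule tendsto_0_squeeze[OF LIMSEQ_inverse_real_of_nat])
    then have "(\<lambda>n. s n - y) \<longlonglongrightarrow> 0" by (rule tendsto_rabs_zero_cancel)
    then have lim: "s \<longlonglongrightarrow> y" by (rule LIM_zero_cancel)
    have "green x y = (\<integral>\<^sup>+t. liminf (\<lambda>n. exp_weight t * ennreal (Q t x (s n))) \<partial>lborel)"
      unfolding green_def
    proof (intro nn_integral_cong)
      fix t :: real
      have "(\<lambda>n. Q t x (s n)) \<longlonglongrightarrow> Q t x y"
        using continuous_on_tendsto_compose[OF continuous_q[OF _ x] lim y] s(1)
        by (cases "0 < t") (auto simp: Q_def)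
      moreover have "exp_weight t < Orderings.top" by (simp add: exp_weight_def ennreal_mult_less_top split: split_indicator)
      ultimately have "(\<lambda>n. exp_weight t * ennreal (Q t x (s n))) \<longlonglongrightarrow> exp_weight t * ennreal (Q t x y)"
        by (intro ennreal_tendsto_cmult tendsto_ennrealI)
      then show "exp_weight t * ennreal (Q t x y) = liminf (\<lambda>n. exp_weight t * ennreal (Q t x (s n)))"
        by (intro lim_imp_Liminf[symmetric]) auto
    qed
    also have "\<dots> \<le> liminf (\<lambda>n. green x (s n))"
      unfolding green_def by (intro nn_integral_liminf Q_measurable_time x s(1))
    also have "\<dots> \<le> liminf (\<lambda>n::nat. c)"
      by (intro Liminf_mono always_eventually allI s(3))
    finally have "green x y \<le> c" by (simp add: Liminf_const)
    with c show False by simp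
  qed
  then show ?thesis using that by blast
qed

text \<open>
  With \<open>\<kappa>\<close> the mass which the resolvent sends from below \<open>u\<close> to above \<open>z0\<close>, the strong Markov property
  at \<open>z\<close> and the symmetry of the kernel bound \<open>\<kappa> * green z\<close> by 1, in the mean over every set above \<open>z\<close>.
  Only points to the left of \<open>z0\<close> are covered, so only left continuity of \<open>G\<close> will follow.
\<close>

lemma green_diagonal_bound:
  assumes z0: "z0 \<in> J"
  obtains u K where "u \<in> J" "u < z0" "\<And>z. u \<le> z \<Longrightarrow> z \<le> z0 \<Longrightarrow> green z z \<le> ennreal K"
proof -
  let ?C = "{y \<in> J. z0 \<le> y}"
  obtain u where u: "u \<in> J" "u < z0" and pos: "(\<integral>\<^sup>+x\<in>{x\<in>J. x < u}. (\<integral>\<^sup>+y\<in>?C. green x y \<partial>M) \<partial>M) \<noteq> 0"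
    by (rule green_communicates[OF z0])
  let ?B = "{x \<in> J. x < u}"
  define \<kappa> where "\<kappa> = (\<integral>\<^sup>+x\<in>?B. (\<integral>\<^sup>+y\<in>?C. green x y \<partial>M) \<partial>M)"
  \<comment> \<open>\<open>\<kappa>\<close> may be infinite, since the measure below
    \<open>u\<close> may be; the minimum with 1 is a positive real number.\<close>
  define k where "k = enn2real (min 1 \<kappa>)"
  have min_top: "min 1 \<kappa> < Orderings.top" by (simp add: min_less_iff_disj)
  then have min_k: "min 1 \<kappa> = ennreal k" by (simp add: k_def)
  have k0: "0 < k" using pos min_top unfolding k_def \<kappa>_def by (simp add: enn2real_positive_iff zero_less_iff_neq_zero)
  have C[measurable]: "?C \<in> sets M" and B[measurable]: "?B \<in> sets M"
    using open_J by (auto simp: sets_M_iff intro!: borel_measurable_le)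
  interpret MM: pair_sigma_finite M M by unfold_locales
  have le_1: "(\<integral>\<^sup>+y\<in>A. green x y \<partial>M) \<le> 1" if "x \<in> J" "A \<in> sets M" for x A
    unfolding resolvent_eq_green[OF that, symmetric] by (rule resolvent_le_1[OF ereal_J[OF that(1)]])
  have key: "ennreal k * (\<integral>\<^sup>+y\<in>A. green z y \<partial>M) \<le> emeasure M A"
    if z: "u \<le> z" "z \<le> z0" and A: "A \<in> sets M" "A \<subseteq> {z..}" for z A
  proof -
    note [measurable] = A(1)
    have zJ: "z \<in> J" using between_in_J[OF u(1) z0 z] .
    have m1: "(\<lambda>x. \<integral>\<^sup>+y\<in>?C. green x y \<partial>M) \<in> borel_measurable M" by measurable
    have "ennreal k * (\<integral>\<^sup>+y\<in>A. green z y \<partial>M) \<le> \<kappa> * (\<integral>\<^sup>+y\<in>A. green z y \<partial>M)"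
      unfolding min_k[symmetric] by (intro mult_right_mono) auto
    also have "\<dots> = (\<integral>\<^sup>+x. (\<integral>\<^sup>+y\<in>?C. green x y \<partial>M) * indicator ?B x * (\<integral>\<^sup>+y\<in>A. green z y \<partial>M) \<partial>M)"
      unfolding \<kappa>_def using m1 by (intro nn_integral_multc[symmetric]) measurable
    also have "\<dots> \<le> (\<integral>\<^sup>+x. (\<integral>\<^sup>+y. green x y * indicator A y * indicator ?B x \<partial>M) \<partial>M)"
    proof (intro nn_integral_mono)
      fix x assume "x \<in> space M"
      then have x: "x \<in> J" by (simp add: space_M)
      show "(\<integral>\<^sup>+y\<in>?C. green x y \<partial>M) * indicator ?B x * (\<integral>\<^sup>+y\<in>A. green z y \<partial>M)
        \<le> (\<integral>\<^sup>+y. green x y * indicator A y * indicator ?B x \<partial>M)"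
      proof (cases "x < u")
        case True
        then have "x < z" using z by simp
        obtain \<psi> where \<psi>: "\<psi> \<le> 1" "\<And>B. B \<in> sets M \<Longrightarrow> B \<subseteq> {z..} \<Longrightarrow> (\<integral>\<^sup>+y\<in>B. green x y \<partial>M) = \<psi> * (\<integral>\<^sup>+y\<in>B. green z y \<partial>M)"
          by (rule green_strong_markov[OF x zJ \<open>x < z\<close>]) blast
        \<comment> \<open>The passage identity is used twice with the same \<open>\<psi>\<close>:
          for \<open>?C\<close> the mass sent from \<open>z\<close> is bounded by 1, and for
          \<open>A\<close> the factor \<open>\<psi>\<close> turns the start \<open>z\<close> back
          into \<open>x\<close>.\<close>
        have "(\<integral>\<^sup>+y\<in>?C. green x y \<partial>M) = \<psi> * (\<integral>\<^sup>+y\<in>?C. green z y \<partial>M)" using z by (intro \<psi>(2) C) auto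
        also have "\<dots> \<le> \<psi> * 1" by (intro mult_left_mono le_1 zJ C) auto
        finally have "(\<integral>\<^sup>+y\<in>?C. green x y \<partial>M) * (\<integral>\<^sup>+y\<in>A. green z y \<partial>M) \<le> \<psi> * (\<integral>\<^sup>+y\<in>A. green z y \<partial>M)"
          by (intro mult_right_mono) auto
        also have "\<dots> = (\<integral>\<^sup>+y\<in>A. green x y \<partial>M)" by (rule \<psi>(2)[OF A, symmetric])
        finally show ?thesis using True x by simp
      qed simp
    qed
    \<comment> \<open>With the integral over \<open>x\<close> inside, symmetry makes it the
      resolvent mass sent from \<open>y\<close> below \<open>u\<close>, at most 1.\<close>
    also have "\<dots> = (\<integral>\<^sup>+y. (\<integral>\<^sup>+x. green x y * indicator A y * indicator ?B x \<partial>M) \<partial>M)"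
    proof (rule MM.Fubini'[symmetric])
      have "(\<lambda>p. (case p of (x, y) \<Rightarrow> green x y) * indicator A (snd p) * indicator ?B (fst p)) \<in> borel_measurable (M \<Otimes>\<^sub>M M)"
        by measurable
      then show "(\<lambda>(x, y). green x y * indicator A y * indicator ?B x) \<in> borel_measurable (M \<Otimes>\<^sub>M M)"
        by (simp add: case_prod_beta')
    qed
    also have "\<dots> \<le> (\<integral>\<^sup>+y. indicator A y \<partial>M)"
    proof (intro nn_integral_mono)
      fix y assume "y \<in> space M"
      then have y: "y \<in> J" by (simp add: space_M)
      have "(\<integral>\<^sup>+x. green x y * indicator ?B x \<partial>M) = (\<integral>\<^sup>+x\<in>?B. green y x \<partial>M)"
        by (intro nn_integral_cong) (auto simp: space_M y green_sym)
      also have "\<dots> \<le> 1" by (rule le_1[OF y B])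
      finally show "(\<integral>\<^sup>+x. green x y * indicator A y * indicator ?B x \<partial>M) \<le> indicator A y"
        by (auto split: split_indicator)
    qed
    also have "\<dots> = emeasure M A" using A by simp
    finally show ?thesis .
  qed
  have "green z z \<le> ennreal (1 / k)" if z: "u \<le> z" "z \<le> z0" for z
  proof (rule ccontr)
    assume "\<not> green z z \<le> ennreal (1 / k)"
    then obtain c where c: "ennreal (1 / k) < c" "c < green z z" using dense by (auto simp: not_le)
    have zJ: "z \<in> J" using between_in_J[OF u(1) z0 z] .
    \<comment> \<open>A value above \<open>1 / k\<close> at \<open>z\<close> persists on an interval
      to the right of \<open>z\<close>, which is where \<open>key\<close> bounds the
      averages.\<close>
    obtain d where d: "0 < d" "\<And>s. s \<in> J \<Longrightarrow> \<bar>s - z\<bar> < d \<Longrightarrow> c < green z s"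
      using green_lsc[OF zJ zJ c(2)] by blast
    obtain v where v: "v \<in> J" "z < v" "v < z + d" using J_neighbourhood[OF zJ d(1)] by metis
    have sub: "{z<..<v} \<subseteq> J" using between_in_J[OF zJ v(1)] by auto
    have pos: "emeasure M {z<..<v} \<noteq> 0" using v(2) sub by (intro support_M) auto
    \<comment> \<open>The assumptions of the locale do not make the interval of finite measure; a
      piece of finite positive measure is needed to cancel it.\<close>
    obtain F :: "nat \<Rightarrow> real set" where F: "range F \<subseteq> sets M" "(\<Union>i. F i) = space M" "\<And>i. emeasure M (F i) \<noteq> \<infinity>"
      using M.sigma_finite by blast
    have zv: "{z<..<v} \<in> sets M" using sub by (auto simp: sets_M_iff)
    have "\<exists>i. emeasure M ({z<..<v} \<inter> F i) \<noteq> 0"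
    proof (rule ccontr)
      assume "\<nexists>i. emeasure M ({z<..<v} \<inter> F i) \<noteq> 0"
      then have "(\<Union>i. {z<..<v} \<inter> F i) \<in> null_sets M"
        using F(1) zv by (intro null_sets_UN) (auto simp: null_sets_def)
      moreover have "(\<Union>i. {z<..<v} \<inter> F i) = {z<..<v}" using F(2) sub by (auto simp: space_M)
      ultimately show False using pos by (simp add: null_sets_def)
    qed
    then obtain i where i: "emeasure M ({z<..<v} \<inter> F i) \<noteq> 0" ..
    let ?A = "{z<..<v} \<inter> F i"
    have A: "?A \<in> sets M" "?A \<subseteq> {z..}" using F(1) zv by auto
    have "emeasure M ?A \<le> emeasure M (F i)" using F(1) by (intro emeasure_mono) auto
    then have fin: "emeasure M ?A \<noteq> \<infinity>" using F(3)[of i] by (auto simp: top_unique)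
    have "c * emeasure M ?A = (\<integral>\<^sup>+y\<in>?A. c \<partial>M)" using A by (simp add: nn_integral_cmult_indicator)
    also have "\<dots> \<le> (\<integral>\<^sup>+y\<in>?A. green z y \<partial>M)"
      using d(2) v sub by (intro nn_integral_mono) (auto intro!: less_imp_le simp: abs_if split: split_indicator)
    finally have "ennreal k * (c * emeasure M ?A) \<le> ennreal k * (\<integral>\<^sup>+y\<in>?A. green z y \<partial>M)"
      by (intro mult_left_mono) auto
    also have "\<dots> \<le> emeasure M ?A" by (rule key[OF z A])
    finally have le: "ennreal k * c * emeasure M ?A \<le> emeasure M ?A" by (simp add: mult.assoc)
    obtain m where m: "emeasure M ?A = ennreal m" "0 < m"
      using i fin by (cases "emeasure M ?A") (auto simp: order_less_le)
    obtain c' where c': "c = ennreal c'" "1 / k < c'"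
      using c(1) c(2) k0 by (cases c) (auto simp: ennreal_less_iff)
    have "1 < k * c'" using c'(2) k0 by (simp add: field_simps)
    then have "m < k * c' * m" using m(2) by simp
    moreover have "0 < c'" using c'(2) k0 by (meson less_trans zero_less_divide_1_iff)
    ultimately show False using le m c' k0 by (simp add: ennreal_mult[symmetric])
  qed
  then show ?thesis using that[OF u] by blast
qed

section \<open>Spectral series of the Green kernel and of its iterates\<close>

definition w :: "nat \<Rightarrow> real" where "w k = 1 / (1 + lam k)"

text \<open>The kernel of the \<open>N\<close>-th power of the resolvent. It is meant for
  \<open>1 \<le> N\<close>; for \<open>N = 0\<close> the series need not converge.\<close>

definition G :: "nat \<Rightarrow> real \<Rightarrow> real \<Rightarrow> real" where
  "G N x y = (\<Sum>k. w k ^ N * (\<phi> k x * \<phi> k y))"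

lemma w_pos: "0 < w k" and w_le_1: "w k \<le> 1"
  using lam_nonneg[of k] by (auto simp: w_def divide_le_eq_1)

lemma w_nonneg: "0 \<le> w k"
  using w_pos by (rule less_imp_le)

lemma w_less: "j < k \<Longrightarrow> w k < w j"
  using lam_nonneg[of j] lam_nonneg[of k] strict_monoD[OF lam_mono, of j k]
  by (auto simp: w_def intro!: divide_strict_left_mono mult_pos_pos)

lemma exp_kernel_split: "exp (- ((1 + c) * t)) = exp (- t) * exp (- c * t)" for c t :: real
  by (simp add: exp_add[symmetric] ring_distribs)

lemma
  shows integrable_exp_kernel: "integrable lborel (\<lambda>t. exp (- ((1 + lam k) * t)) * indicator {0..} t)"
    and integral_exp_kernel: "(\<integral>t. exp (- ((1 + lam k) * t)) * indicator {0..} t \<partial>lborel) = w k"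
proof -
  have "(\<integral>\<^sup>+t. ennreal (exp (- ((1 + lam k) * t)) * indicator {0..} t) \<partial>lborel) = ennreal (w k)"
    using nn_integral_exp_rate[of "1 + lam k"] lam_nonneg[of k]
    by (simp add: w_def ennreal_mult' ennreal_indicator)
  then have "integrable lborel (\<lambda>t. exp (- ((1 + lam k) * t)) * indicator {0..} t)
      \<and> (\<integral>t. exp (- ((1 + lam k) * t)) * indicator {0..} t \<partial>lborel) = w k"
    using w_pos[of k] by (subst (asm) nn_integral_eq_integrable) auto
  then show "integrable lborel (\<lambda>t. exp (- ((1 + lam k) * t)) * indicator {0..} t)"
    "(\<integral>t. exp (- ((1 + lam k) * t)) * indicator {0..} t \<partial>lborel) = w k" by auto
qed

text \<open>On the diagonal all terms are nonnegative, so sum and integral can be exchanged before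
  anything is known to be finite.\<close>

lemma green_diagonal:
  assumes z: "z \<in> J"
  shows "green z z = (\<Sum>k. ennreal (w k * (\<phi> k z)\<^sup>2))"
proof -
  have "green z z = (\<integral>\<^sup>+t. (\<Sum>k. ennreal ((\<phi> k z)\<^sup>2 * (exp (- ((1 + lam k) * t)) * indicator {0..} t))) \<partial>lborel)"
    unfolding green_def
  proof (rule nn_integral_cong_AE, use AE_lborel_singleton[of 0] in eventually_elim)
    fix t :: real assume "t \<noteq> 0"
    show "exp_weight t * ennreal (Q t z z) = (\<Sum>k. ennreal ((\<phi> k z)\<^sup>2 * (exp (- ((1 + lam k) * t)) * indicator {0..} t)))"
    proof (cases "0 < t")
      case True
      have "(\<lambda>k. exp (- t) * (exp (- lam k * t) * \<phi> k z * \<phi> k z)) sums (exp (- t) * q t z z)"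
        by (intro sums_mult q_sums True z)
      moreover have "exp (- t) * (exp (- lam k * t) * \<phi> k z * \<phi> k z) = (\<phi> k z)\<^sup>2 * exp (- ((1 + lam k) * t))" for k
        unfolding exp_kernel_split by (simp add: power2_eq_square)
      ultimately have "(\<lambda>k. (\<phi> k z)\<^sup>2 * exp (- ((1 + lam k) * t))) sums (exp (- t) * q t z z)" by simp
      then have "(\<Sum>k. ennreal ((\<phi> k z)\<^sup>2 * exp (- ((1 + lam k) * t)))) = ennreal (exp (- t) * q t z z)"
        by (subst suminf_ennreal2) (auto simp: sums_iff)
      then show ?thesis using True by (simp add: exp_weight_def Q_def ennreal_mult')
    next
      case False
      then show ?thesis using \<open>t \<noteq> 0\<close> by (simp add: exp_weight_def)
    qed
  qed
  also have "\<dots> = (\<Sum>k. \<integral>\<^sup>+t. ennreal ((\<phi> k z)\<^sup>2 * (exp (- ((1 + lam k) * t)) * indicator {0..} t)) \<partial>lborel)"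
    by (rule nn_integral_suminf) measurable
  also have "\<dots> = (\<Sum>k. ennreal (w k * (\<phi> k z)\<^sup>2))"
  proof (intro suminf_cong)
    fix k
    have "(\<integral>\<^sup>+t. ennreal ((\<phi> k z)\<^sup>2 * (exp (- ((1 + lam k) * t)) * indicator {0..} t)) \<partial>lborel)
        = ennreal (\<integral>t. (\<phi> k z)\<^sup>2 * (exp (- ((1 + lam k) * t)) * indicator {0..} t) \<partial>lborel)"
      by (intro nn_integral_eq_integral integrable_mult_right integrable_exp_kernel) auto
    then show "(\<integral>\<^sup>+t. ennreal ((\<phi> k z)\<^sup>2 * (exp (- ((1 + lam k) * t)) * indicator {0..} t)) \<partial>lborel) = ennreal (w k * (\<phi> k z)\<^sup>2)"
      by (simp only: integral_mult_right_zero integral_exp_kernel mult.commute[of "w k"])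
  qed
  finally show ?thesis .
qed

text \<open>The basis of all later convergence: the other series are compared with this one by
  \<open>w k \<le> 1\<close> and Cauchy-Schwarz.\<close>

lemma summable_diagonal:
  assumes z: "z \<in> J"
  shows "summable (\<lambda>k. w k * (\<phi> k z)\<^sup>2)"
proof -
  obtain u K where "u < z" "\<And>s. u \<le> s \<Longrightarrow> s \<le> z \<Longrightarrow> green s s \<le> ennreal K"
    by (rule green_diagonal_bound[OF z]) blast
  then have "green z z \<le> ennreal K" by simp
  then have "(\<Sum>k. ennreal (w k * (\<phi> k z)\<^sup>2)) \<noteq> Orderings.top"
    by (auto simp: green_diagonal[OF z] top_unique)
  then show ?thesis by (intro summable_suminf_not_top) (auto simp: w_nonneg)
qed

lemma suminf_diagonal_le:
  assumes z: "z \<in> J" and K: "green z z \<le> ennreal K" "0 \<le> K"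
  shows "(\<Sum>k. w k * (\<phi> k z)\<^sup>2) \<le> K"
proof -
  have "(\<Sum>k. ennreal (w k * (\<phi> k z)\<^sup>2)) = ennreal (\<Sum>k. w k * (\<phi> k z)\<^sup>2)"
    by (intro suminf_ennreal2 summable_diagonal z) (auto simp: w_nonneg)
  then show ?thesis using K by (simp add: green_diagonal[OF z])
qed

lemma summable_power_diagonal:
  assumes "z \<in> J" "1 \<le> N"
  shows "summable (\<lambda>k. w k ^ N * (\<phi> k z)\<^sup>2)"
proof (rule summable_comparison_test'[OF summable_diagonal[OF assms(1)], of 0])
  fix k
  have "w k ^ N \<le> w k ^ 1" using w_pos[of k] w_le_1[of k] assms(2) by (intro power_decreasing) auto
  then show "norm (w k ^ N * (\<phi> k z)\<^sup>2) \<le> w k * (\<phi> k z)\<^sup>2"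
    using w_pos[of k] by (simp add: abs_mult mult_right_mono)
qed

lemma
  assumes x: "x \<in> J" and y: "y \<in> J" and N: "1 \<le> N"
  shows summable_G_abs: "summable (\<lambda>k. \<bar>w k ^ N * (\<phi> k x * \<phi> k y)\<bar>)"
    and G_Cauchy_Schwarz: "(G N x y)\<^sup>2 \<le> G N x x * G N y y"
proof -
  have sq: "(sqrt (w k ^ N) * \<phi> k z)\<^sup>2 = w k ^ N * (\<phi> k z)\<^sup>2" for k z
    using w_pos[of k] by (simp add: power_mult_distrib)
  have pr: "(sqrt (w k ^ N) * \<phi> k x) * (sqrt (w k ^ N) * \<phi> k y) = w k ^ N * (\<phi> k x * \<phi> k y)" for k
    using w_pos[of k] by (simp add: mult.assoc mult.left_commute real_sqrt_mult_self flip: mult.assoc)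
  have s: "summable (\<lambda>k. (sqrt (w k ^ N) * \<phi> k z)\<^sup>2)" if "z \<in> J" for z
    unfolding sq by (rule summable_power_diagonal[OF that N])
  note CS = suminf_Cauchy_Schwarz[OF s[OF x] s[OF y], unfolded pr sq]
  show "summable (\<lambda>k. \<bar>w k ^ N * (\<phi> k x * \<phi> k y)\<bar>)" by (rule CS)
  show "(G N x y)\<^sup>2 \<le> G N x x * G N y y" using CS(2) by (simp add: G_def power2_eq_square)
qed

lemma G_sums: "x \<in> J \<Longrightarrow> y \<in> J \<Longrightarrow> 1 \<le> N \<Longrightarrow> (\<lambda>k. w k ^ N * (\<phi> k x * \<phi> k y)) sums G N x y"
  unfolding G_def by (intro summable_sums summable_rabs_cancel[OF summable_G_abs])

lemma G_sym: "G N x y = G N y x"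
  by (simp add: G_def mult.commute[of "\<phi> _ x"])

text \<open>Off the diagonal the terms change sign and are integrated one by one by absolute
  convergence, which rests on the diagonal bound. Nonnegativity is inherited from \<open>q\<close>;
  the series does not show it.\<close>

lemma
  assumes x: "x \<in> J" and y: "y \<in> J"
  shows G_nonneg: "0 \<le> G 1 x y" and green_eq_G: "green x y = ennreal (G 1 x y)"
proof -
  define F where "F k t = \<phi> k x * \<phi> k y * (exp (- ((1 + lam k) * t)) * indicator {0..} t)" for k and t :: real
  have int: "integrable lborel (F k)" for k
    unfolding F_def by (intro integrable_mult_right integrable_exp_kernel)
  have intF: "(\<integral>t. F k t \<partial>lborel) = w k ^ 1 * (\<phi> k x * \<phi> k y)" for k
    unfolding F_def by (simp add: integral_exp_kernel)
  have normF: "(\<integral>t. norm (F k t) \<partial>lborel) = \<bar>w k ^ 1 * (\<phi> k x * \<phi> k y)\<bar>" for k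
  proof -
    have "(\<integral>t. norm (F k t) \<partial>lborel) = (\<integral>t. \<bar>\<phi> k x * \<phi> k y\<bar> * (exp (- ((1 + lam k) * t)) * indicator {0..} t) \<partial>lborel)"
      by (simp add: F_def abs_mult)
    then show ?thesis using w_pos[of k] by (simp add: integral_exp_kernel abs_mult)
  qed
  have F_sums: "(\<lambda>k. F k t) sums (exp (- t) * Q t x y)" "summable (\<lambda>k. norm (F k t))" if "0 < t" for t
  proof -
    have F: "F k t = exp (- t) * (exp (- lam k * t) * \<phi> k x * \<phi> k y)" for k
      using that unfolding F_def exp_kernel_split by simp
    show "(\<lambda>k. F k t) sums (exp (- t) * Q t x y)"
      unfolding F Q_def using that by (simp only: if_True) (intro sums_mult q_sums that x y)
    have "norm (F k t) = exp (- t) * (exp (- lam k * t) * \<bar>\<phi> k x * \<phi> k y\<bar>)" for k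
      unfolding F by (simp add: abs_mult)
    then show "summable (\<lambda>k. norm (F k t))"
      using summable_mult[OF q_summable_abs[OF that x y], of "exp (- t)"] by simp
  qed
  have F_neg: "F k t = 0" if "t < 0" for k t using that by (simp add: F_def)
  have AE_sum: "AE t in lborel. summable (\<lambda>k. norm (F k t))"
    using AE_lborel_singleton[of 0]
  proof eventually_elim
    case (elim t)
    then show ?case using F_sums(2)[of t] F_neg[of t] by (cases "0 < t") auto
  qed
  have sumF: "summable (\<lambda>k. \<integral>t. norm (F k t) \<partial>lborel)"
    unfolding normF by (rule summable_G_abs[OF x y]) simp
  have I: "integrable lborel (\<lambda>t. \<Sum>k. F k t)"
    by (rule integrable_suminf[OF int AE_sum sumF])
  have E: "(\<integral>t. (\<Sum>k. F k t) \<partial>lborel) = G 1 x y"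
    using integral_suminf[OF int AE_sum sumF] by (simp only: intF G_def)
  have AE_eq: "AE t in lborel. exp_weight t * ennreal (Q t x y) = ennreal (\<Sum>k. F k t) \<and> 0 \<le> (\<Sum>k. F k t)"
    using AE_lborel_singleton[of 0]
  proof eventually_elim
    case (elim t)
    show ?case
    proof (cases "0 < t")
      case True
      have "0 \<le> Q t x y" using True x y by (simp add: Q_def q_nonneg)
      moreover have "(\<Sum>k. F k t) = exp (- t) * Q t x y"
        by (rule sums_unique[OF F_sums(1)[OF True], symmetric])
      ultimately show ?thesis using True by (simp add: exp_weight_def ennreal_mult')
    next
      case False
      then show ?thesis using elim F_neg[of t] by (simp add: exp_weight_def)
    qed
  qed
  have "0 \<le> (\<integral>t. (\<Sum>k. F k t) \<partial>lborel)"
    using AE_eq by (intro integral_nonneg_AE) auto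
  then show "0 \<le> G 1 x y" by (simp only: E)
  have "green x y = (\<integral>\<^sup>+t. ennreal (\<Sum>k. F k t) \<partial>lborel)"
    unfolding green_def using AE_eq by (intro nn_integral_cong_AE) auto
  also have "\<dots> = ennreal (\<integral>t. (\<Sum>k. F k t) \<partial>lborel)"
    using AE_eq by (intro nn_integral_eq_integral I) auto
  finally show "green x y = ennreal (G 1 x y)" by (simp only: E)
qed

lemma G_pos:
  assumes x: "x \<in> J"
  shows "0 < G 1 x x"
proof -
  obtain k where k: "\<phi> k x \<noteq> 0" using \<phi>_nonvanishing[OF x] ..
  have "(\<Sum>j\<in>{k}. w j * (\<phi> j x)\<^sup>2) \<le> (\<Sum>j. w j * (\<phi> j x)\<^sup>2)"
    by (intro sum_le_suminf summable_diagonal x) (auto simp: w_nonneg)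
  moreover have "0 < w k * (\<phi> k x)\<^sup>2" using k w_pos by simp
  ultimately show ?thesis by (simp add: G_def power2_eq_square)
qed

end

section \<open>Left continuity and multiplicativity of the real kernel\<close>

context discrete_diffusion
begin

text \<open>By Cauchy-Schwarz the squared tail of the series is at most the diagonal tail at
  \<open>x\<close>, which tends to 0, times the diagonal value at \<open>y\<close>, bounded on the
  interval. So convergence is uniform in \<open>y\<close>, on an interval that is the same for all
  \<open>x\<close>.\<close>

lemma G_left_continuous:
  assumes z0: "z0 \<in> J"
  obtains u where "u \<in> J" "u < z0" "\<And>x. x \<in> J \<Longrightarrow> continuous_on {u..z0} (G 1 x)"
proof -
  obtain u K' where u: "u \<in> J" "u < z0" and K': "\<And>z. u \<le> z \<Longrightarrow> z \<le> z0 \<Longrightarrow> green z z \<le> ennreal K'"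
    by (rule green_diagonal_bound[OF z0]) blast
  \<comment> \<open>\<open>K'\<close> might be negative, as \<open>ennreal\<close> sends negative
    numbers to 0.\<close>
  define K where "K = max K' 0"
  have inJ: "y \<in> J" if "y \<in> {u..z0}" for y using between_in_J[OF u(1) z0] that by auto
  have K: "(\<Sum>k. w k * (\<phi> k y)\<^sup>2) \<le> K" if "y \<in> {u..z0}" for y
  proof (rule suminf_diagonal_le[OF inJ[OF that]])
    have "green y y \<le> ennreal K'" using that by (intro K') auto
    also have "\<dots> \<le> ennreal K" by (intro ennreal_leI) (simp add: K_def)
    finally show "green y y \<le> ennreal K" .
  qed (simp add: K_def)
  have "continuous_on {u..z0} (G 1 x)" if x: "x \<in> J" for x
  proof (rule uniform_limit_theorem)
    show "uniform_limit {u..z0} (\<lambda>N y. \<Sum>k<N. w k ^ 1 * (\<phi> k x * \<phi> k y)) (G 1 x) sequentially"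
    proof (rule uniform_limitI)
      fix e :: real assume e: "0 < e"
      have "(\<lambda>N. \<Sum>i. w (i + N) * (\<phi> (i + N) x)\<^sup>2) \<longlonglongrightarrow> 0"
        by (rule suminf_exist_split2[OF summable_diagonal[OF x]])
      then have "(\<lambda>N. (\<Sum>i. w (i + N) * (\<phi> (i + N) x)\<^sup>2) * K) \<longlonglongrightarrow> 0 * K"
        by (intro tendsto_mult tendsto_const)
      then have "\<forall>\<^sub>F N in sequentially. (\<Sum>i. w (i + N) * (\<phi> (i + N) x)\<^sup>2) * K < e\<^sup>2"
        using e by (intro order_tendstoD) auto
      then show "\<forall>\<^sub>F N in sequentially. \<forall>y\<in>{u..z0}. dist (\<Sum>k<N. w k ^ 1 * (\<phi> k x * \<phi> k y)) (G 1 x y) < e"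
      proof eventually_elim
        case (elim N)
        show ?case
        proof
          fix y assume y: "y \<in> {u..z0}"
          let ?a = "\<lambda>s i. sqrt (w (i + N)) * \<phi> (i + N) s"
          have sq: "(?a s i)\<^sup>2 = w (i + N) * (\<phi> (i + N) s)\<^sup>2" for s i
            using w_nonneg by (simp add: power_mult_distrib)
          have s: "summable (\<lambda>i. (?a s i)\<^sup>2)" if "s \<in> J" for s
            unfolding sq by (rule summable_ignore_initial_segment[OF summable_diagonal[OF that]])
          have pr: "?a x i * ?a y i = w (i + N) * (\<phi> (i + N) x * \<phi> (i + N) y)" for i
            using real_sqrt_mult_self[of "w (i + N)"] w_nonneg[of "i + N"] by (simp add: mult.assoc mult.left_commute flip: mult.assoc)
          have "G 1 x y - (\<Sum>k<N. w k ^ 1 * (\<phi> k x * \<phi> k y)) = (\<Sum>i. ?a x i * ?a y i)"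
            using suminf_minus_initial_segment[OF sums_summable[OF G_sums[OF x inJ[OF y], of 1]], of N]
            by (simp add: pr G_def)
          then have "(G 1 x y - (\<Sum>k<N. w k ^ 1 * (\<phi> k x * \<phi> k y)))\<^sup>2
              \<le> (\<Sum>i. w (i + N) * (\<phi> (i + N) x)\<^sup>2) * (\<Sum>i. w (i + N) * (\<phi> (i + N) y)\<^sup>2)"
            using suminf_Cauchy_Schwarz(2)[OF s[OF x] s[OF inJ[OF y]], unfolded sq] by simp
          also have "\<dots> \<le> (\<Sum>i. w (i + N) * (\<phi> (i + N) x)\<^sup>2) * K"
          proof (rule mult_left_mono)
            have "(\<Sum>i. w (i + N) * (\<phi> (i + N) y)\<^sup>2) \<le> (\<Sum>k. w k * (\<phi> k y)\<^sup>2)"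
              unfolding suminf_minus_initial_segment[OF summable_diagonal[OF inJ[OF y]]]
              by (simp add: sum_nonneg w_nonneg)
            then show "(\<Sum>i. w (i + N) * (\<phi> (i + N) y)\<^sup>2) \<le> K" using K[OF y] by linarith
            show "0 \<le> (\<Sum>i. w (i + N) * (\<phi> (i + N) x)\<^sup>2)"
              by (intro suminf_nonneg summable_ignore_initial_segment[OF summable_diagonal[OF x]]) (simp add: w_nonneg)
          qed
          also have "\<dots> < e\<^sup>2" by (rule elim)
          finally have "\<bar>G 1 x y - (\<Sum>k<N. w k ^ 1 * (\<phi> k x * \<phi> k y))\<bar> < e"
            using e by (metis abs_of_pos power2_abs power2_less_imp_less abs_ge_zero less_imp_le)
          then show "dist (\<Sum>k<N. w k ^ 1 * (\<phi> k x * \<phi> k y)) (G 1 x y) < e"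
            by (simp add: dist_real_def abs_minus_commute)
        qed
      qed
    qed
    have c: "continuous_on {u..z0} (\<phi> k)" for k
      using continuous_\<phi> by (rule continuous_on_subset) (use inJ in auto)
    show "\<forall>\<^sub>F N in sequentially. continuous_on {u..z0} (\<lambda>y. \<Sum>k<N. w k ^ 1 * (\<phi> k x * \<phi> k y))"
      by (intro always_eventually allI continuous_on_sum continuous_on_mult continuous_on_const c)
  qed simp
  then show ?thesis using that u by blast
qed

text \<open>Equality of integrals over all sets above \<open>z\<close> makes two densities equal
  almost everywhere, and left continuity reaches every \<open>y\<close> strictly above
  \<open>z\<close>. The factor \<open>p\<close> is independent of \<open>y\<close>, so it can be
  eliminated between two targets.\<close>

lemma G_transfer:
  assumes x: "x \<in> J" and z: "z \<in> J" "x < z"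
  obtains p where "\<And>y. y \<in> J \<Longrightarrow> z < y \<Longrightarrow> G 1 x y = p * G 1 z y"
proof -
  obtain \<psi> where \<psi>: "\<psi> \<le> 1"
    "\<And>B. B \<in> sets M \<Longrightarrow> B \<subseteq> {z..} \<Longrightarrow> (\<integral>\<^sup>+y\<in>B. green x y \<partial>M) = \<psi> * (\<integral>\<^sup>+y\<in>B. green z y \<partial>M)"
    by (rule green_strong_markov[OF x z]) blast
  define p where "p = enn2real \<psi>"
  have p: "\<psi> = ennreal p" "0 \<le> p"
    using \<psi>(1) by (auto simp: p_def le_less_trans)
  note [measurable] = green_measurable1[OF x] green_measurable1[OF z(1)] id_M
  have Z[measurable]: "{y \<in> J. z \<le> y} \<in> sets M" using open_J by (auto simp: sets_M_iff intro!: borel_measurable_le)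
  let ?f = "\<lambda>y. green x y * indicator {y \<in> J. z \<le> y} y"
  let ?g = "\<lambda>y. \<psi> * (green z y * indicator {y \<in> J. z \<le> y} y)"
  have mf: "?f \<in> borel_measurable M" and mg: "?g \<in> borel_measurable M" by measurable
  have "density M ?f = density M ?g"
  proof (rule measure_eqI)
    fix A assume "A \<in> sets (density M ?f)"
    then have A[measurable]: "A \<in> sets M" by simp
    let ?A = "A \<inter> {y \<in> J. z \<le> y}"
    have "emeasure (density M ?f) A = (\<integral>\<^sup>+y\<in>?A. green x y \<partial>M)"
      using mf A by (subst emeasure_density) (auto intro!: nn_integral_cong split: split_indicator)
    also have "\<dots> = \<psi> * (\<integral>\<^sup>+y\<in>?A. green z y \<partial>M)" using A Z by (intro \<psi>(2)) auto
    also have "\<dots> = (\<integral>\<^sup>+y. \<psi> * (green z y * indicator ?A y) \<partial>M)"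
      by (rule nn_integral_cmult[symmetric]) measurable
    also have "\<dots> = emeasure (density M ?g) A"
      using mg A by (subst emeasure_density) (auto intro!: nn_integral_cong split: split_indicator)
    finally show "emeasure (density M ?f) A = emeasure (density M ?g) A" .
  qed simp
  then have "AE y in M. ?f y = ?g y" by (rule M.density_unique[OF mf mg])
  then have AE: "AE y in M. z \<le> y \<longrightarrow> G 1 x y = p * G 1 z y"
    using AE_space
  proof eventually_elim
    case (elim y)
    then have y: "y \<in> J" by (simp add: space_M)
    show ?case
    proof
      assume "z \<le> y"
      then have "ennreal (G 1 x y) = ennreal p * ennreal (G 1 z y)"
        using elim(1) y by (simp add: green_eq_G x z p(1))
      then show "G 1 x y = p * G 1 z y"
        using p(2) G_nonneg[OF x y] G_nonneg[OF z(1) y] by (simp flip: ennreal_mult)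
    qed
  qed
  show ?thesis
  proof (rule that[of p])
    fix y assume y: "y \<in> J" "z < y"
    obtain u where u: "u \<in> J" "u < y" "\<And>x. x \<in> J \<Longrightarrow> continuous_on {u..y} (G 1 x)"
      by (rule G_left_continuous[OF y(1)]) blast
    \<comment> \<open>A left neighbourhood of \<open>y\<close> with both continuity and the
      identity, which is known above \<open>z\<close> only.\<close>
    let ?u = "max u z"
    have uJ: "?u \<in> J" using u(1) z(1) by (simp add: max_def)
    have c: "continuous_on {?u..y} (G 1 x)" if "x \<in> J" for x
      using u(3)[OF that] by (rule continuous_on_subset) auto
    show "G 1 x y = p * G 1 z y"
    proof (rule agree_at_left_limit[of ?u y "G 1 x" "\<lambda>y. p * G 1 z y"])
      show "continuous_on {?u..y} (G 1 x)" by (rule c[OF x])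
      show "continuous_on {?u..y} (\<lambda>y. p * G 1 z y)"
        by (intro continuous_on_mult continuous_on_const c z)
      show "?u < y" using u y by simp
      fix v assume v: "?u \<le> v" "v < y"
      then have "v \<in> J" using between_in_J[OF uJ y(1), of v] by simp
      from AE_M_dense[OF AE this y(1) v(2)]
      obtain s where "v < s" "s < y" "z \<le> s \<longrightarrow> G 1 x s = p * G 1 z s" by blast
      then show "\<exists>s. v < s \<and> s < y \<and> G 1 x s = p * G 1 z s" using v by (intro exI[of _ s]) auto
    qed
  qed
qed

text \<open>\<open>G_transfer\<close> at \<open>z\<close> does not cover the target \<open>z\<close>
  itself. It is applied at \<open>s < z\<close> for the targets \<open>z\<close> and
  \<open>y\<close>; eliminating its factor gives the claim with one \<open>z\<close> on each side
  replaced by \<open>s\<close>, and \<open>s\<close> tends to \<open>z\<close> from the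
  left.\<close>

lemma G_multiplicative:
  assumes x: "x \<in> J" and y: "y \<in> J" and z: "z \<in> J" and le: "x \<le> z" "z \<le> y"
  shows "G 1 x y * G 1 z z = G 1 x z * G 1 z y"
proof (cases "x = z \<or> z = y")
  case True
  then show ?thesis by auto
next
  case False
  with le have lt: "x < z" "z < y" by auto
  obtain u where u: "u \<in> J" "u < z" "\<And>x. x \<in> J \<Longrightarrow> continuous_on {u..z} (G 1 x)"
    by (rule G_left_continuous[OF z]) blast
  let ?u = "max u x"
  have uJ: "?u \<in> J" using u(1) x by (simp add: max_def)
  have c: "continuous_on {?u..z} (G 1 x)" if "x \<in> J" for x
    using u(3)[OF that] by (rule continuous_on_subset) auto
  show ?thesis
  proof (rule agree_at_left_limit[of ?u z "\<lambda>s. G 1 x y * G 1 z s" "\<lambda>s. G 1 x z * G 1 y s", unfolded G_sym[of 1 y z]])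
    show "continuous_on {?u..z} (\<lambda>s. G 1 x y * G 1 z s)" "continuous_on {?u..z} (\<lambda>s. G 1 x z * G 1 y s)"
      by (intro continuous_on_mult continuous_on_const c z y)+
    show "?u < z" using u lt by simp
    fix v assume v: "?u \<le> v" "v < z"
    obtain s where s: "v < s" "s < z" using dense v(2) by blast
    then have sJ: "s \<in> J" using between_in_J[OF uJ z, of s] v by simp
    have "x < s" using s v by simp
    obtain p where p: "\<And>y. y \<in> J \<Longrightarrow> s < y \<Longrightarrow> G 1 x y = p * G 1 s y"
      by (rule G_transfer[OF x sJ \<open>x < s\<close>]) blast
    have "G 1 x y * G 1 z s = G 1 x z * G 1 y s"
      unfolding p[OF y less_trans[OF s(2) lt(2)]] p[OF z s(2)] G_sym[of 1 z s] G_sym[of 1 y s] by (simp add: mult_ac)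
    then show "\<exists>s. v < s \<and> s < z \<and> G 1 x y * G 1 z s = G 1 x z * G 1 y s" using s by blast
  qed
qed

lemma det_G_nonneg:
  assumes "\<And>i. i < n \<Longrightarrow> x i \<in> J" "\<And>i j. i < j \<Longrightarrow> j < n \<Longrightarrow> x i \<le> x j"
    and "\<And>i. i < n \<Longrightarrow> y i \<in> J" "\<And>i j. i < j \<Longrightarrow> j < n \<Longrightarrow> y i \<le> y j"
  shows "0 \<le> alternant n (\<lambda>i. G 1 (x i)) y"
  unfolding alternant_def
proof (rule det_green_kernel_nonneg[of J "G 1"])
  show "(G 1 x y)\<^sup>2 \<le> G 1 x x * G 1 y y" if "x \<in> J" "y \<in> J" for x y
    using that by (rule G_Cauchy_Schwarz) simp
  show "G 1 x y = G 1 y x" for x y by (rule G_sym)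
  show "0 \<le> G 1 x y" if "x \<in> J" "y \<in> J" for x y using that by (rule G_nonneg)
  show "0 < G 1 x x" if "x \<in> J" for x using that by (rule G_pos)
  show "G 1 x y * G 1 z z = G 1 x z * G 1 z y" if "x \<in> J" "y \<in> J" "z \<in> J" "x \<le> z" "z \<le> y" for x y z
    using that by (rule G_multiplicative)
qed (rule assms; assumption)+

lemma expands_G:
  assumes x: "x \<in> J" and N: "1 \<le> N"
  shows "expands (G N x) (\<lambda>k. w k ^ N * \<phi> k x)"
proof (rule expands_pointwise_limit)
  show "summable (\<lambda>k. (w k ^ N * \<phi> k x)\<^sup>2)"
    using summable_power_diagonal[OF x, of "2 * N"] N by (simp add: power_mult_distrib power_mult mult.commute[of 2])
  show "(\<lambda>k. w k ^ N * \<phi> k x * \<phi> k y) sums G N x y" if "y \<in> space M" for y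
    using G_sums[OF x _ N] that by (simp add: space_M mult.assoc)
qed

lemma expands_q:
  assumes t: "0 < t" and x: "x \<in> J"
  shows "expands (q t x) (\<lambda>k. exp (- lam k * t) * \<phi> k x)"
proof (rule expands_pointwise_limit)
  have "(exp (- lam k * t) * \<phi> k x)\<^sup>2 = exp (- lam k * (2 * t)) * \<phi> k x * \<phi> k x" for k
    using exp_double[of "- lam k * t"] by (simp add: power_mult_distrib power2_eq_square mult_ac)
  then show "summable (\<lambda>k. (exp (- lam k * t) * \<phi> k x)\<^sup>2)"
    using sums_summable[OF q_sums[of "2 * t" x x]] t x by simp
  show "(\<lambda>k. exp (- lam k * t) * \<phi> k x * \<phi> k y) sums q t x y" if "y \<in> space M" for y
    using q_sums[OF t x] that by (simp add: space_M)
qed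

text \<open>In the eigenbasis composition of kernels multiplies the coefficients
  \<open>w k ^ N\<close> and \<open>w k\<close>.\<close>

lemma integral_G_mult_G:
  assumes x: "x \<in> J" and y: "y \<in> J" and N: "1 \<le> N"
  shows "(\<integral>s. G N x s * G 1 y s \<partial>M) = G (Suc N) x y"
proof -
  have "(\<lambda>k. w k ^ 1 * \<phi> k y * coef (G N x) k) sums (\<integral>s. G N x s * G 1 y s \<partial>M)"
    using expands_G[OF x N] by (intro expands_sums_integral expands_G y) (auto simp: expands_def)
  moreover have "(\<lambda>k. w k ^ 1 * \<phi> k y * coef (G N x) k) = (\<lambda>k. w k ^ Suc N * (\<phi> k x * \<phi> k y))"
    by (simp add: expands_coef[OF expands_G[OF x N]] mult_ac)
  ultimately show ?thesis using G_sums[OF x y, of "Suc N"] by (simp add: sums_unique2)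
qed

end

section \<open>The ground state\<close>

lemma alternant_cong:
  "(\<And>i j. i < n \<Longrightarrow> j < n \<Longrightarrow> u i (x j) = v i (y j)) \<Longrightarrow> alternant n u x = alternant n v y"
  unfolding alternant_def by (rule arg_cong[of _ _ Determinant.det]) (auto intro!: eq_matI)

locale killed_diffusions = discrete_diffusion + chamber: weyl_product M n for n +
  assumes n_pos: "1 \<le> n"
begin

abbreviation "eigen s \<equiv> alternant n (\<lambda>i. \<phi> (tuple n s i))"

sublocale H: l2_total "chamber_measure n M" eigen
  by (rule chamber.l2_total_alternants[OF l2_total_axioms n_pos])

lemma in_chamber_iff:
  "x \<in> chamber.W \<longleftrightarrow> x \<in> {..<n} \<rightarrow>\<^sub>E J \<and> (\<forall>i j. i < j \<and> j < n \<longrightarrow> x i \<le> x j)"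
  by (simp add: weyl_chamber_def space_M)

lemma in_chamberD: "x \<in> chamber.W \<Longrightarrow> i < n \<Longrightarrow> x i \<in> J"
  by (auto simp: in_chamber_iff)

text \<open>One computation for \<open>G N\<close> and \<open>q t\<close>, both diagonal in the
  eigenbasis: Andreief's identity reduces the coefficient to a determinant whose row
  \<open>i\<close> carries the factor \<open>c (tuple n s i)\<close>.\<close>

lemma alternant_expands:
  assumes x: "x \<in> chamber.W" and F: "\<And>z. z \<in> J \<Longrightarrow> expands (F z) (\<lambda>k. c k * \<phi> k z)"
  shows "alternant n (\<lambda>i. F (x i)) \<in> L2 (chamber_measure n M)"
    and "H.coef (alternant n (\<lambda>i. F (x i))) s = (\<Prod>i<n. c (tuple n s i)) * eigen s x"
proof -
  have FL: "F (x i) \<in> L2 M" if "i < n" for i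
    using F[OF in_chamberD[OF x that]] by (simp add: expands_def)
  show "alternant n (\<lambda>i. F (x i)) \<in> L2 (chamber_measure n M)"
    by (intro chamber.L2_restrict_chamM chamber.L2_alternant FL)
  have "H.coef (alternant n (\<lambda>i. F (x i))) s = (\<integral>y. eigen s y * alternant n (\<lambda>i. F (x i)) y \<partial>chamber_measure n M)"
    by (simp add: H.coef_def mult.commute)
  also have "\<dots> = Determinant.det (mat n n (\<lambda>(i, j). \<integral>y. \<phi> (tuple n s i) y * F (x j) y \<partial>M))"
    by (rule chamber.andreief_identity) (auto intro: e_L2 FL)
  also have "\<dots> = Determinant.det (mat n n (\<lambda>(i, j). c (tuple n s i) * \<phi> (tuple n s i) (x j)))"
  proof (rule arg_cong[of _ _ Determinant.det], rule eq_matI)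
    fix i j assume "i < dim_row (mat n n (\<lambda>(i, j). c (tuple n s i) * \<phi> (tuple n s i) (x j)))"
      "j < dim_col (mat n n (\<lambda>(i, j). c (tuple n s i) * \<phi> (tuple n s i) (x j)))"
    then show "mat n n (\<lambda>(i, j). \<integral>y. \<phi> (tuple n s i) y * F (x j) y \<partial>M) $$ (i, j)
        = mat n n (\<lambda>(i, j). c (tuple n s i) * \<phi> (tuple n s i) (x j)) $$ (i, j)"
      using expands_coef[OF F[OF in_chamberD[OF x]], of j "tuple n s i"]
      by (simp add: coef_def mult.commute)
  qed auto
  also have "\<dots> = (\<Prod>i<n. c (tuple n s i)) * eigen s x"
    unfolding det_mat_eq_sum alternant_eq_sum by (simp add: prod.distrib sum_distrib_left mult_ac)
  finally show "H.coef (alternant n (\<lambda>i. F (x i))) s = (\<Prod>i<n. c (tuple n s i)) * eigen s x" .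
qed

text \<open>Andreief's identity in its role as continuous Cauchy-Binet formula: the determinant
  kernel of a composition is the composition of the determinant kernels.\<close>

lemma alternant_G_Suc:
  assumes x: "x \<in> chamber.W" and y: "y \<in> chamber.W" and N: "1 \<le> N"
  shows "alternant n (\<lambda>i. G (Suc N) (x i)) y
    = (\<integral>s. alternant n (\<lambda>i. G N (x i)) s * alternant n (\<lambda>i. G 1 (y i)) s \<partial>chamber_measure n M)"
proof -
  have "(\<integral>s. alternant n (\<lambda>i. G N (x i)) s * alternant n (\<lambda>i. G 1 (y i)) s \<partial>chamber_measure n M)
    = Determinant.det (mat n n (\<lambda>(i, j). \<integral>s. G N (x i) s * G 1 (y j) s \<partial>M))"
    using expands_G[OF in_chamberD[OF x] N] expands_G[OF in_chamberD[OF y] order_refl]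
    by (intro chamber.andreief_identity) (auto simp: expands_def)
  also have "\<dots> = alternant n (\<lambda>i. G (Suc N) (x i)) y"
    unfolding alternant_def
    using integral_G_mult_G[OF in_chamberD[OF x] in_chamberD[OF y] N]
    by (intro arg_cong[of _ _ Determinant.det] eq_matI) auto
  finally show ?thesis by simp
qed

text \<open>Total positivity of \<open>G 1\<close> is the base case; the induction step integrates a
  product of two nonnegative functions over the chamber.\<close>

lemma alternant_G_nonneg:
  assumes "x \<in> chamber.W" "y \<in> chamber.W" "1 \<le> N"
  shows "0 \<le> alternant n (\<lambda>i. G N (x i)) y"
  using assms(3,1,2)
proof (induction N arbitrary: x y rule: dec_induct)
  case base
  then show ?case by (intro det_G_nonneg) (auto simp: in_chamber_iff)
next
  case (step N)
  have "0 \<le> alternant n (\<lambda>i. G 1 (y i)) s" if "s \<in> chamber.W" for s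
    using that step.prems by (intro det_G_nonneg) (auto simp: in_chamber_iff)
  then have "AE s in chamber_measure n M. 0 \<le> alternant n (\<lambda>i. G N (x i)) s * alternant n (\<lambda>i. G 1 (y i)) s"
    using step by (intro AE_I2 mult_nonneg_nonneg) (auto simp only: chamber.space_chamM)
  then show ?case
    unfolding alternant_G_Suc[OF step.prems step.hyps(1)] by (rule integral_nonneg_AE)
qed

section \<open>The leading tuple\<close>

definition \<rho> :: "nat \<Rightarrow> real" where "\<rho> s = (\<Prod>i<n. w (tuple n s i))"

definition s0 :: nat where "s0 = (SOME s. tuple n s = (\<lambda>i\<in>{..<n}. i))"

lemma tuple_s0: "i < n \<Longrightarrow> tuple n s0 i = i"
proof -
  have "(\<lambda>i\<in>{..<n}. i) \<in> increasing_tuples n" by (auto simp: increasing_tuples_def)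
  then have "(\<lambda>i\<in>{..<n}. i) \<in> range (tuple n)"
    using bij_betw_imp_surj_on[OF bij_betw_tuple[OF n_pos]] by simp
  then have "\<exists>s. tuple n s = (\<lambda>i\<in>{..<n}. i)" by (metis imageE)
  then have "tuple n s0 = (\<lambda>i\<in>{..<n}. i)" unfolding s0_def by (rule someI_ex)
  then show "i < n \<Longrightarrow> tuple n s0 i = i" by simp
qed

lemma eigen_s0: "eigen s0 x = alternant n \<phi> x"
  by (intro alternant_cong) (simp add: tuple_s0)

lemma \<rho>_pos: "0 < \<rho> s"
  unfolding \<rho>_def by (intro prod_pos) (simp add: w_pos)

text \<open>The tuple dominates \<open>0, ..., n - 1\<close> entrywise, strictly in some entry, and
  \<open>w\<close> is positive and strictly decreasing. Strictness excludes ties, so exactly one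
  term survives in the limit.\<close>

lemma \<rho>_less:
  assumes "s \<noteq> s0"
  shows "\<rho> s < \<rho> s0"
proof -
  have "\<exists>i<n. tuple n s i \<noteq> i"
  proof (rule ccontr)
    assume "\<not> (\<exists>i<n. tuple n s i \<noteq> i)"
    then have "tuple n s ` {..<n} = tuple n s0 ` {..<n}" using tuple_s0 by auto
    then show False using assms tuple_eq_iff[OF n_pos] by simp
  qed
  then obtain i where i: "i < n" "i < tuple n s i"
    using tuple_ge[OF n_pos] by (metis le_neq_implies_less)
  have le: "w (tuple n s j) \<le> w j" if "j < n" for j
    using tuple_ge[OF n_pos that, of s] w_less[of j "tuple n s j"] by (cases "j = tuple n s j") auto
  have "\<rho> s = w (tuple n s i) * (\<Prod>j\<in>{..<n} - {i}. w (tuple n s j))"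
    unfolding \<rho>_def using i by (intro prod.remove) auto
  also have "\<dots> \<le> w (tuple n s i) * (\<Prod>j\<in>{..<n} - {i}. w j)"
    using le by (intro mult_left_mono prod_mono) (auto simp: w_nonneg)
  also have "\<dots> < w i * (\<Prod>j\<in>{..<n} - {i}. w j)"
    using i(2) w_pos by (intro mult_strict_right_mono w_less prod_pos) auto
  also have "\<dots> = (\<Prod>j<n. w j)" using i by (intro prod.remove[symmetric]) auto
  also have "\<dots> = \<rho> s0" unfolding \<rho>_def by (intro prod.cong) (auto simp: tuple_s0)
  finally show ?thesis .
qed

text \<open>The leading term, as \<open>N\<close> tends to infinity, of the nonnegative determinants \<open>det (G N (x i) (y j))\<close>.\<close>

lemma alternant_sign:
  assumes x: "x \<in> chamber.W" and y: "y \<in> chamber.W"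
  shows "0 \<le> alternant n \<phi> x * alternant n \<phi> y"
proof -
  have coefs: "H.coef (alternant n (\<lambda>i. G N (z i))) s = \<rho> s ^ N * eigen s z"
    if "z \<in> chamber.W" "1 \<le> N" for N z s
    using alternant_expands(2)[OF that(1), of "G N" "\<lambda>k. w k ^ N" s] expands_G[OF _ that(2)]
    by (simp add: \<rho>_def prod_power_distrib)
  have L2: "alternant n (\<lambda>i. G N (z i)) \<in> L2 (chamber_measure n M)" if "z \<in> chamber.W" "1 \<le> N" for N z
    using alternant_expands(1)[OF that(1), of "G N" "\<lambda>k. w k ^ N"] expands_G[OF _ that(2)] by blast
  \<comment> \<open>The extra factor \<open>\<rho> s\<close> stems from the single
    \<open>G 1\<close> in \<open>alternant_G_Suc\<close>.\<close>
  define c where "c s = \<rho> s * eigen s x * eigen s y" for s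
  let ?a = "\<lambda>s N. (\<rho> s / \<rho> s0) ^ N * c s"
  have sums: "(\<lambda>s. \<rho> s ^ N * c s) sums alternant n (\<lambda>i. G (Suc N) (x i)) y" if "1 \<le> N" for N
  proof -
    have "(\<lambda>s. H.coef (alternant n (\<lambda>i. G N (x i))) s * H.coef (alternant n (\<lambda>i. G 1 (y i))) s)
        sums alternant n (\<lambda>i. G (Suc N) (x i)) y"
      unfolding alternant_G_Suc[OF x y that] by (intro H.parseval L2 x y that order_refl)
    then show ?thesis
      unfolding coefs[OF x that] coefs[OF y order_refl] by (simp add: c_def mult_ac)
  qed
  have nonneg: "0 \<le> (\<Sum>s. ?a s N)" if "1 \<le> N" for N
  proof -
    have "(\<lambda>s. (1 / \<rho> s0) ^ N * (\<rho> s ^ N * c s)) sums ((1 / \<rho> s0) ^ N * alternant n (\<lambda>i. G (Suc N) (x i)) y)"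
      by (intro sums_mult sums that)
    moreover have "(\<lambda>s. (1 / \<rho> s0) ^ N * (\<rho> s ^ N * c s)) = (\<lambda>s. ?a s N)"
      by (simp add: power_divide)
    ultimately have "(\<Sum>s. ?a s N) = (1 / \<rho> s0) ^ N * alternant n (\<lambda>i. G (Suc N) (x i)) y"
      by (simp add: sums_iff)
    also have "0 \<le> \<dots>"
      using \<rho>_pos by (intro mult_nonneg_nonneg alternant_G_nonneg x y) (auto intro: less_imp_le)
    finally show ?thesis .
  qed
  \<comment> \<open>The terms for \<open>N = 1\<close> are absolutely summable and dominate those of
    all later \<open>N\<close>, because the ratios \<open>\<rho> s / \<rho> s0\<close> are at most
    1.\<close>
  have "summable (\<lambda>s. \<bar>H.coef (alternant n (\<lambda>i. G 1 (x i))) s * H.coef (alternant n (\<lambda>i. G 1 (y i))) s\<bar>)"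
    by (intro suminf_Cauchy_Schwarz(1) H.bessel L2 x y order_refl)
  then have "summable (\<lambda>s. (1 / \<rho> s0) * \<bar>H.coef (alternant n (\<lambda>i. G 1 (x i))) s * H.coef (alternant n (\<lambda>i. G 1 (y i))) s\<bar>)"
    by (rule summable_mult)
  moreover have eq: "(1 / \<rho> s0) * \<bar>H.coef (alternant n (\<lambda>i. G 1 (x i))) s * H.coef (alternant n (\<lambda>i. G 1 (y i))) s\<bar>
      = \<bar>\<rho> s / \<rho> s0 * c s\<bar>" for s
    unfolding coefs[OF x order_refl] coefs[OF y order_refl]
    using \<rho>_pos[of s] \<rho>_pos[of s0] by (simp add: c_def abs_mult mult_ac)
  ultimately have summ: "summable (\<lambda>s. \<bar>\<rho> s / \<rho> s0 * c s\<bar>)" by (simp only: eq)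
  have ratio: "0 \<le> \<rho> s / \<rho> s0" "\<rho> s / \<rho> s0 \<le> 1" for s
    using \<rho>_less[of s] \<rho>_pos[of s] \<rho>_pos[of s0] by (cases "s = s0"; simp)+
  have lim: "(\<lambda>N. ?a s N) \<longlonglongrightarrow> (if s = s0 then c s0 else 0)" for s
  proof (cases "s = s0")
    case True
    then show ?thesis using \<rho>_pos[of s0] by simp
  next
    case False
    then have "\<rho> s / \<rho> s0 < 1" using \<rho>_less[OF False] \<rho>_pos[of s0] by simp
    then have "(\<lambda>N. ?a s N) \<longlonglongrightarrow> 0 * c s"
      using ratio by (intro tendsto_mult_right LIMSEQ_realpow_zero)
    then show ?thesis using False by simp
  qed
  have le: "norm (?a s N) \<le> \<bar>\<rho> s / \<rho> s0 * c s\<bar>" if "1 \<le> N" for s N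
  proof -
    have "(\<rho> s / \<rho> s0) ^ N \<le> (\<rho> s / \<rho> s0) ^ 1" using that ratio by (intro power_decreasing) auto
    then have "(\<rho> s / \<rho> s0) ^ N * \<bar>c s\<bar> \<le> \<rho> s / \<rho> s0 * \<bar>c s\<bar>" by (intro mult_right_mono) auto
    then show ?thesis using ratio(1)[of s] by (simp only: real_norm_def abs_mult abs_of_nonneg zero_le_power)
  qed
  have bound: "\<forall>\<^sub>F (s, N) in sequentially \<times>\<^sub>F sequentially. norm (?a s N) \<le> \<bar>\<rho> s / \<rho> s0 * c s\<bar>"
    unfolding eventually_prod_filter
  proof (rule exI[of _ "\<lambda>_. True"], rule exI[of _ "\<lambda>N. 1 \<le> N"], intro conjI allI impI)
    fix s N :: nat assume "1 \<le> N"
    then show "case (s, N) of (s, N) \<Rightarrow> norm (?a s N) \<le> \<bar>\<rho> s / \<rho> s0 * c s\<bar>"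
      unfolding prod.case by (rule le)
  qed (rule eventually_True eventually_ge_at_top)+
  have "(\<lambda>N. \<Sum>s. ?a s N) \<longlonglongrightarrow> (\<Sum>s. if s = s0 then c s0 else 0)"
    using tannerys_theorem[OF lim bound summ sequentially_bot] by blast
  moreover have "(\<Sum>s. if s = s0 then c s0 else 0) = c s0"
    using sums_single[of s0 "\<lambda>_. c s0"] by (simp add: sums_iff)
  ultimately have "(\<lambda>N. \<Sum>s. ?a s N) \<longlonglongrightarrow> c s0" by simp
  then have "0 \<le> c s0"
    by (rule LIMSEQ_le_const) (use nonneg in blast)
  then show ?thesis
    using \<rho>_pos[of s0] by (simp add: c_def eigen_s0 mult.assoc zero_le_mult_iff)
qed

lemma ground_state:
  "\<exists>\<sigma>\<in>{1, -1}. is_ground_state (chamber_measure n M) (karlin_mcgregor_density n q)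
     (\<lambda>x. \<sigma> * alternant n \<phi> x) (\<Sum>i<n. lam i)"
proof -
  define \<mu> where "\<mu> s = (\<Sum>i<n. lam (tuple n s i))" for s
  have \<mu>0: "\<mu> s0 = (\<Sum>i<n. lam i)" by (simp add: \<mu>_def tuple_s0)
  have km: "karlin_mcgregor_density n q t x = alternant n (\<lambda>i. q t (x i))" for t x
    by (simp add: fun_eq_iff karlin_mcgregor_density_def alternant_def)
  interpret S: l2_spectral_kernel "chamber_measure n M" eigen "karlin_mcgregor_density n q" \<mu> s0
  proof
    fix t :: real and x assume t: "0 < t" and "x \<in> space (chamber_measure n M)"
    then have x: "x \<in> chamber.W" by (simp add: chamber.space_chamM)
    show "karlin_mcgregor_density n q t x \<in> L2 (chamber_measure n M)"
      unfolding km using expands_q[OF t] by (rule alternant_expands(1)[OF x])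
    show "H.coef (karlin_mcgregor_density n q t x) s = exp (- \<mu> s * t) * eigen s x" for s
    proof -
      have "H.coef (alternant n (\<lambda>i. q t (x i))) s = (\<Prod>i<n. exp (- lam (tuple n s i) * t)) * eigen s x"
        using expands_q[OF t] by (rule alternant_expands(2)[OF x])
      also have "(\<Prod>i<n. exp (- lam (tuple n s i) * t)) = exp (- \<mu> s * t)"
        unfolding exp_sum[OF finite_lessThan, symmetric] by (simp add: \<mu>_def sum_negf sum_distrib_right)
      finally show ?thesis unfolding km .
    qed
  next
    show "0 \<le> \<mu> i" for i unfolding \<mu>_def by (intro sum_nonneg lam_nonneg)
    show "\<mu> s0 \<le> \<mu> i" for i
      unfolding \<mu>0 unfolding \<mu>_def using tuple_ge[OF n_pos, of _ i] strict_mono_less_eq[OF lam_mono]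
      by (intro sum_mono) auto
  qed
  have eig: "eigen s0 = alternant n \<phi>" by (rule ext) (rule eigen_s0)
  \<comment> \<open>\<open>alternant_sign\<close> determines products of values only: one positive
    value makes all values nonnegative, and without a positive value all are at most 0.\<close>
  define \<sigma> :: real where "\<sigma> = (if \<exists>x\<in>chamber.W. 0 < alternant n \<phi> x then 1 else -1)"
  have pos: "0 \<le> \<sigma> * alternant n \<phi> x" if x: "x \<in> chamber.W" for x
  proof (cases "\<exists>y\<in>chamber.W. 0 < alternant n \<phi> y")
    case True
    then obtain y where y: "y \<in> chamber.W" "0 < alternant n \<phi> y" by blast
    then show ?thesis using alternant_sign[OF x y(1)] True by (simp add: \<sigma>_def zero_le_mult_iff)
  next
    case False
    then show ?thesis using x by (auto simp: \<sigma>_def not_less)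
  qed
  have \<sigma>: "\<sigma> \<in> {1, -1}" by (simp add: \<sigma>_def)
  have L2: "alternant n \<phi> \<in> L2 (chamber_measure n M)" using H.e_L2[of s0] by (simp only: eig)
  have "is_ground_state (chamber_measure n M) (karlin_mcgregor_density n q) (\<lambda>x. \<sigma> * alternant n \<phi> x) (\<Sum>i<n. lam i)"
    unfolding is_ground_state_def
  proof (intro conjI allI impI ballI)
    show "(\<lambda>x. \<sigma> * alternant n \<phi> x) \<in> L2 (chamber_measure n M)" by (rule L2_cmult[OF L2])
    show "\<not> (AE x in chamber_measure n M. \<sigma> * alternant n \<phi> x = 0)"
    proof
      assume "AE x in chamber_measure n M. \<sigma> * alternant n \<phi> x = 0"
      then have "AE x in chamber_measure n M. eigen s0 x * eigen s0 x = 0"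
        using \<sigma> by (auto simp: eigen_s0 elim!: eventually_mono)
      then have "(\<integral>x. eigen s0 x * eigen s0 x \<partial>chamber_measure n M) = 0" by (rule integral_eq_zero_AE)
      then show False using H.ortho[of s0 s0] by simp
    qed
  next
    fix x assume "x \<in> space (chamber_measure n M)"
    then show "0 \<le> \<sigma> * alternant n \<phi> x" by (intro pos) (simp add: chamber.space_chamM)
  next
    fix t :: real and x assume t: "0 < t" and x: "x \<in> space (chamber_measure n M)"
    show "integrable (chamber_measure n M) (\<lambda>y. karlin_mcgregor_density n q t x y * (\<sigma> * alternant n \<phi> y))"
      by (rule L2_integrable_mult[OF S.p_L2[OF t x] L2_cmult[OF L2]])
    \<comment> \<open>At each \<open>x\<close> this is a coefficient of the kernel itself, so the
      eigenvalue equation holds pointwise and not just almost everywhere.\<close>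
    have "kernel_semigroup (chamber_measure n M) (karlin_mcgregor_density n q) t (\<lambda>x. \<sigma> * alternant n \<phi> x) x
        = \<sigma> * H.coef (karlin_mcgregor_density n q t x) s0"
      by (simp add: kernel_semigroup_def H.coef_def eigen_s0 mult.left_commute)
    then show "kernel_semigroup (chamber_measure n M) (karlin_mcgregor_density n q) t (\<lambda>x. \<sigma> * alternant n \<phi> x) x
        = exp (- (\<Sum>i<n. lam i) * t) * (\<sigma> * alternant n \<phi> x)"
      by (simp add: S.p_coef[OF t x] eigen_s0 \<mu>0)
  next
    show "is_spectral_bottom (chamber_measure n M) (kernel_semigroup (chamber_measure n M) (karlin_mcgregor_density n q)) (\<Sum>i<n. lam i)"
      using S.spectral_bottom by (simp only: \<mu>0)
  qed
  then show ?thesis using \<sigma> by blast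
qed

end

section \<open>The speed measure\<close>

lemma continuous_scale_deriv:
  assumes a: "continuous_on (einterval l r) a" "\<And>x. x \<in> einterval l r \<Longrightarrow> 0 < a x"
    and b: "continuous_on (einterval l r) b" and c: "c \<in> einterval l r"
  shows "continuous_on (einterval l r) (scale_deriv a b c)"
  unfolding continuous_on_eq_continuous_at[OF open_einterval]
proof
  fix x assume x: "x \<in> einterval l r"
  \<comment> \<open>The fundamental theorem of calculus works on a compact interval; this one has
    \<open>c\<close> and \<open>x\<close> in its interior, so that continuity at \<open>x\<close> is
    two-sided.\<close>
  obtain e where e: "0 < e" "ball (min c x) e \<subseteq> einterval l r" "ball (max c x) e \<subseteq> einterval l r"
  proof -
    have "min c x \<in> einterval l r" "max c x \<in> einterval l r" using c x by (auto simp: min_def max_def)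
    then obtain e1 e2 where "0 < e1" "ball (min c x) e1 \<subseteq> einterval l r" "0 < e2" "ball (max c x) e2 \<subseteq> einterval l r"
      using open_einterval open_contains_ball by metis
    then show ?thesis by (intro that[of "min e1 e2"]) auto
  qed
  define u where "u = min c x - e / 2"
  define v where "v = max c x + e / 2"
  have "u \<in> ball (min c x) e" "v \<in> ball (max c x) e" using e(1) by (auto simp: u_def v_def dist_real_def)
  then have uv: "u \<in> einterval l r" "v \<in> einterval l r" using e by auto
  have sub: "{u..v} \<subseteq> einterval l r"
  proof
    fix s assume "s \<in> {u..v}"
    then show "s \<in> einterval l r"
      using uv less_le_trans[of l "ereal u" "ereal s"] le_less_trans[of "ereal s" "ereal v" r]
      by (auto simp: einterval_def)
  qed
  have ab: "continuous_on {u..v} (\<lambda>y. b y / a y)"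
    using continuous_on_subset[OF a(1) sub] continuous_on_subset[OF b sub] a(2) sub
    by (intro continuous_on_divide) force+
  have "((\<lambda>s. LBINT y=ereal c..ereal s. b y / a y) has_vector_derivative b x / a x) (at x within {u..v})"
    using e(1) by (intro interval_integral_FTC2 ab) (auto simp: u_def v_def)
  then have "continuous (at x within {u..v}) (\<lambda>s. LBINT y=ereal c..ereal s. b y / a y)"
    by (rule has_vector_derivative_continuous)
  moreover have "at x within {u..v} = at x"
    using e(1) by (intro at_within_interior) (auto simp: u_def v_def)
  ultimately have "isCont (\<lambda>s. LBINT y=ereal c..ereal s. b y / a y) x" by simp
  then show "isCont (scale_deriv a b c) x"
    unfolding scale_deriv_def[abs_def] by (intro continuous_intros)
qed

text \<open>What the two locales ask of the measure. Singletons are null because Lebesgue measure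
  has no atoms, and open sets are charged because the density is strictly positive.\<close>

lemma speed_measure_properties:
  assumes a: "continuous_on (einterval l r) a" "\<And>x. x \<in> einterval l r \<Longrightarrow> 0 < a x"
    and b: "continuous_on (einterval l r) b" and c: "c \<in> einterval l r"
  shows "sets (speed_measure l r a b c) = sets (restrict_space borel (einterval l r))"
    and "sigma_finite_measure (speed_measure l r a b c)"
    and "AE x in speed_measure l r a b c. x \<noteq> y"
    and "open U \<Longrightarrow> U \<subseteq> einterval l r \<Longrightarrow> U \<noteq> {} \<Longrightarrow> emeasure (speed_measure l r a b c) U \<noteq> 0"
proof -
  let ?J = "einterval l r"
  let ?L = "restrict_space lborel ?J"
  have sets_L: "sets ?L = sets (restrict_space borel ?J)" by (rule sets_restrict_space_cong) simp
  then show "sets (speed_measure l r a b c) = sets (restrict_space borel ?J)" by (simp add: speed_measure_def)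
  have s: "0 < scale_deriv a b c x" for x by (simp add: scale_deriv_def)
  have pos: "0 < speed_density a b c x" if "x \<in> ?J" for x
    using s a(2)[OF that] by (simp add: speed_density_def)
  have "scale_deriv a b c x * a x \<noteq> 0" if "x \<in> ?J" for x using s[of x] a(2)[OF that] by simp
  then have "continuous_on ?J (speed_density a b c)"
    unfolding speed_density_def[abs_def]
    by (intro continuous_on_divide continuous_on_const continuous_on_mult a(1) continuous_scale_deriv[OF a b c]) auto
  then have "speed_density a b c \<in> borel_measurable (restrict_space borel ?J)"
    by (rule borel_measurable_continuous_on_restrict)
  then have dens[measurable]: "speed_density a b c \<in> borel_measurable ?L"
    by (simp add: measurable_cong_sets[OF sets_L refl])
  interpret L: sigma_finite_measure ?L
    by (rule sigma_finite_measure_restrict_space[OF lborel.sigma_finite_measure_axioms]) simp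
  show "sigma_finite_measure (speed_measure l r a b c)"
    unfolding speed_measure_def by (subst L.sigma_finite_iff_density_finite) auto
  show "AE x in speed_measure l r a b c. x \<noteq> y"
    unfolding speed_measure_def
    using AE_lborel_singleton[of y] by (auto simp: AE_density AE_restrict_space_iff elim!: eventually_mono)
  assume U: "open U" "U \<subseteq> ?J" "U \<noteq> {}"
  show "emeasure (speed_measure l r a b c) U \<noteq> 0"
  proof
    assume 0: "emeasure (speed_measure l r a b c) U = 0"
    have UL: "U \<in> sets ?L" using U unfolding sets_L by (subst sets_restrict_space_iff) auto
    then have "U \<in> null_sets (speed_measure l r a b c)" using 0 by (auto simp: speed_measure_def)
    then have "AE x in speed_measure l r a b c. x \<notin> U" by (rule AE_not_in)
    then have "AE x in lborel. x \<in> ?J \<longrightarrow> 0 < speed_density a b c x \<longrightarrow> x \<notin> U"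
      unfolding speed_measure_def by (simp add: AE_density AE_restrict_space_iff)
    then have AE: "AE x in lborel. x \<notin> U"
      using pos U(2) by (auto elim!: eventually_mono)
    obtain x e where x: "0 < e" "cball x e \<subseteq> U"
      using U open_contains_cball by (metis all_not_in_conv)
    have "AE t in lborel. t \<notin> {x - e..x + e}"
      using AE by eventually_elim (use x in \<open>auto simp: cball_eq_atLeastAtMost\<close>)
    then have "{x - e..x + e} \<in> null_sets lborel" by (subst AE_iff_null_sets) auto
    then have "emeasure lborel {x - e..x + e} = 0" by (rule null_setsD1)
    then show False using x(1) by (subst (asm) emeasure_lborel_Icc) auto
  qed
qed

theorem corollary3p37:
  fixes l r :: ereal and I :: "real set" and a b :: "real \<Rightarrow> real" and c :: real
    and Om :: "'w measure" and P :: "ereal \<Rightarrow> 'w measure" and X :: "real \<Rightarrow> 'w \<Rightarrow> ereal"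
    and q :: "real \<Rightarrow> real \<Rightarrow> real \<Rightarrow> real"
    and lam :: "nat \<Rightarrow> real" and \<phi> :: "nat \<Rightarrow> real \<Rightarrow> real" and n :: nat
  defines "m \<equiv> speed_measure l r a b c"
    and "h \<equiv> (\<lambda>x. Determinant.det (mat n n (\<lambda>(i, j). \<phi> i (x j))))"
  assumes "l < r"
    and "a C1_differentiable_on einterval l r"
    and "\<And>x. x \<in> einterval l r \<Longrightarrow> 0 < a x"
    and "continuous_on (einterval l r) b"
    and "c \<in> einterval l r"
    and "diffusion l r I Om P X"
    and "has_generator l r P X a b"
    and "has_transition_density l r Om P X m q"
    and "discrete_spectrum l r a b m q lam \<phi>"
    and "1 \<le> n"
  shows "\<exists>\<sigma>\<in>{1, -1}. is_ground_state (chamber_measure n m) (karlin_mcgregor_density n q)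
           (\<lambda>x. \<sigma> * h x) (\<Sum>i<n. lam i)"
proof -
  have a: "continuous_on (einterval l r) a"
    using assms(4) by (rule C1_differentiable_imp_continuous_on)
  note speed = speed_measure_properties[OF a assms(5-7), folded m_def]
  interpret M: sigma_finite_measure m by (rule speed(2))
  interpret discrete_diffusion l r I Om P X m a b q lam \<phi>
  proof
    show "diffusion l r I Om P X" by fact
    show "sets m = sets (restrict_space borel (einterval l r))" by (rule speed(1))
    show "emeasure m U \<noteq> 0" if "open U" "U \<subseteq> einterval l r" "U \<noteq> {}" for U
      using speed(4)[of U] that by blast
    show "has_transition_density l r Om P X m q" "discrete_spectrum l r a b m q lam \<phi>" by fact+
  qed
  interpret killed_diffusions l r I Om P X m a b q lam \<phi> n
  proof
    show "(\<lambda>x. x) \<in> borel_measurable m" by (rule id_M)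
    show "AE x in m. x \<noteq> y" for y by (rule speed(3))
    show "1 \<le> n" by fact
  qed
  have "h = alternant n \<phi>" by (rule ext) (simp add: h_def alternant_def)
  then show ?thesis using ground_state by simp
qed

end
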